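(* Let $n\ge 2$, let $\mathcal{H}_K=\mathcal{H}_{k_1}\otimes\cdots\otimes\mathcal{H}_{k_n}$ be an analytic Hilbert module over $\mathbb{C}[z_1,\dots,z_n]$, and let $\mathcal{Q}=\mathcal{Q}_1\otimes\cdots\otimes\mathcal{Q}_n$ be a doubly commuting quotient module of $\mathcal{H}_K$, where $\mathcal{Q}_i$ is a quotient module of $\mathcal{H}_{k_i}$ for each $i$. Then $\mathcal{Q}$ is essentially normal if and only if one of the following holds: (i) $\mathcal{Q}$ is finite dimensional. (ii) There exists $i\in\{1,\dots,n\}$ such that $\mathcal{Q}_i$ is an infinite dimensional essentially normal quotient module of $\mathcal{H}_{k_i}$, and $\mathcal{Q}_j\cong\mathbb{C}$ (i.e. $\dim\mathcal{Q}_j=1$) for all $j\ne i$.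
   Context: Let $k:\mathbb{D}\times\mathbb{D}\to\mathbb{C}$ be a positive definite function, analytic in the first variable and anti-analytic in the second, with reproducing kernel Hilbert space $\mathcal{H}_k$ of holomorphic functions on the open unit disc $\mathbb{D}$. $\mathcal{H}_k$ is a reproducing kernel Hilbert module over $\mathbb{C}[z]$ if multiplication $M_z$ by the coordinate is bounded on $\mathcal{H}_k$; it is an analytic Hilbert module over $\mathbb{C}[z]$ if moreover $k^{-1}(z,w)=1/k(z,w)$ is a polynomial in $z$ and $\bar w$. An analytic Hilbert module over $\mathbb{C}[z_1,\dots,z_n]$ is a Hilbert space tensor product $\mathcal{H}_{k_1}\otimes\cdots\otimes\mathcal{H}_{k_n}$ in which each $\mathcal{H}_{k_i}$ is an analytic Hilbert module over $\mathbb{C}[z]$; it is the reproducing kernel Hilbert space on $\mathbb{D}^n$ with kernel $\prod_i k_i(z_i,w_i)$, and $M_{z_i}$ is $M_z$ acting in the $i$-th tensor factor (identity in the others). A quotient module is a closed subspace $\mathcal{Q}$ whose orthogonal complement is invariant under all $M_{z_i}$; put $C_{z_i}=P_{\mathcal{Q}}M_{z_i}|_{\mathcal{Q}}$. $\mathcal{Q}$ is doubly commuting if $[C_{z_i},C_{z_j}^*]=0$ for all $1\le i<j\le n$; it is known that this holds if and only if $\mathcal{Q}=\mathcal{Q}_1\otimes\cdots\otimes\mathcal{Q}_n$ for some quotient modules $\mathcal{Q}_i$ of $\mathcal{H}_{k_i}$. $\mathcal{Q}$ is essentially normal if $[C_{z_i},C_{z_j}^*]$ is compact for all $1\le i,j\le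 n$ (for $n=1$: $[C_z,C_z^*]$ is compact). *)

theory Defs
  imports "HOL-Analysis.Analysis" "HOL-Library.Function_Algebras"
begin

section \<open>Hilbert spaces of complex-valued functions\<close>

text \<open>
  The underlying set of a Hilbert space of functions on a set \<open>X\<close> consists of total functions
  vanishing outside \<open>X\<close>, so that equality, addition and scaling are those of functions on \<open>X\<close>.
  The inner product is linear in its first argument.
\<close>

record 'x fun_hilbert =
  fset :: "('x \<Rightarrow> complex) set"
  finner :: "('x \<Rightarrow> complex) \<Rightarrow> ('x \<Rightarrow> complex) \<Rightarrow> complex"

definition cscale :: "complex \<Rightarrow> ('x \<Rightarrow> complex) \<Rightarrow> 'x \<Rightarrow> complex" where
  "cscale c f = (\<lambda>x. c * f x)"

global_interpretation cfun: vector_space "cscale :: complex \<Rightarrow> ('x \<Rightarrow> complex) \<Rightarrow> 'x \<Rightarrow> complex"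
  by standard (auto simp: cscale_def fun_eq_iff algebra_simps)

definition finite_dimensional :: "('x \<Rightarrow> complex) set \<Rightarrow> bool" where
  "finite_dimensional Q \<longleftrightarrow> (\<exists>B. finite B \<and> B \<subseteq> Q \<and> Q \<subseteq> cfun.span B)"

definition inner_product_on ::
  "('x \<Rightarrow> complex) set \<Rightarrow> (('x \<Rightarrow> complex) \<Rightarrow> ('x \<Rightarrow> complex) \<Rightarrow> complex) \<Rightarrow> bool" where
  "inner_product_on V ip \<longleftrightarrow>
     (\<forall>f\<in>V. \<forall>g\<in>V. \<forall>h\<in>V. ip (f + g) h = ip f h + ip g h) \<and>
     (\<forall>c. \<forall>f\<in>V. \<forall>g\<in>V. ip (cscale c f) g = c * ip f g) \<and>
     (\<forall>f\<in>V. \<forall>g\<in>V. ip g f = cnj (ip f g)) \<and>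
     (\<forall>f\<in>V. f \<noteq> 0 \<longrightarrow> 0 < Re (ip f f))"

definition fnorm :: "'x fun_hilbert \<Rightarrow> ('x \<Rightarrow> complex) \<Rightarrow> real" where
  "fnorm H f = sqrt (Re (finner H f f))"

text \<open>The value off the space is irrelevant, but \<^locale>\<open>Metric_space\<close> asks for symmetry and
  nonnegativity on the whole type.\<close>

definition fdist :: "'x fun_hilbert \<Rightarrow> ('x \<Rightarrow> complex) \<Rightarrow> ('x \<Rightarrow> complex) \<Rightarrow> real" where
  "fdist H f g = (if f \<in> fset H \<and> g \<in> fset H then fnorm H (f - g) else 0)"

definition ftopology :: "'x fun_hilbert \<Rightarrow> ('x \<Rightarrow> complex) topology" where
  "ftopology H = Metric_space.mtopology (fset H) (fdist H)"

definition hilbert_function_space :: "'x set \<Rightarrow> 'x fun_hilbert \<Rightarrow> bool" where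
  "hilbert_function_space X H \<longleftrightarrow>
     cfun.subspace (fset H) \<and>
     (\<forall>f\<in>fset H. \<forall>x. x \<notin> X \<longrightarrow> f x = 0) \<and>
     inner_product_on (fset H) (finner H) \<and>
     Metric_space.mcomplete (fset H) (fdist H)"

definition closed_subspace :: "'x fun_hilbert \<Rightarrow> ('x \<Rightarrow> complex) set \<Rightarrow> bool" where
  "closed_subspace H Q \<longleftrightarrow> cfun.subspace Q \<and> closedin (ftopology H) Q"

definition orth_complement ::
  "'x fun_hilbert \<Rightarrow> ('x \<Rightarrow> complex) set \<Rightarrow> ('x \<Rightarrow> complex) set" where
  "orth_complement H Q = {f \<in> fset H. \<forall>g\<in>Q. finner H f g = 0}"

definition orth_proj ::
  "'x fun_hilbert \<Rightarrow> ('x \<Rightarrow> complex) set \<Rightarrow> ('x \<Rightarrow> complex) \<Rightarrow> 'x \<Rightarrow> complex" where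
  "orth_proj H Q f = (THE g. g \<in> Q \<and> f - g \<in> orth_complement H Q)"

text \<open>Operators on a closed subspace \<open>Q\<close> are functions on the ambient type of which only the values
  on \<open>Q\<close> matter.\<close>

definition adjoint_on ::
  "'x fun_hilbert \<Rightarrow> ('x \<Rightarrow> complex) set \<Rightarrow> (('x \<Rightarrow> complex) \<Rightarrow> 'x \<Rightarrow> complex) \<Rightarrow>
   ('x \<Rightarrow> complex) \<Rightarrow> 'x \<Rightarrow> complex" where
  "adjoint_on H Q T g = (THE h. h \<in> Q \<and> (\<forall>f\<in>Q. finner H (T f) g = finner H f h))"

definition compact_operator_on ::
  "'x fun_hilbert \<Rightarrow> ('x \<Rightarrow> complex) set \<Rightarrow> (('x \<Rightarrow> complex) \<Rightarrow> 'x \<Rightarrow> complex) \<Rightarrow> bool" where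
  "compact_operator_on H Q T \<longleftrightarrow>
     T ` Q \<subseteq> Q \<and>
     compactin (ftopology H) (ftopology H closure_of (T ` {f \<in> Q. fnorm H f \<le> 1}))"

definition commutator ::
  "(('x \<Rightarrow> complex) \<Rightarrow> 'x \<Rightarrow> complex) \<Rightarrow> (('x \<Rightarrow> complex) \<Rightarrow> 'x \<Rightarrow> complex) \<Rightarrow>
   ('x \<Rightarrow> complex) \<Rightarrow> 'x \<Rightarrow> complex" where
  "commutator S T = (\<lambda>f. S (T f) - T (S f))"


section \<open>Reproducing kernels\<close>

definition positive_definite_kernel :: "'x set \<Rightarrow> ('x \<Rightarrow> 'x \<Rightarrow> complex) \<Rightarrow> bool" where
  "positive_definite_kernel X K \<longleftrightarrow>
     (\<forall>S c. finite S \<and> S \<subseteq> X \<longrightarrow>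
        (let s = (\<Sum>x\<in>S. \<Sum>y\<in>S. cnj (c x) * c y * K x y) in s \<in> \<real> \<and> 0 \<le> Re s))"

definition kernel_section :: "'x set \<Rightarrow> ('x \<Rightarrow> 'x \<Rightarrow> complex) \<Rightarrow> 'x \<Rightarrow> 'x \<Rightarrow> complex" where
  "kernel_section X K w = (\<lambda>z. if z \<in> X then K z w else 0)"

text \<open>\<open>H\<close> is the reproducing kernel Hilbert space of \<open>K\<close>; by the Moore--Aronszajn theorem it exists
  for every positive definite \<open>K\<close>, and its set and its inner product (on that set) are unique.\<close>

definition rkhs :: "'x set \<Rightarrow> ('x \<Rightarrow> 'x \<Rightarrow> complex) \<Rightarrow> 'x fun_hilbert \<Rightarrow> bool" where
  "rkhs X K H \<longleftrightarrow>
     hilbert_function_space X H \<and>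
     (\<forall>w\<in>X. kernel_section X K w \<in> fset H) \<and>
     (\<forall>f\<in>fset H. \<forall>w\<in>X. finner H f (kernel_section X K w) = f w)"

definition mult_op :: "('x \<Rightarrow> complex) \<Rightarrow> ('x \<Rightarrow> complex) \<Rightarrow> 'x \<Rightarrow> complex" where
  "mult_op \<phi> f = (\<lambda>x. \<phi> x * f x)"

definition bounded_multiplier :: "'x fun_hilbert \<Rightarrow> ('x \<Rightarrow> complex) \<Rightarrow> bool" where
  "bounded_multiplier H \<phi> \<longleftrightarrow>
     (\<forall>f\<in>fset H. mult_op \<phi> f \<in> fset H) \<and>
     (\<exists>C. \<forall>f\<in>fset H. fnorm H (mult_op \<phi> f) \<le> C * fnorm H f)"


section \<open>Quotient modules\<close>

text \<open>
  The module action is given by the set \<open>\<Phi>\<close> of coordinate functions: \<open>{\<lambda>z. z}\<close> on the disc,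
  \<open>{\<lambda>z. z i | 1 \<le> i \<le> n}\<close> on the polydisc.
\<close>

definition quotient_module ::
  "'x fun_hilbert \<Rightarrow> ('x \<Rightarrow> complex) set \<Rightarrow> ('x \<Rightarrow> complex) set \<Rightarrow> bool" where
  "quotient_module H \<Phi> Q \<longleftrightarrow>
     closed_subspace H Q \<and>
     (\<forall>\<phi>\<in>\<Phi>. \<forall>f\<in>orth_complement H Q. mult_op \<phi> f \<in> orth_complement H Q)"

definition compression ::
  "'x fun_hilbert \<Rightarrow> ('x \<Rightarrow> complex) set \<Rightarrow> ('x \<Rightarrow> complex) \<Rightarrow> ('x \<Rightarrow> complex) \<Rightarrow> 'x \<Rightarrow> complex" where
  "compression H Q \<phi> f = orth_proj H Q (mult_op \<phi> f)"

definition cross_commutator ::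
  "'x fun_hilbert \<Rightarrow> ('x \<Rightarrow> complex) set \<Rightarrow> ('x \<Rightarrow> complex) \<Rightarrow> ('x \<Rightarrow> complex) \<Rightarrow>
   ('x \<Rightarrow> complex) \<Rightarrow> 'x \<Rightarrow> complex" where
  "cross_commutator H Q \<phi> \<psi> =
     commutator (compression H Q \<phi>) (adjoint_on H Q (compression H Q \<psi>))"

definition essentially_normal ::
  "'x fun_hilbert \<Rightarrow> ('x \<Rightarrow> complex) set \<Rightarrow> ('x \<Rightarrow> complex) set \<Rightarrow> bool" where
  "essentially_normal H \<Phi> Q \<longleftrightarrow>
     (\<forall>\<phi>\<in>\<Phi>. \<forall>\<psi>\<in>\<Phi>. compact_operator_on H Q (cross_commutator H Q \<phi> \<psi>))"


section \<open>Analytic Hilbert modules over the disc and the polydisc\<close>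

abbreviation disc :: "complex set" where
  "disc \<equiv> ball 0 1"

definition analytic_kernel :: "(complex \<Rightarrow> complex \<Rightarrow> complex) \<Rightarrow> bool" where
  "analytic_kernel k \<longleftrightarrow>
     positive_definite_kernel disc k \<and>
     (\<forall>w\<in>disc. (\<lambda>z. k z w) holomorphic_on disc) \<and>
     (\<forall>z\<in>disc. (\<lambda>w. cnj (k z w)) holomorphic_on disc)"

definition inverse_polynomial_kernel :: "(complex \<Rightarrow> complex \<Rightarrow> complex) \<Rightarrow> bool" where
  "inverse_polynomial_kernel k \<longleftrightarrow>
     (\<forall>z\<in>disc. \<forall>w\<in>disc. k z w \<noteq> 0) \<and>
     (\<exists>(N::nat) (a :: nat \<Rightarrow> nat \<Rightarrow> complex). \<forall>z\<in>disc. \<forall>w\<in>disc.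
        1 / k z w = (\<Sum>p\<le>N. \<Sum>q\<le>N. a p q * z ^ p * cnj w ^ q))"

definition analytic_hilbert_module ::
  "(complex \<Rightarrow> complex \<Rightarrow> complex) \<Rightarrow> complex fun_hilbert \<Rightarrow> bool" where
  "analytic_hilbert_module k H \<longleftrightarrow>
     analytic_kernel k \<and> rkhs disc k H \<and>
     bounded_multiplier H (\<lambda>z. z) \<and> inverse_polynomial_kernel k"

text \<open>Points of the polydisc are functions on \<open>{1..n}\<close>, extended by \<^const>\<open>undefined\<close>.\<close>

definition polydisc :: "nat \<Rightarrow> (nat \<Rightarrow> complex) set" where
  "polydisc n = {1..n} \<rightarrow>\<^sub>E disc"

definition coord :: "nat \<Rightarrow> (nat \<Rightarrow> complex) \<Rightarrow> complex" where
  "coord i z = z i"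

definition coords :: "nat \<Rightarrow> ((nat \<Rightarrow> complex) \<Rightarrow> complex) set" where
  "coords n = coord ` {1..n}"

definition product_kernel ::
  "nat \<Rightarrow> (nat \<Rightarrow> complex \<Rightarrow> complex \<Rightarrow> complex) \<Rightarrow> (nat \<Rightarrow> complex) \<Rightarrow> (nat \<Rightarrow> complex) \<Rightarrow> complex" where
  "product_kernel n k z w = (\<Prod>i\<in>{1..n}. k i (z i) (w i))"

text \<open>The tensor product of the modules \<open>H i\<close> with kernels \<open>k i\<close> is realised as the reproducing kernel
  Hilbert space of the product kernel on the polydisc.\<close>

definition analytic_hilbert_module_polydisc ::
  "nat \<Rightarrow> (nat \<Rightarrow> complex \<Rightarrow> complex \<Rightarrow> complex) \<Rightarrow> (nat \<Rightarrow> complex fun_hilbert) \<Rightarrow>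
   (nat \<Rightarrow> complex) fun_hilbert \<Rightarrow> bool" where
  "analytic_hilbert_module_polydisc n k H HK \<longleftrightarrow>
     (\<forall>i\<in>{1..n}. analytic_hilbert_module (k i) (H i)) \<and>
     rkhs (polydisc n) (product_kernel n k) HK"

text \<open>Under this identification the elementary tensor of \<open>f 1, \<dots>, f n\<close> is the function
  \<open>z \<mapsto> f 1 (z 1) * \<dots> * f n (z n)\<close>.\<close>

definition elementary_tensor ::
  "nat \<Rightarrow> (nat \<Rightarrow> complex \<Rightarrow> complex) \<Rightarrow> (nat \<Rightarrow> complex) \<Rightarrow> complex" where
  "elementary_tensor n f = (\<lambda>z. if z \<in> polydisc n then \<Prod>i\<in>{1..n}. f i (z i) else 0)"

definition tensor_subspace ::
  "(nat \<Rightarrow> complex) fun_hilbert \<Rightarrow> nat \<Rightarrow> (nat \<Rightarrow> (complex \<Rightarrow> complex) set) \<Rightarrow>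
   ((nat \<Rightarrow> complex) \<Rightarrow> complex) set" where
  "tensor_subspace HK n Q =
     ftopology HK closure_of
       cfun.span {elementary_tensor n f | f. \<forall>i\<in>{1..n}. f i \<in> Q i}"

definition doubly_commuting ::
  "(nat \<Rightarrow> complex) fun_hilbert \<Rightarrow> nat \<Rightarrow> ((nat \<Rightarrow> complex) \<Rightarrow> complex) set \<Rightarrow> bool" where
  "doubly_commuting HK n Q \<longleftrightarrow>
     (\<forall>i\<in>{1..n}. \<forall>j\<in>{1..n}. i < j \<longrightarrow>
        (\<forall>f\<in>Q. cross_commutator HK Q (coord i) (coord j) f = 0))"

end

theory Submission
  imports Defs "HOL-Complex_Analysis.Great_Picard"
    "HOL-Computational_Algebra.Fundamental_Theorem_Algebra"
begin

text \<open>
  On elementary tensors the self-commutator of \<open>C\<^bsub>z\<^sub>j\<^esub>\<close> acts as \<open>[C\<^sub>z, C\<^sub>z\<^sup>*]\<close> in the \<open>j\<close>-th factor and as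
  the identity in the others. If some factor \<open>Q\<^sub>i\<close> is infinite dimensional, compactness therefore forces
  \<open>C\<^sub>z\<close> to be normal on every other \<open>Q\<^sub>j\<close>, and a nonzero quotient module of \<open>H\<^sub>j\<close> with normal
  compression is one dimensional: \<open>1/k\<close> is a polynomial, so a suitable hereditary polynomial in \<open>M\<^sub>z\<close> has
  rank one, \<open>U \<otimes> U\<close> say; by normality \<open>Q\<^sub>j \<inter> U\<^sup>\<bottom>\<close> reduces \<open>C\<^sub>z\<close>, and a polynomial identity for
  \<open>M\<^sub>z\<^sup>*\<close> on it would produce an eigenvector, which the rank one formula excludes unless the space is zero.
\<close>

section \<open>Hilbert spaces of functions\<close>

text \<open>The eigenvector step dictates the preparation of \<open>1/k\<close>. If h is orthogonal
  to U and an eigenvector of the adjoint with eigenvalue t, the rank one formula says P(z,t) h(z) =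
  0 on the disc, which forces h = 0 only if P(.,t) is not the zero polynomial. Multiplication by z
  may have norm above one, so t is not known to lie in the disc, and outside it \<open>1/k\<close>
  may vanish identically in z. Such factors are therefore divided out; U records what they leave
  behind in place of the constant 1. The tensor product is given only through its kernel. That
  elementary tensors have product inner products, and that the coordinates are bounded multipliers,
  is thus proved from the reproducing property and density. For the converse, fixed unit vectors in
  the one dimensional factors turn \<open>Qi i\<close> isometrically into all of \<open>Q\<close>,
  and compactness is transported along this map in the form of Cauchy subsequences, which mention
  only norms of differences.\<close>

locale hilbert_fun =
  fixes H :: "'x fun_hilbert"
  assumes subspace_fset: "cfun.subspace (fset H)"
    and inner_product_fset: "inner_product_on (fset H) (finner H)"
    and mcomplete_fset: "Metric_space.mcomplete (fset H) (fdist H)"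
begin

lemma zero_mem [simp]: "0 \<in> fset H"
  and add_mem [simp]: "f \<in> fset H \<Longrightarrow> g \<in> fset H \<Longrightarrow> f + g \<in> fset H"
  and diff_mem [simp]: "f \<in> fset H \<Longrightarrow> g \<in> fset H \<Longrightarrow> f - g \<in> fset H"
  and scale_mem [simp]: "f \<in> fset H \<Longrightarrow> cscale c f \<in> fset H"
  and sum_mem: "(\<And>i. i \<in> A \<Longrightarrow> h i \<in> fset H) \<Longrightarrow> sum h A \<in> fset H"
  using subspace_fset
  by (simp_all add: cfun.subspace_0 cfun.subspace_add cfun.subspace_diff cfun.subspace_scale
      cfun.subspace_sum)

lemma inner_add_left: "f \<in> fset H \<Longrightarrow> g \<in> fset H \<Longrightarrow> h \<in> fset H \<Longrightarrow>
    finner H (f + g) h = finner H f h + finner H g h"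
  using inner_product_fset[unfolded inner_product_on_def, THEN conjunct1] by simp

lemma inner_scale_left: "f \<in> fset H \<Longrightarrow> g \<in> fset H \<Longrightarrow>
    finner H (cscale c f) g = c * finner H f g"
  using inner_product_fset[unfolded inner_product_on_def, THEN conjunct2, THEN conjunct1] by simp

lemma inner_commute: "f \<in> fset H \<Longrightarrow> g \<in> fset H \<Longrightarrow> finner H g f = cnj (finner H f g)"
  using inner_product_fset[unfolded inner_product_on_def, THEN conjunct2, THEN conjunct2, THEN conjunct1]
  by blast

lemma inner_pos: "f \<in> fset H \<Longrightarrow> f \<noteq> 0 \<Longrightarrow> 0 < Re (finner H f f)"
  using inner_product_fset[unfolded inner_product_on_def, THEN conjunct2, THEN conjunct2, THEN conjunct2]
  by blast

lemma inner_add_right: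
  assumes "f \<in> fset H" "g \<in> fset H" "h \<in> fset H"
  shows "finner H f (g + h) = finner H f g + finner H f h"
  using assms inner_commute[of "g + h" f] inner_commute[of g f] inner_commute[of h f]
  by (simp add: inner_add_left)

lemma inner_scale_right:
  assumes "f \<in> fset H" "g \<in> fset H"
  shows "finner H f (cscale c g) = cnj c * finner H f g"
  using assms inner_commute[of "cscale c g" f] inner_commute[of g f]
  by (simp add: inner_scale_left)

lemma inner_zero_left [simp]: "f \<in> fset H \<Longrightarrow> finner H 0 f = 0"
  using inner_scale_left[of f f 0] by simp

lemma inner_zero_right [simp]: "f \<in> fset H \<Longrightarrow> finner H f 0 = 0"
  using inner_commute[of 0 f] by simp

lemma inner_diff_left:
  assumes "f \<in> fset H" "g \<in> fset H" "h \<in> fset H"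
  shows "finner H (f - g) h = finner H f h - finner H g h"
  using inner_add_left[of "f - g" g h] assms by simp

lemma inner_diff_right:
  assumes "f \<in> fset H" "g \<in> fset H" "h \<in> fset H"
  shows "finner H f (g - h) = finner H f g - finner H f h"
  using inner_add_right[of f "g - h" h] assms by simp

lemma inner_sum_left:
  assumes "\<And>i. i \<in> A \<Longrightarrow> f i \<in> fset H" "g \<in> fset H"
  shows "finner H (sum f A) g = (\<Sum>i\<in>A. finner H (f i) g)"
proof (cases "finite A")
  case True
  then show ?thesis using assms
    by (induction A rule: finite_induct) (simp_all add: inner_add_left sum_mem)
qed (use assms in simp)

lemma inner_sum_right:
  assumes "\<And>i. i \<in> A \<Longrightarrow> f i \<in> fset H" "g \<in> fset H"
  shows "finner H g (sum f A) = (\<Sum>i\<in>A. finner H g (f i))"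
proof -
  have "finner H g (sum f A) = cnj (\<Sum>i\<in>A. finner H (f i) g)"
    using assms by (subst inner_commute) (auto simp: sum_mem inner_sum_left)
  also have "\<dots> = (\<Sum>i\<in>A. finner H g (f i))"
    using assms by (auto simp: inner_commute[of _ g] intro!: sum.cong)
  finally show ?thesis .
qed

lemma inner_self: "f \<in> fset H \<Longrightarrow> finner H f f = of_real ((fnorm H f)\<^sup>2)"
proof -
  assume f: "f \<in> fset H"
  have "0 \<le> Re (finner H f f)"
    using f inner_pos[of f] by (cases "f = 0") auto
  moreover have "Im (finner H f f) = 0"
    using arg_cong[OF inner_commute[OF f f], of Im] by simp
  ultimately show ?thesis
    by (simp add: fnorm_def complex_eq_iff)
qed

lemma fnorm_nonneg [simp]: "f \<in> fset H \<Longrightarrow> 0 \<le> fnorm H f"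
  using inner_pos[of f] by (cases "f = 0") (auto simp: fnorm_def)

lemma fnorm_zero [simp]: "fnorm H 0 = 0"
  by (simp add: fnorm_def)

lemma fnorm_eq_0_iff: "f \<in> fset H \<Longrightarrow> fnorm H f = 0 \<longleftrightarrow> f = 0"
  using inner_pos[of f] by (cases "f = 0") (auto simp: fnorm_def)

lemma inner_self_eq_0_iff: "f \<in> fset H \<Longrightarrow> finner H f f = 0 \<longleftrightarrow> f = 0"
  by (simp add: inner_self fnorm_eq_0_iff)

lemma fnorm_scale:
  assumes "f \<in> fset H"
  shows "fnorm H (cscale c f) = cmod c * fnorm H f"
proof -
  have "finner H (cscale c f) (cscale c f) = of_real ((cmod c)\<^sup>2) * finner H f f"
    using assms by (simp add: inner_scale_left inner_scale_right complex_norm_square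
        mult.assoc mult.left_commute del: of_real_power)
  then show ?thesis
    by (simp add: fnorm_def real_sqrt_mult)
qed

lemma fnorm_sq: "f \<in> fset H \<Longrightarrow> (fnorm H f)\<^sup>2 = Re (finner H f f)"
  by (simp add: inner_self)

lemma fnorm_add_sq:
  assumes "f \<in> fset H" "g \<in> fset H"
  shows "(fnorm H (f + g))\<^sup>2 = (fnorm H f)\<^sup>2 + (fnorm H g)\<^sup>2 + 2 * Re (finner H f g)"
  using assms inner_commute[of f g] by (simp add: fnorm_sq inner_add_left inner_add_right)

lemma fnorm_diff_sq:
  assumes "f \<in> fset H" "g \<in> fset H"
  shows "(fnorm H (f - g))\<^sup>2 = (fnorm H f)\<^sup>2 + (fnorm H g)\<^sup>2 - 2 * Re (finner H f g)"
  using assms inner_commute[of f g] by (simp add: fnorm_sq inner_diff_left inner_diff_right)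

lemma Cauchy_Schwarz:
  assumes f: "f \<in> fset H" and g: "g \<in> fset H"
  shows "cmod (finner H f g) \<le> fnorm H f * fnorm H g"
proof (cases "g = 0")
  case False
  define N where "N = (fnorm H g)\<^sup>2"
  have N: "N > 0" using False g by (simp add: N_def fnorm_eq_0_iff)
  \<comment> \<open>This is the coefficient of the projection of f to the line through g, where the
    norm of f - c g is least.\<close>
  define c where "c = finner H f g / of_real N"
  have "0 \<le> (fnorm H (f - cscale c g))\<^sup>2" by simp
  also have "\<dots> = (fnorm H f)\<^sup>2 + (cmod c)\<^sup>2 * N - 2 * Re (cnj c * finner H f g)"
    using f g by (simp add: fnorm_diff_sq fnorm_scale inner_scale_right power_mult_distrib N_def)
  also have "cnj c * finner H f g = of_real ((cmod (finner H f g))\<^sup>2 / N)"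
    by (simp add: c_def complex_norm_square mult.commute del: of_real_power)
  also have "(cmod c)\<^sup>2 * N = (cmod (finner H f g))\<^sup>2 / N"
    using N by (simp add: c_def norm_divide power_divide power2_eq_square)
  finally have "(cmod (finner H f g))\<^sup>2 \<le> (fnorm H f * fnorm H g)\<^sup>2"
    using N by (simp add: field_simps N_def power_mult_distrib)
  then show ?thesis
    using f g by (meson fnorm_nonneg mult_nonneg_nonneg power2_le_imp_le)
qed (use f in simp)

lemma fnorm_triangle:
  assumes f: "f \<in> fset H" and g: "g \<in> fset H"
  shows "fnorm H (f + g) \<le> fnorm H f + fnorm H g"
proof (rule power2_le_imp_le)
  have "Re (finner H f g) \<le> fnorm H f * fnorm H g"
    using Cauchy_Schwarz[OF f g] complex_Re_le_cmod order_trans by blast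
  then show "(fnorm H (f + g))\<^sup>2 \<le> (fnorm H f + fnorm H g)\<^sup>2"
    using f g by (simp add: fnorm_add_sq power2_sum)
qed (use f g in simp)

lemma fnorm_minus_commute: "f \<in> fset H \<Longrightarrow> g \<in> fset H \<Longrightarrow> fnorm H (f - g) = fnorm H (g - f)"
  using fnorm_scale[of "g - f" "-1"] by simp

lemma fnorm_diff_triangle:
  assumes "f \<in> fset H" "g \<in> fset H" "h \<in> fset H"
  shows "fnorm H (f - h) \<le> fnorm H (f - g) + fnorm H (g - h)"
  using fnorm_triangle[of "f - g" "g - h"] assms by simp

lemma fnorm_diff_le:
  assumes "f \<in> fset H" "g \<in> fset H"
  shows "fnorm H (f - g) \<le> fnorm H f + fnorm H g"
  using fnorm_diff_triangle[of f 0 g] fnorm_minus_commute[of 0 g] assms by simp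

sublocale Metric_space "fset H" "fdist H"
  by unfold_locales
    (auto simp: Defs.fdist_def fnorm_minus_commute fnorm_diff_triangle fnorm_eq_0_iff)

section \<open>Norm convergence of sequences\<close>

definition flim :: "(nat \<Rightarrow> 'x \<Rightarrow> complex) \<Rightarrow> ('x \<Rightarrow> complex) \<Rightarrow> bool" where
  "flim s f \<longleftrightarrow> (\<forall>m. s m \<in> fset H) \<and> f \<in> fset H \<and> (\<lambda>m. fnorm H (s m - f)) \<longlonglongrightarrow> 0"

lemma ftopology_eq: "ftopology H = mtopology"
  by (simp add: ftopology_def)

lemma flim_inner:
  assumes "flim s f" "flim t g"
  shows "(\<lambda>m. finner H (s m) (t m)) \<longlonglongrightarrow> finner H f g"
proof -
  have mem: "\<And>m. s m \<in> fset H" "\<And>m. t m \<in> fset H" "f \<in> fset H" "g \<in> fset H"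
    using assms by (auto simp: flim_def)
  have s: "(\<lambda>m. fnorm H (s m - f)) \<longlonglongrightarrow> 0" and t: "(\<lambda>m. fnorm H (t m - g)) \<longlonglongrightarrow> 0"
    using assms by (auto simp: flim_def)
  have lim: "(\<lambda>m. fnorm H (s m - f) * (fnorm H (t m - g) + fnorm H g) + fnorm H f * fnorm H (t m - g)) \<longlonglongrightarrow> 0 * (0 + fnorm H g) + fnorm H f * 0"
    by (intro tendsto_intros s t)
  have bound: "norm (finner H (s m) (t m) - finner H f g)
      \<le> fnorm H (s m - f) * (fnorm H (t m - g) + fnorm H g) + fnorm H f * fnorm H (t m - g)" for m
  proof -
    have "finner H (s m) (t m) - finner H f g = finner H (s m - f) (t m) + finner H f (t m - g)"
      using mem by (simp add: inner_diff_left inner_diff_right)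
    also have "cmod \<dots> \<le> fnorm H (s m - f) * fnorm H (t m) + fnorm H f * fnorm H (t m - g)"
      using mem by (meson Cauchy_Schwarz add_mono diff_mem norm_triangle_le)
    also have "\<dots> \<le> fnorm H (s m - f) * (fnorm H (t m - g) + fnorm H g) + fnorm H f * fnorm H (t m - g)"
      using fnorm_triangle[of "t m - g" g] mem by (intro add_right_mono mult_left_mono) auto
    finally show ?thesis .
  qed
  have "(\<lambda>m. finner H (s m) (t m) - finner H f g) \<longlonglongrightarrow> 0"
    by (rule Lim_null_comparison[OF always_eventually[OF allI[OF bound]] lim[simplified]])
  then show ?thesis by (rule LIM_zero_cancel)
qed

lemma flim_const: "f \<in> fset H \<Longrightarrow> flim (\<lambda>_. f) f"
  by (simp add: flim_def)

lemma complete: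
  assumes "\<And>m. s m \<in> fset H"
    and "\<And>e. e > 0 \<Longrightarrow> \<exists>N. \<forall>m\<ge>N. \<forall>l\<ge>N. fnorm H (s m - s l) < e"
  obtains f where "flim s f"
proof -
  have "MCauchy s"
    unfolding MCauchy_def using assms by (simp add: Defs.fdist_def image_subset_iff)
  then obtain f where f: "limitin mtopology s f sequentially"
    using mcomplete_fset mcomplete_def by blast
  then have fH: "f \<in> fset H" by (simp add: limit_metric_sequentially)
  moreover have "(\<lambda>m. fnorm H (s m - f)) \<longlonglongrightarrow> 0"
    using f fH assms(1) by (simp add: LIMSEQ_iff limit_metric_sequentially Defs.fdist_def)
  ultimately show thesis using that assms(1) by (auto simp: flim_def)
qed

lemma flim_Cauchy:
  assumes "flim s f" "e > 0"
  shows "\<exists>N. \<forall>m\<ge>N. \<forall>l\<ge>N. fnorm H (s m - s l) < e"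
proof -
  have mem: "\<And>m. s m \<in> fset H" "f \<in> fset H" and lim: "(\<lambda>m. fnorm H (s m - f)) \<longlonglongrightarrow> 0"
    using assms by (auto simp: flim_def)
  obtain N where N: "\<forall>m\<ge>N. fnorm H (s m - f) < e / 2"
    using LIMSEQ_D[OF lim, of "e / 2"] \<open>e > 0\<close> mem by auto
  have "fnorm H (s m - s l) < e" if "m \<ge> N" "l \<ge> N" for m l
  proof -
    have "fnorm H (s m - s l) \<le> fnorm H (s m - f) + fnorm H (f - s l)"
      by (rule fnorm_diff_triangle) (use mem in auto)
    also have "\<dots> < e / 2 + e / 2"
      using N that mem by (metis add_strict_mono fnorm_minus_commute)
    finally show ?thesis by simp
  qed
  then show ?thesis by blast
qed

lemma closure_of_iff_flim:
  assumes "S \<subseteq> fset H"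
  shows "f \<in> ftopology H closure_of S \<longleftrightarrow> (\<exists>s. (\<forall>m. s m \<in> S) \<and> flim s f)"
proof
  assume "f \<in> ftopology H closure_of S"
  then have f: "f \<in> fset H" and "\<forall>r>0. \<exists>y\<in>S. y \<in> mball f r"
    by (auto simp: ftopology_eq metric_closure_of)
  then have "\<exists>y\<in>S. fnorm H (f - y) < 1 / real (Suc m)" for m
    by (auto simp: Defs.fdist_def) (metis of_nat_0_less_iff zero_less_Suc zero_less_divide_1_iff of_nat_Suc)
  then obtain s where s: "\<And>m. s m \<in> S" "\<And>m. fnorm H (f - s m) < 1 / real (Suc m)"
    by metis
  have "(\<lambda>m. fnorm H (s m - f)) \<longlonglongrightarrow> 0"
  proof (rule tendsto_sandwich[OF _ _ tendsto_const LIMSEQ_Suc[OF lim_1_over_n]])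
    show "\<forall>\<^sub>F m in sequentially. fnorm H (s m - f) \<le> 1 / of_nat (Suc m)"
      using s f assms by (intro always_eventually allI) (metis fnorm_minus_commute less_eq_real_def subsetD)
    show "\<forall>\<^sub>F m in sequentially. 0 \<le> fnorm H (s m - f)"
      using s f assms by (intro always_eventually allI) (meson diff_mem fnorm_nonneg subsetD)
  qed
  then show "\<exists>s. (\<forall>m. s m \<in> S) \<and> flim s f"
    using s f assms by (auto simp: flim_def)
next
  assume "\<exists>s. (\<forall>m. s m \<in> S) \<and> flim s f"
  then obtain s where s: "\<And>m. s m \<in> S" "flim s f" by blast
  show "f \<in> ftopology H closure_of S"
    unfolding ftopology_eq metric_closure_of
  proof (clarify, intro conjI allI impI)
    show f: "f \<in> fset H" using s by (auto simp: flim_def)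
    fix r :: real assume "r > 0"
    then obtain N where "fnorm H (s N - f) < r"
      using s(2) unfolding flim_def LIMSEQ_iff by fastforce
    then have "s N \<in> mball f r"
      using s assms f by (auto simp: Defs.fdist_def fnorm_minus_commute)
    then show "\<exists>y\<in>S. y \<in> mball f r" using s by blast
  qed
qed

text \<open>The sequential form in which closedness is used throughout. Inclusion in
  \<open>fset H\<close> comes with closedness, since that set carries the topology.\<close>

lemma closed_subspace_iff:
  "closed_subspace H Q \<longleftrightarrow>
     cfun.subspace Q \<and> Q \<subseteq> fset H \<and> (\<forall>s f. (\<forall>m. s m \<in> Q) \<and> flim s f \<longrightarrow> f \<in> Q)"
proof (cases "Q \<subseteq> fset H")
  case True
  have "closedin (ftopology H) Q \<longleftrightarrow> ftopology H closure_of Q \<subseteq> Q"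
    using True by (metis closure_of_subset_eq ftopology_eq topspace_mtopology)
  also have "\<dots> \<longleftrightarrow> (\<forall>s f. (\<forall>m. s m \<in> Q) \<and> flim s f \<longrightarrow> f \<in> Q)"
    using closure_of_iff_flim[OF True] by blast
  finally show ?thesis using True by (simp add: closed_subspace_def)
next
  case False
  then show ?thesis
    by (metis closed_subspace_def closedin_subset ftopology_eq topspace_mtopology)
qed

lemma closed_subspace_fset [simp]: "closed_subspace H (fset H)"
  by (auto simp: closed_subspace_iff subspace_fset flim_def)

lemma closed_subspaceD:
  assumes "closed_subspace H Q"
  shows "cfun.subspace Q" "Q \<subseteq> fset H" "\<And>s f. (\<And>m. s m \<in> Q) \<Longrightarrow> flim s f \<Longrightarrow> f \<in> Q"
  using assms closed_subspace_iff by blast+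

section \<open>Orthogonal projections and the Riesz representation theorem\<close>

lemma parallelogram:
  assumes "f \<in> fset H" "g \<in> fset H"
  shows "(fnorm H (f + g))\<^sup>2 + (fnorm H (f - g))\<^sup>2 = 2 * (fnorm H f)\<^sup>2 + 2 * (fnorm H g)\<^sup>2"
  using assms by (simp add: fnorm_add_sq fnorm_diff_sq)

text \<open>A minimising sequence is Cauchy by the parallelogram law; completeness supplies its
  limit, and closedness keeps the limit in \<open>Q\<close>.\<close>

lemma nearest_point:
  assumes Q: "closed_subspace H Q" and f: "f \<in> fset H"
  obtains g where "g \<in> Q" "\<And>h. h \<in> Q \<Longrightarrow> fnorm H (f - g) \<le> fnorm H (f - h)"
proof -
  note Q' = closed_subspaceD[OF Q]
  have Q0: "0 \<in> Q" using Q'(1) cfun.subspace_0 by blast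
  have QV: "\<And>g. g \<in> Q \<Longrightarrow> g \<in> fset H" using Q'(2) by blast
  define d where "d = (INF g\<in>Q. (fnorm H (f - g))\<^sup>2)"
  have bdd: "bdd_below ((\<lambda>g. (fnorm H (f - g))\<^sup>2) ` Q)"
    by (rule bdd_belowI[of _ 0]) auto
  have d_le: "d \<le> (fnorm H (f - g))\<^sup>2" if "g \<in> Q" for g
    unfolding d_def by (rule cINF_lower[OF bdd that])
  have "\<exists>g\<in>Q. (fnorm H (f - g))\<^sup>2 < d + 1 / real (Suc m)" for m
  proof (rule ccontr)
    assume "\<not> ?thesis"
    then have "d + 1 / real (Suc m) \<le> d"
      unfolding d_def by (intro cINF_greatest) (use Q0 in \<open>auto simp: not_less\<close>)
    then show False by (simp add: field_simps)
  qed
  then obtain s where s: "\<And>m. s m \<in> Q" "\<And>m. (fnorm H (f - s m))\<^sup>2 < d + 1 / real (Suc m)"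
    by metis
  have sV: "\<And>m. s m \<in> fset H" using s QV by blast
  have est: "(fnorm H (s m - s l))\<^sup>2 < 2 / real (Suc m) + 2 / real (Suc l)" for m l
  proof -
    define a b where "a = f - s m" and "b = f - s l"
    have ab: "a \<in> fset H" "b \<in> fset H" using f sV by (auto simp: a_def b_def)
    \<comment> \<open>The midpoint of \<open>s m\<close> and \<open>s l\<close> lies in
      \<open>Q\<close>, so its squared distance to f is at least \<open>d\<close>. This bounds the
      norm of a + b from below in the parallelogram law.\<close>
    have mid: "cscale (1/2) (s m + s l) \<in> Q"
      using s Q'(1) by (simp add: cfun.subspace_add cfun.subspace_scale)
    have "a + b = cscale 2 (f - cscale (1/2) (s m + s l))"
      by (simp add: a_def b_def cscale_def fun_eq_iff algebra_simps)
    then have "fnorm H (a + b) = 2 * fnorm H (f - cscale (1/2) (s m + s l))"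
      using mid f QV by (simp add: fnorm_scale)
    then have "(fnorm H (a + b))\<^sup>2 \<ge> 4 * d"
      using d_le[OF mid] by (simp add: power_mult_distrib)
    moreover have "a - b = - (s m - s l)" by (simp add: a_def b_def)
    then have "fnorm H (a - b) = fnorm H (s m - s l)"
      using sV by (metis diff_mem fnorm_minus_commute minus_diff_eq)
    ultimately show ?thesis
      using parallelogram[OF ab] s(2)[of m] s(2)[of l] by (simp add: a_def b_def)
  qed
  obtain g where g: "flim s g"
  proof (rule complete[of s])
    fix e :: real assume e: "e > 0"
    obtain N where N: "4 / e\<^sup>2 < real N" using reals_Archimedean2 by blast
    have "fnorm H (s m - s l) < e" if "m \<ge> N" "l \<ge> N" for m l
    proof (rule power2_less_imp_less)
      have "1 / real (Suc m) \<le> 1 / real (Suc N)" "1 / real (Suc l) \<le> 1 / real (Suc N)"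
        using that by (auto intro!: divide_left_mono)
      then have "(fnorm H (s m - s l))\<^sup>2 < 4 / real (Suc N)"
        using est[of m l] by simp
      also have "\<dots> < e\<^sup>2" using N e by (simp add: field_simps) (smt (verit) zero_less_power)
      finally show "(fnorm H (s m - s l))\<^sup>2 < e\<^sup>2" .
    qed (use e in simp)
    then show "\<exists>N. \<forall>m\<ge>N. \<forall>l\<ge>N. fnorm H (s m - s l) < e" by blast
  qed (use sV in auto)
  have gQ: "g \<in> Q" using Q'(3) s(1) g by blast
  have fg: "(fnorm H (f - g))\<^sup>2 \<le> d"
  proof (rule LIMSEQ_le)
    have "flim (\<lambda>m. f - s m) (f - g)"
      using g f sV by (auto simp: flim_def fnorm_minus_commute)
    from flim_inner[OF this this]
    have "(\<lambda>m. Re (finner H (f - s m) (f - s m))) \<longlonglongrightarrow> Re (finner H (f - g) (f - g))"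
      by (rule tendsto_Re)
    then show "(\<lambda>m. (fnorm H (f - s m))\<^sup>2) \<longlonglongrightarrow> (fnorm H (f - g))\<^sup>2"
      using f sV gQ QV by (simp add: fnorm_sq)
    show "(\<lambda>m. d + 1 / real (Suc m)) \<longlonglongrightarrow> d"
      using tendsto_add[OF tendsto_const LIMSEQ_Suc[OF lim_1_over_n]] by simp
    show "\<exists>N. \<forall>m\<ge>N. (fnorm H (f - s m))\<^sup>2 \<le> d + 1 / real (Suc m)"
      using s(2) less_imp_le by blast
  qed
  show thesis
  proof (rule that[OF gQ])
    fix h assume "h \<in> Q"
    then show "fnorm H (f - g) \<le> fnorm H (f - h)"
      using fg d_le[of h] f QV by (meson diff_mem fnorm_nonneg order_trans power2_le_imp_le)
  qed
qed

lemma projection_exists: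
  assumes Q: "closed_subspace H Q" and f: "f \<in> fset H"
  obtains g where "g \<in> Q" "f - g \<in> orth_complement H Q"
proof -
  note Q' = closed_subspaceD[OF Q]
  obtain g where g: "g \<in> Q" "\<And>h. h \<in> Q \<Longrightarrow> fnorm H (f - g) \<le> fnorm H (f - h)"
    using nearest_point[OF Q f] by blast
  have gV: "g \<in> fset H" using g Q'(2) by blast
  have "finner H (f - g) h = 0" if h: "h \<in> Q" for h
  proof (cases "h = 0")
    case False
    have hV: "h \<in> fset H" using h Q'(2) by blast
    define N where "N = (fnorm H h)\<^sup>2"
    have N: "N > 0" using False hV by (simp add: N_def fnorm_eq_0_iff)
    define w where "w = finner H (f - g) h"
    \<comment> \<open>Moving g by this multiple of h lowers the squared distance by |w|^2 / N, which
      minimality forbids unless w = 0.\<close>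
    define c where "c = w / of_real N"
    have "g + cscale c h \<in> Q" using g h Q'(1) by (simp add: cfun.subspace_add cfun.subspace_scale)
    from g(2)[OF this] have "fnorm H (f - g) \<le> fnorm H ((f - g) - cscale c h)"
      by (simp add: diff_diff_eq)
    then have "(fnorm H (f - g))\<^sup>2 \<le> (fnorm H ((f - g) - cscale c h))\<^sup>2"
      using f gV by (intro power_mono) auto
    also have "\<dots> = (fnorm H (f - g))\<^sup>2 + (cmod c)\<^sup>2 * N - 2 * Re (cnj c * w)"
      using f gV hV by (simp add: fnorm_diff_sq[of "f - g"] fnorm_scale inner_scale_right
          power_mult_distrib N_def w_def)
    also have "cnj c * w = of_real ((cmod w)\<^sup>2 / N)"
      by (simp add: c_def complex_norm_square mult.commute del: of_real_power)
    also have "(cmod c)\<^sup>2 * N = (cmod w)\<^sup>2 / N"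
      using N by (simp add: c_def norm_divide power_divide power2_eq_square)
    finally have "(cmod w)\<^sup>2 / N \<le> 0" by simp
    then show ?thesis using N by (simp add: w_def divide_le_0_iff)
  qed (use f gV in simp)
  then show thesis using that g(1) f gV by (auto simp: orth_complement_def)
qed

lemma orth_proj_unique:
  assumes Q: "closed_subspace H Q" and "g \<in> Q" "f - g \<in> orth_complement H Q"
  shows "orth_proj H Q f = g"
  unfolding orth_proj_def
proof (rule the_equality)
  note Q' = closed_subspaceD[OF Q]
  fix h assume h: "h \<in> Q \<and> f - h \<in> orth_complement H Q"
  have "h - g \<in> Q" using h assms Q'(1) by (simp add: cfun.subspace_diff)
  moreover have mem: "f - g \<in> fset H" "f - h \<in> fset H"
    using h assms by (auto simp: orth_complement_def)
  have "finner H (h - g) q = 0" if "q \<in> Q" for q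
  proof -
    have "h - g = (f - g) - (f - h)" by simp
    then show ?thesis
      using h assms that Q'(2) mem inner_diff_left[of "f - g" "f - h" q]
      by (auto simp: orth_complement_def)
  qed
  ultimately have "finner H (h - g) (h - g) = 0" by blast
  then show "h = g"
    using Q'(2) \<open>h - g \<in> Q\<close> by (subst (asm) inner_self_eq_0_iff) auto
qed (use assms in auto)

lemma orth_proj:
  assumes Q: "closed_subspace H Q" and f: "f \<in> fset H"
  shows orth_proj_mem: "orth_proj H Q f \<in> Q"
    and orth_proj_compl: "f - orth_proj H Q f \<in> orth_complement H Q"
  using projection_exists[OF Q f] orth_proj_unique[OF Q] by metis+

lemma orth_proj_mem_fset:
  "closed_subspace H Q \<Longrightarrow> f \<in> fset H \<Longrightarrow> orth_proj H Q f \<in> fset H"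
  using orth_proj_mem closed_subspaceD(2) by blast

lemma inner_orth_proj:
  assumes Q: "closed_subspace H Q" and f: "f \<in> fset H" and g: "g \<in> Q"
  shows "finner H (orth_proj H Q f) g = finner H f g"
    and "finner H g (orth_proj H Q f) = finner H g f"
proof -
  have gV: "g \<in> fset H" using closed_subspaceD(2)[OF Q] g by blast
  have "finner H (f - orth_proj H Q f) g = 0"
    using orth_proj_compl[OF Q f] g by (auto simp: orth_complement_def)
  then show 1: "finner H (orth_proj H Q f) g = finner H f g"
    using f gV orth_proj_mem_fset[OF Q f] by (simp add: inner_diff_left)
  show "finner H g (orth_proj H Q f) = finner H g f"
    using 1 f gV orth_proj_mem_fset[OF Q f] inner_commute by metis
qed

lemma fnorm_orth_proj_le:
  assumes Q: "closed_subspace H Q" and f: "f \<in> fset H"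
  shows "fnorm H (orth_proj H Q f) \<le> fnorm H f"
proof -
  let ?p = "orth_proj H Q f"
  have p: "?p \<in> fset H" "?p \<in> Q" using orth_proj_mem_fset[OF Q f] orth_proj_mem[OF Q f] by auto
  have "(fnorm H ?p)\<^sup>2 = Re (finner H f ?p)"
    using p inner_orth_proj(1)[OF Q f p(2)] by (simp add: fnorm_sq)
  also have "\<dots> \<le> fnorm H f * fnorm H ?p"
    using Cauchy_Schwarz[OF f p(1)] complex_Re_le_cmod order_trans by blast
  finally show ?thesis
    using p f fnorm_nonneg[OF p(1)]
    by (cases "fnorm H ?p = 0") (auto simp: power2_eq_square mult_le_cancel_right)
qed

lemma subspace_orth_complement:
  assumes "Q \<subseteq> fset H" shows "cfun.subspace (orth_complement H Q)"
  using assms by (auto simp: cfun.subspace_def orth_complement_def inner_add_left inner_scale_left subset_iff)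

lemma closed_subspace_orthogonal_in:
  assumes Q: "closed_subspace H Q" and A: "A \<subseteq> fset H"
  shows "closed_subspace H {f \<in> Q. \<forall>g\<in>A. finner H f g = 0}"
proof -
  note Q' = closed_subspaceD[OF Q]
  have "f \<in> Q \<and> (\<forall>g\<in>A. finner H f g = 0)"
    if s: "\<And>m. s m \<in> {f \<in> Q. \<forall>g\<in>A. finner H f g = 0}" "flim s f" for s f
  proof
    show "f \<in> Q" using Q'(3)[of s f] s by auto
    show "\<forall>g\<in>A. finner H f g = 0"
    proof
      fix g assume g: "g \<in> A"
      have "(\<lambda>m. finner H (s m) g) \<longlonglongrightarrow> finner H f g"
        using flim_inner[OF s(2) flim_const] g A by blast
      moreover have "(\<lambda>m. finner H (s m) g) = (\<lambda>_. 0)" using s(1) g by auto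
      ultimately show "finner H f g = 0" by (simp add: LIMSEQ_const_iff)
    qed
  qed
  moreover have "cfun.subspace {f \<in> Q. \<forall>g\<in>A. finner H f g = 0}"
    using Q' A by (auto simp: cfun.subspace_def inner_add_left inner_scale_left subset_iff)
  ultimately show ?thesis using Q'(2) unfolding closed_subspace_iff by blast
qed

text \<open>A closed subspace is its own double orthogonal complement: the residual of the
  projection is orthogonal both to f and to the projection of f, hence to itself.\<close>

lemma in_closed_subspaceI:
  assumes Q: "closed_subspace H Q" and f: "f \<in> fset H"
    and orth: "\<And>g. g \<in> orth_complement H Q \<Longrightarrow> finner H f g = 0"
  shows "f \<in> Q"
proof -
  let ?p = "orth_proj H Q f"
  have p: "?p \<in> fset H" "?p \<in> Q" "f - ?p \<in> orth_complement H Q"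
    using orth_proj_mem_fset[OF Q f] orth_proj[OF Q f] by auto
  have "finner H (f - ?p) (f - ?p) = finner H f (f - ?p) - finner H ?p (f - ?p)"
    using p f by (simp add: inner_diff_left)
  also have "\<dots> = 0"
    using orth[OF p(3)] inner_commute[of "f - ?p" ?p] p f by (auto simp: orth_complement_def)
  finally show ?thesis using p f by (simp add: inner_self_eq_0_iff)
qed

lemma inner_ext:
  assumes "cfun.subspace Q" "Q \<subseteq> fset H" "f \<in> Q" "g \<in> Q"
    and "\<And>h. h \<in> Q \<Longrightarrow> finner H h f = finner H h g"
  shows "f = g"
proof -
  have "f - g \<in> Q" using assms by (simp add: cfun.subspace_diff)
  then have "finner H (f - g) (f - g) = 0"
    using assms by (simp add: inner_diff_right subset_iff)
  then show ?thesis using assms inner_self_eq_0_iff[of "f - g"] \<open>f - g \<in> Q\<close> by auto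
qed

text \<open>The residual r of a vector outside the null space N of the functional spans the
  orthogonal complement of N in \<open>Q\<close>, and a multiple of r represents the
  functional.\<close>

lemma Riesz_representation:
  assumes Q: "closed_subspace H Q"
    and add: "\<And>f g. f \<in> Q \<Longrightarrow> g \<in> Q \<Longrightarrow> \<phi> (f + g) = \<phi> f + \<phi> g"
    and scale: "\<And>c f. f \<in> Q \<Longrightarrow> \<phi> (cscale c f) = c * \<phi> f"
    and bound: "\<And>f. f \<in> Q \<Longrightarrow> cmod (\<phi> f) \<le> C * fnorm H f"
  obtains h where "h \<in> Q" "\<And>f. f \<in> Q \<Longrightarrow> \<phi> f = finner H f h"
proof -
  note Q' = closed_subspaceD[OF Q]
  have QV: "\<And>g. g \<in> Q \<Longrightarrow> g \<in> fset H" using Q'(2) by blast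
  have Qd: "\<And>f g. f \<in> Q \<Longrightarrow> g \<in> Q \<Longrightarrow> f - g \<in> Q" and Qs: "\<And>f c. f \<in> Q \<Longrightarrow> cscale c f \<in> Q"
    using Q'(1) by (simp_all add: cfun.subspace_diff cfun.subspace_scale)
  have diff: "\<phi> (f - g) = \<phi> f - \<phi> g" if "f \<in> Q" "g \<in> Q" for f g
    using add[of "f - g" g] that Qd by simp
  define N where "N = {f \<in> Q. \<phi> f = 0}"
  have "f \<in> N" if s: "\<And>m. s m \<in> N" "flim s f" for s f
  proof -
    have sQ: "\<And>m. s m \<in> Q" "\<And>m. \<phi> (s m) = 0" using s by (auto simp: N_def)
    then have fQ: "f \<in> Q" using Q'(3) s by blast
    have "(\<lambda>m. C * fnorm H (s m - f)) \<longlonglongrightarrow> C * 0"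
      using s(2) unfolding flim_def by (intro tendsto_intros) auto
    moreover have "cmod (\<phi> f) \<le> C * fnorm H (s m - f)" for m
      using bound[of "s m - f"] sQ fQ Qd by (simp add: diff)
    ultimately have "cmod (\<phi> f) \<le> C * 0"
      by (intro LIMSEQ_le_const[where X = "\<lambda>m. C * fnorm H (s m - f)"]) auto
    then show ?thesis using fQ by (simp add: N_def)
  qed
  moreover have "cfun.subspace N"
    using Q'(1) add scale scale[of 0 0] by (auto simp: cfun.subspace_def N_def)
  moreover have "N \<subseteq> fset H" using Q'(2) by (auto simp: N_def)
  ultimately have N: "closed_subspace H N"
    unfolding closed_subspace_iff by blast
  show thesis
  proof (cases "N = Q")
    case True
    then show thesis using that[of 0] Q'(1) QV by (auto simp: N_def cfun.subspace_0)
  next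
    case False
    then obtain f0 where f0: "f0 \<in> Q" "\<phi> f0 \<noteq> 0" by (auto simp: N_def)
    define p where "p = orth_proj H N f0"
    define r where "r = f0 - p"
    have p: "p \<in> N" "r \<in> orth_complement H N"
      using orth_proj[OF N] f0 QV by (auto simp: p_def r_def)
    then have pQ: "p \<in> Q" "\<phi> p = 0" by (auto simp: N_def)
    then have r: "r \<in> Q" "\<phi> r \<noteq> 0" using f0 Qd by (auto simp: r_def diff)
    then have "r \<noteq> 0" using scale[of r 0] by auto
    then have nr: "finner H r r \<noteq> 0" using r QV by (simp add: inner_self_eq_0_iff)
    have cr: "cnj (finner H r r) = finner H r r" using r QV by (simp add: inner_self)
    show thesis
    proof (rule that)
      \<comment> \<open>The scalar is determined by the case f = r; it is conjugated because the
        inner product is antilinear in its second argument.\<close>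
      show "cscale (cnj (\<phi> r) / finner H r r) r \<in> Q" using r Qs by blast
      fix f assume f: "f \<in> Q"
      have "f - cscale (\<phi> f / \<phi> r) r \<in> N"
        using f r Qd Qs by (simp add: N_def diff scale)
      then have "finner H r (f - cscale (\<phi> f / \<phi> r) r) = 0"
        using p by (auto simp: orth_complement_def)
      then have "finner H (f - cscale (\<phi> f / \<phi> r) r) r = 0"
        using inner_commute[of r "f - cscale (\<phi> f / \<phi> r) r"] f r QV by simp
      then have "finner H f r = \<phi> f / \<phi> r * finner H r r"
        using f r QV by (simp add: inner_diff_left inner_scale_left)
      then show "\<phi> f = finner H f (cscale (cnj (\<phi> r) / finner H r r) r)"
        using f r QV nr by (simp add: inner_scale_right cr)
    qed
  qed
qed

section \<open>Bounded operators on a subspace, adjoints and compressions\<close>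

definition bounded_op :: "('x \<Rightarrow> complex) set \<Rightarrow> (('x \<Rightarrow> complex) \<Rightarrow> 'x \<Rightarrow> complex) \<Rightarrow> bool" where
  "bounded_op Q T \<longleftrightarrow> (\<forall>f\<in>Q. T f \<in> Q) \<and> (\<forall>f\<in>Q. \<forall>g\<in>Q. T (f + g) = T f + T g) \<and>
     (\<forall>c. \<forall>f\<in>Q. T (cscale c f) = cscale c (T f)) \<and> (\<exists>C\<ge>0. \<forall>f\<in>Q. fnorm H (T f) \<le> C * fnorm H f)"

lemma bounded_opD:
  assumes "bounded_op Q T"
  shows "f \<in> Q \<Longrightarrow> T f \<in> Q" "f \<in> Q \<Longrightarrow> g \<in> Q \<Longrightarrow> T (f + g) = T f + T g"
    "f \<in> Q \<Longrightarrow> T (cscale c f) = cscale c (T f)"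
  using assms by (auto simp: bounded_op_def)

lemma bounded_op_bound:
  assumes "bounded_op Q T"
  obtains C where "C \<ge> 0" "\<And>f. f \<in> Q \<Longrightarrow> fnorm H (T f) \<le> C * fnorm H f"
  using assms by (auto simp: bounded_op_def)

lemma bounded_op_comp:
  assumes S: "bounded_op Q S" and T: "bounded_op Q T"
  shows "bounded_op Q (\<lambda>f. S (T f))"
proof -
  obtain C where C: "C \<ge> 0" "\<And>f. f \<in> Q \<Longrightarrow> fnorm H (S f) \<le> C * fnorm H f"
    using bounded_op_bound[OF S] by blast
  obtain D where D: "D \<ge> 0" "\<And>f. f \<in> Q \<Longrightarrow> fnorm H (T f) \<le> D * fnorm H f"
    using bounded_op_bound[OF T] by blast
  have "fnorm H (S (T f)) \<le> (C * D) * fnorm H f" if "f \<in> Q" for f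
  proof -
    have "fnorm H (S (T f)) \<le> C * fnorm H (T f)" using C(2) bounded_opD(1)[OF T that] .
    also have "\<dots> \<le> C * (D * fnorm H f)" using C(1) D(2)[OF that] by (rule mult_left_mono[rotated])
    finally show ?thesis by simp
  qed
  then show ?thesis
    unfolding bounded_op_def using C(1) D(1) bounded_opD[OF S] bounded_opD[OF T]
    by (simp add: exI[of _ "C * D"])
qed

lemma bounded_op_diff_op:
  assumes Q: "cfun.subspace Q" "Q \<subseteq> fset H" and S: "bounded_op Q S" and T: "bounded_op Q T"
  shows "bounded_op Q (\<lambda>f. S f - T f)"
proof -
  obtain C where C: "C \<ge> 0" "\<And>f. f \<in> Q \<Longrightarrow> fnorm H (S f) \<le> C * fnorm H f"
    using bounded_op_bound[OF S] by blast
  obtain D where D: "D \<ge> 0" "\<And>f. f \<in> Q \<Longrightarrow> fnorm H (T f) \<le> D * fnorm H f"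
    using bounded_op_bound[OF T] by blast
  have "fnorm H (S f - T f) \<le> (C + D) * fnorm H f" if "f \<in> Q" for f
  proof -
    have "fnorm H (S f - T f) \<le> fnorm H (S f) + fnorm H (T f)"
      using bounded_opD(1)[OF S that] bounded_opD(1)[OF T that] Q by (intro fnorm_diff_le) auto
    then show ?thesis using C(2)[OF that] D(2)[OF that] by (simp add: distrib_right)
  qed
  then show ?thesis
    unfolding bounded_op_def using C(1) D(1) bounded_opD[OF S] bounded_opD[OF T] Q
    by (simp add: exI[of _ "C + D"] cfun.subspace_diff cfun.scale_right_diff_distrib)
qed

lemma bounded_op_commutator:
  assumes "cfun.subspace Q" "Q \<subseteq> fset H" "bounded_op Q S" "bounded_op Q T"
  shows "bounded_op Q (commutator S T)"
  unfolding commutator_def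
  by (rule bounded_op_diff_op[OF assms(1,2) bounded_op_comp[OF assms(3,4)] bounded_op_comp[OF assms(4,3)]])

lemma adjoint_on_unique:
  assumes Q: "closed_subspace H Q" and "h \<in> Q"
    and "\<And>f. f \<in> Q \<Longrightarrow> finner H (T f) g = finner H f h"
  shows "adjoint_on H Q T g = h"
  unfolding adjoint_on_def
  using assms inner_ext[OF closed_subspaceD(1,2)[OF Q]] by (intro the_equality) auto

text \<open>Riesz representation provides the witness for the definite description in
  \<open>adjoint_on\<close>.\<close>

lemma adjoint_on:
  assumes Q: "closed_subspace H Q" and T: "bounded_op Q T" and g: "g \<in> Q"
  shows adjoint_on_mem: "adjoint_on H Q T g \<in> Q"
    and inner_adjoint_on: "f \<in> Q \<Longrightarrow> finner H f (adjoint_on H Q T g) = finner H (T f) g"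
proof -
  note Q' = closed_subspaceD[OF Q]
  have QV: "\<And>g. g \<in> Q \<Longrightarrow> g \<in> fset H" using Q'(2) by blast
  obtain C where C: "C \<ge> 0" "\<And>f. f \<in> Q \<Longrightarrow> fnorm H (T f) \<le> C * fnorm H f"
    using bounded_op_bound[OF T] by blast
  obtain h where h: "h \<in> Q" "\<And>f. f \<in> Q \<Longrightarrow> finner H (T f) g = finner H f h"
  proof (rule Riesz_representation[OF Q, where \<phi> = "\<lambda>f. finner H (T f) g" and C = "C * fnorm H g"])
    fix f assume f: "f \<in> Q"
    have "cmod (finner H (T f) g) \<le> fnorm H (T f) * fnorm H g"
      using bounded_opD(1)[OF T f] g QV by (intro Cauchy_Schwarz) auto
    also have "\<dots> \<le> C * fnorm H f * fnorm H g"
      using C(2)[OF f] g QV by (intro mult_right_mono) auto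
    finally show "cmod (finner H (T f) g) \<le> C * fnorm H g * fnorm H f" by (simp add: ac_simps)
  qed (use bounded_opD[OF T] g QV in \<open>auto simp: inner_add_left inner_scale_left\<close>)
  have "adjoint_on H Q T g = h" by (rule adjoint_on_unique[OF Q h])
  then show "adjoint_on H Q T g \<in> Q"
    "f \<in> Q \<Longrightarrow> finner H f (adjoint_on H Q T g) = finner H (T f) g" using h by auto
qed

lemma inner_adjoint_on_left:
  assumes Q: "closed_subspace H Q" and T: "bounded_op Q T" and g: "g \<in> Q" and f: "f \<in> Q"
  shows "finner H (adjoint_on H Q T g) f = finner H g (T f)"
proof -
  have QV: "\<And>g. g \<in> Q \<Longrightarrow> g \<in> fset H" using closed_subspaceD(2)[OF Q] by blast
  show ?thesis
    using inner_adjoint_on[OF Q T g f] inner_commute[of f "adjoint_on H Q T g"] inner_commute[of "T f" g]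
      adjoint_on_mem[OF Q T g] bounded_opD(1)[OF T f] f g QV by simp
qed

lemma bounded_op_adjoint_on:
  assumes Q: "closed_subspace H Q" and T: "bounded_op Q T"
  shows "bounded_op Q (adjoint_on H Q T)"
proof -
  note Q' = closed_subspaceD[OF Q]
  have QV: "\<And>g. g \<in> Q \<Longrightarrow> g \<in> fset H" using Q'(2) by blast
  note m = adjoint_on_mem[OF Q T] and i = inner_adjoint_on[OF Q T] and Tm = bounded_opD(1)[OF T]
  obtain C where C: "C \<ge> 0" "\<And>f. f \<in> Q \<Longrightarrow> fnorm H (T f) \<le> C * fnorm H f"
    using bounded_op_bound[OF T] by blast
  have "fnorm H (adjoint_on H Q T g) \<le> C * fnorm H g" if g: "g \<in> Q" for g
  proof -
    let ?a = "adjoint_on H Q T g"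
    have "(fnorm H ?a)\<^sup>2 = Re (finner H (T ?a) g)"
      using i[OF g m[OF g]] m[OF g] QV by (simp add: fnorm_sq)
    also have "\<dots> \<le> fnorm H (T ?a) * fnorm H g"
      using Cauchy_Schwarz[of "T ?a" g] complex_Re_le_cmod order_trans Tm m[OF g] g QV by blast
    also have "\<dots> \<le> (C * fnorm H ?a) * fnorm H g"
      using C(2) m[OF g] g QV by (intro mult_right_mono) auto
    finally have *: "fnorm H ?a * fnorm H ?a \<le> (C * fnorm H g) * fnorm H ?a"
      by (simp add: power2_eq_square ac_simps)
    have "0 \<le> fnorm H ?a" "0 \<le> C * fnorm H g" using C(1) m[OF g] g QV by auto
    then show ?thesis
      using * by (cases "fnorm H ?a = 0") (auto simp: mult_le_cancel_right)
  qed
  moreover have "adjoint_on H Q T (f + g) = adjoint_on H Q T f + adjoint_on H Q T g"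
    if "f \<in> Q" "g \<in> Q" for f g
    using that m QV Tm Q'(1)
    by (intro adjoint_on_unique[OF Q]) (auto simp: cfun.subspace_add inner_add_right i)
  moreover have "adjoint_on H Q T (cscale c g) = cscale c (adjoint_on H Q T g)" if "g \<in> Q" for c g
    using that m QV Tm Q'(1)
    by (intro adjoint_on_unique[OF Q]) (auto simp: cfun.subspace_scale inner_scale_right i)
  ultimately show ?thesis
    unfolding bounded_op_def using m C(1) by blast
qed

lemma bounded_op_compression:
  assumes Q: "closed_subspace H Q" and b: "bounded_multiplier H \<phi>"
  shows "bounded_op Q (compression H Q \<phi>)"
proof -
  note Q' = closed_subspaceD[OF Q]
  have QV: "\<And>g. g \<in> Q \<Longrightarrow> g \<in> fset H" using Q'(2) by blast
  obtain C where m: "\<And>f. f \<in> fset H \<Longrightarrow> mult_op \<phi> f \<in> fset H"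
    and C: "\<And>f. f \<in> fset H \<Longrightarrow> fnorm H (mult_op \<phi> f) \<le> C * fnorm H f"
    using b by (auto simp: bounded_multiplier_def)
  note p = orth_proj[OF Q] orth_proj_mem_fset[OF Q]
  have "compression H Q \<phi> f \<in> Q" if "f \<in> Q" for f
    using p m that QV by (auto simp: compression_def)
  moreover have "compression H Q \<phi> (f + g) = compression H Q \<phi> f + compression H Q \<phi> g"
    if "f \<in> Q" "g \<in> Q" for f g
  proof -
    have *: "mult_op \<phi> (f + g) = mult_op \<phi> f + mult_op \<phi> g"
      by (simp add: mult_op_def fun_eq_iff algebra_simps)
    have "mult_op \<phi> f + mult_op \<phi> g - (orth_proj H Q (mult_op \<phi> f) + orth_proj H Q (mult_op \<phi> g))
      = (mult_op \<phi> f - orth_proj H Q (mult_op \<phi> f)) + (mult_op \<phi> g - orth_proj H Q (mult_op \<phi> g))"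
      by simp
    also have "\<dots> \<in> orth_complement H Q"
      using p m that QV subspace_orth_complement[OF Q'(2)] by (intro cfun.subspace_add) auto
    finally show ?thesis
      unfolding compression_def *
      using p m that QV Q'(1) by (intro orth_proj_unique[OF Q]) (auto simp: cfun.subspace_add)
  qed
  moreover have "compression H Q \<phi> (cscale c f) = cscale c (compression H Q \<phi> f)" if "f \<in> Q" for c f
  proof -
    have *: "mult_op \<phi> (cscale c f) = cscale c (mult_op \<phi> f)"
      by (simp add: mult_op_def cscale_def fun_eq_iff)
    have "cscale c (mult_op \<phi> f) - cscale c (orth_proj H Q (mult_op \<phi> f))
      = cscale c (mult_op \<phi> f - orth_proj H Q (mult_op \<phi> f))"
      by (simp add: cfun.scale_right_diff_distrib)
    also have "\<dots> \<in> orth_complement H Q"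
      using p m that QV subspace_orth_complement[OF Q'(2)] by (intro cfun.subspace_scale) auto
    finally show ?thesis
      unfolding compression_def *
      using p m that QV Q'(1) by (intro orth_proj_unique[OF Q]) (auto simp: cfun.subspace_scale)
  qed
  \<comment> \<open>The constant of a \<open>bounded_multiplier\<close> may be negative when
    \<open>fset H\<close> is trivial, whereas \<open>bounded_op\<close> asks for a nonnegative one,
    so that bounds can be multiplied.\<close>
  moreover have "fnorm H (compression H Q \<phi> f) \<le> \<bar>C\<bar> * fnorm H f" if "f \<in> Q" for f
  proof -
    have "fnorm H (compression H Q \<phi> f) \<le> C * fnorm H f"
      unfolding compression_def
      using fnorm_orth_proj_le[OF Q, of "mult_op \<phi> f"] m C[of f] that QV by fastforce
    also have "\<dots> \<le> \<bar>C\<bar> * fnorm H f" using that QV by (intro mult_right_mono) auto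
    finally show ?thesis .
  qed
  ultimately show ?thesis
    unfolding bounded_op_def by (meson abs_ge_zero)
qed

lemma bounded_op_cross_commutator:
  assumes "closed_subspace H Q" "bounded_multiplier H \<phi>" "bounded_multiplier H \<psi>"
  shows "bounded_op Q (cross_commutator H Q \<phi> \<psi>)"
  unfolding cross_commutator_def
  by (rule bounded_op_commutator[OF closed_subspaceD(1,2)[OF assms(1)]
        bounded_op_compression[OF assms(1,2)]
        bounded_op_adjoint_on[OF assms(1) bounded_op_compression[OF assms(1,3)]]])

section \<open>Orthonormal systems and compact operators\<close>

definition orthonormal :: "('x \<Rightarrow> complex) set \<Rightarrow> bool" where
  "orthonormal E \<longleftrightarrow> E \<subseteq> fset H \<and> (\<forall>e\<in>E. \<forall>e'\<in>E. finner H e e' = (if e = e' then 1 else 0))"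

lemma span_subset_fset: "E \<subseteq> fset H \<Longrightarrow> cfun.span E \<subseteq> fset H"
  by (simp add: cfun.span_minimal subspace_fset)

lemma orthonormal_coefficient:
  assumes "finite E" "orthonormal E" "e \<in> E"
  shows "finner H (\<Sum>e\<in>E. cscale (c e) e) e = c e"
proof -
  have "finner H (\<Sum>e\<in>E. cscale (c e) e) e = (\<Sum>e'\<in>E. finner H (cscale (c e') e') e)"
    using assms by (intro inner_sum_left) (auto simp: orthonormal_def)
  also have "\<dots> = (\<Sum>e'\<in>E. if e' = e then c e' else 0)"
    using assms by (intro sum.cong) (auto simp: orthonormal_def inner_scale_left subset_iff)
  finally show ?thesis using assms by simp
qed

lemma orthonormal_expansion:
  assumes E: "finite E" "orthonormal E" and f: "f \<in> cfun.span E"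
  shows "f = (\<Sum>e\<in>E. cscale (finner H f e) e)"
proof -
  obtain c where c: "f = (\<Sum>e\<in>E. cscale (c e) e)"
    using f E(1) by (auto simp: cfun.span_finite)
  then have "finner H f e = c e" if "e \<in> E" for e
    using orthonormal_coefficient[OF E that] by simp
  then show ?thesis using c by simp
qed

text \<open>Only f has to lie in the span: the part of g off the span is orthogonal to f.\<close>

lemma Parseval_finite:
  assumes E: "finite E" "orthonormal E" and f: "f \<in> cfun.span E" and g: "g \<in> fset H"
  shows "finner H f g = (\<Sum>e\<in>E. finner H f e * cnj (finner H g e))"
proof -
  have EV: "\<And>e. e \<in> E \<Longrightarrow> e \<in> fset H" using E by (auto simp: orthonormal_def)
  have "finner H f g = finner H (\<Sum>e\<in>E. cscale (finner H f e) e) g"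
    using orthonormal_expansion[OF E f] by simp
  also have "\<dots> = (\<Sum>e\<in>E. finner H (cscale (finner H f e) e) g)"
    using g EV by (intro inner_sum_left) auto
  also have "\<dots> = (\<Sum>e\<in>E. finner H f e * cnj (finner H g e))"
    using g EV by (intro sum.cong) (auto simp: inner_scale_left inner_commute[OF g, symmetric])
  finally show ?thesis .
qed

lemma orthonormal_residual:
  assumes E: "finite E" "orthonormal E" and f: "f \<in> fset H" and e: "e \<in> E"
  shows "finner H (f - (\<Sum>e\<in>E. cscale (finner H f e) e)) e = 0"
proof -
  have EV: "\<And>e. e \<in> E \<Longrightarrow> e \<in> fset H" using E by (auto simp: orthonormal_def)
  have "(\<Sum>e\<in>E. cscale (finner H f e) e) \<in> fset H" using EV by (intro sum_mem) auto
  then show ?thesis using orthonormal_coefficient[OF E e, of "finner H f"] f EV[OF e]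
    by (simp add: inner_diff_left)
qed

text \<open>One Gram-Schmidt step. The two span memberships say that f and u can replace each other
  next to \<open>E\<close>.\<close>

lemma orthonormal_extend:
  assumes E: "finite E" "orthonormal E" and f: "f \<in> fset H" "f \<notin> cfun.span E"
  obtains u where "finner H u u = 1" "\<And>e. e \<in> E \<Longrightarrow> finner H u e = 0" "u \<in> cfun.span (insert f E)"
    "f \<in> cfun.span (insert u E)"
proof -
  have EV: "\<And>e. e \<in> E \<Longrightarrow> e \<in> fset H" using E by (auto simp: orthonormal_def)
  define p where "p = (\<Sum>e\<in>E. cscale (finner H f e) e)"
  define r where "r = f - p"
  have pspan: "p \<in> cfun.span E"
    unfolding p_def by (intro cfun.span_sum cfun.span_scale cfun.span_base)
  have r: "r \<in> fset H" "\<And>e. e \<in> E \<Longrightarrow> finner H r e = 0"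
    using orthonormal_residual[OF E f(1)] f EV
    by (auto simp: r_def p_def intro!: sum_mem diff_mem)
  have "r \<noteq> 0" using f pspan by (auto simp: r_def)
  define N where "N = fnorm H r"
  have N: "N > 0" "finner H r r = of_real (N\<^sup>2)"
    using r(1) \<open>r \<noteq> 0\<close> fnorm_eq_0_iff[OF r(1)] fnorm_nonneg[OF r(1)]
    by (simp_all add: N_def inner_self order_less_le)
  define u where "u = cscale (1 / of_real N) r"
  show thesis
  proof (rule that)
    show "finner H u u = 1"
      using r N by (simp add: u_def inner_scale_left inner_scale_right power2_eq_square)
    show "finner H u e = 0" if "e \<in> E" for e
      using r that EV by (simp add: u_def inner_scale_left)
    have *: "p \<in> cfun.span (insert x E)" for x
      using pspan cfun.span_mono[of E "insert x E"] by blast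
    show "u \<in> cfun.span (insert f E)"
      unfolding u_def r_def by (intro cfun.span_scale cfun.span_diff *) (simp add: cfun.span_base)
    have "f = cscale (of_real N) u + p"
      using N by (simp add: u_def r_def)
    then show "f \<in> cfun.span (insert u E)"
      using * by (metis cfun.span_add cfun.span_base cfun.span_scale insertI1)
  qed
qed

lemma orthonormal_insert:
  assumes "orthonormal E" "u \<in> fset H" "finner H u u = 1" "\<And>e. e \<in> E \<Longrightarrow> finner H u e = 0"
  shows "orthonormal (insert u E)"
proof -
  have "finner H e u = 0" if "e \<in> E" for e
    using assms that inner_commute[of u e] by (auto simp: orthonormal_def)
  then show ?thesis
    using assms unfolding orthonormal_def by (auto split: if_splits)
qed

lemma finite_orthonormal_basis:
  assumes "finite B" "B \<subseteq> fset H"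
  obtains E where "finite E" "orthonormal E" "cfun.span E = cfun.span B"
proof -
  have "\<exists>E. finite E \<and> orthonormal E \<and> cfun.span E = cfun.span B"
    using assms
  proof (induction B rule: finite_induct)
    case empty
    show ?case by (rule exI[of _ "{}"]) (simp add: orthonormal_def)
  next
    case (insert b B)
    then obtain E where E: "finite E" "orthonormal E" "cfun.span E = cfun.span B" by auto
    show ?case
    proof (cases "b \<in> cfun.span E")
      case True
      then have "cfun.span (insert b B) = cfun.span B"
        using E by (simp add: cfun.span_redundant)
      then show ?thesis using E by blast
    next
      case False
      have b: "b \<in> fset H" using insert by simp
      obtain u where u: "finner H u u = 1" "\<And>e. e \<in> E \<Longrightarrow> finner H u e = 0"
        "u \<in> cfun.span (insert b E)" "b \<in> cfun.span (insert u E)"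
        using orthonormal_extend[OF E(1,2) b False] by blast
      have uV: "u \<in> fset H"
        using u(3) span_subset_fset[of "insert b E"] b E(2) by (auto simp: orthonormal_def)
      have "cfun.span (insert u E) = cfun.span (insert b E)"
        using u(3,4) by (simp add: cfun.span_eq cfun.span_superset subset_iff cfun.span_base)
      also have "\<dots> = cfun.span (insert b B)"
        using E(3) by (metis cfun.span_insert)
      finally show ?thesis
        using E orthonormal_insert[OF E(2) uV u(1,2)] by (intro exI[of _ "insert u E"]) simp
    qed
  qed
  then show thesis using that by blast
qed

lemma finite_dimensional_basis:
  assumes Q: "cfun.subspace Q" "Q \<subseteq> fset H" and fin: "finite_dimensional Q"
  obtains E where "finite E" "orthonormal E" "E \<subseteq> Q" "Q = cfun.span E"
proof -
  obtain B where B: "finite B" "B \<subseteq> Q" "Q \<subseteq> cfun.span B"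
    using fin by (auto simp: finite_dimensional_def)
  then have QB: "Q = cfun.span B" using Q(1) by (metis cfun.span_minimal subset_antisym)
  obtain E where "finite E" "orthonormal E" "cfun.span E = cfun.span B"
    using finite_orthonormal_basis[OF B(1)] B(2) Q(2) by blast
  then show thesis using that[of E] QB cfun.span_superset by blast
qed

lemma infinite_orthonormal_sequence:
  assumes Q: "cfun.subspace Q" "Q \<subseteq> fset H" and inf: "\<not> finite_dimensional Q"
  obtains e :: "nat \<Rightarrow> 'x \<Rightarrow> complex" where "\<And>m. e m \<in> Q"
    "\<And>m l. finner H (e m) (e l) = (if m = l then 1 else 0)"
proof -
  \<comment> \<open>Orthogonality is recorded against earlier members only, which is all that a
    recursion on m can see; the other half follows by conjugate symmetry.\<close>
  define P where "P = (\<lambda>e (m::nat) u. u \<in> Q \<and> finner H u u = 1 \<and> (\<forall>l<m. finner H u (e l) = 0))"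
  have "\<exists>e. \<forall>m. P e m (e m)"
  proof (rule dependent_wellorder_choice)
    fix r and f g :: "nat \<Rightarrow> 'x \<Rightarrow> complex" and x
    assume "\<And>y. y < x \<Longrightarrow> f y = g y"
    then show "P f x r = P g x r" by (simp add: P_def)
  next
    fix x and f :: "nat \<Rightarrow> 'x \<Rightarrow> complex"
    assume f: "\<And>y. y < x \<Longrightarrow> P f y (f y)"
    define E where "E = f ` {..<x}"
    have EQ: "E \<subseteq> Q" using f by (auto simp: E_def P_def)
    have "finner H (f a) (f b) = 0" if "a < x" "b < x" "f a \<noteq> f b" for a b
    proof (cases "b < a")
      case True then show ?thesis using f that by (auto simp: P_def)
    next
      case False
      then have "a < b" using that by (metis linorder_neqE_nat)
      then have "finner H (f b) (f a) = 0" using f that by (auto simp: P_def)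
      then show ?thesis using inner_commute[of "f b" "f a"] f that Q(2) by (auto simp: P_def)
    qed
    then have E: "finite E" "orthonormal E"
      using f Q(2) EQ by (auto simp: orthonormal_def E_def P_def)
    \<comment> \<open>Finitely many earlier vectors cannot span \<open>Q\<close>, so the recursion
      never stops.\<close>
    have "\<not> Q \<subseteq> cfun.span E" using inf E(1) EQ by (auto simp: finite_dimensional_def)
    then obtain q where q: "q \<in> Q" "q \<notin> cfun.span E" by blast
    obtain u where u: "finner H u u = 1" "\<And>e. e \<in> E \<Longrightarrow> finner H u e = 0" "u \<in> cfun.span (insert q E)"
      using orthonormal_extend[OF E, of q] q Q(2) by blast
    have "u \<in> Q" using u(3) q(1) EQ Q(1) cfun.span_minimal[of "insert q E" Q] by blast
    then show "\<exists>r. P f x r" using u by (auto simp: P_def E_def)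
  qed
  then obtain e where e: "\<And>m. P e m (e m)" by blast
  show thesis
  proof (rule that)
    show eQ: "e m \<in> Q" for m using e[of m] by (simp add: P_def)
    show "finner H (e m) (e l) = (if m = l then 1 else 0)" for m l
    proof (cases m l rule: linorder_cases)
      case less
      then have "finner H (e l) (e m) = 0" using e[of l] by (simp add: P_def)
      then show ?thesis using less inner_commute[of "e l" "e m"] eQ Q(2) by auto
    qed (use e[of m] in \<open>auto simp: P_def\<close>)
  qed
qed

text \<open>In a complete space, compact closure amounts to total boundedness, which sequentially
  means Cauchy subsequences. The criterion involves only norms of differences, hence passes through
  isometries.\<close>

lemma compact_operator_on_iff:
  assumes Q: "Q \<subseteq> fset H"
  shows "compact_operator_on H Q T \<longleftrightarrow> T ` Q \<subseteq> Q \<and>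
    (\<forall>s. (\<forall>m. s m \<in> Q \<and> fnorm H (s m) \<le> 1) \<longrightarrow>
      (\<exists>r. strict_mono (r :: nat \<Rightarrow> nat) \<and>
        (\<forall>e>0. \<exists>N. \<forall>m\<ge>N. \<forall>l\<ge>N. fnorm H (T (s (r m)) - T (s (r l))) < e)))"
proof (cases "T ` Q \<subseteq> Q")
  case True
  let ?B = "{f \<in> Q. fnorm H f \<le> 1}"
  have TV: "\<And>f. f \<in> Q \<Longrightarrow> T f \<in> fset H" using True Q by blast
  have "compactin (ftopology H) (ftopology H closure_of (T ` ?B)) \<longleftrightarrow> mtotally_bounded (T ` ?B)"
    unfolding ftopology_eq
    using mtotally_bounded_eq_compact_closure_of[OF mcomplete_fset, of "T ` ?B"] TV by blast
  also have "\<dots> \<longleftrightarrow> (\<forall>\<sigma>. range \<sigma> \<subseteq> T ` ?B \<longrightarrow> (\<exists>r. strict_mono (r :: nat \<Rightarrow> nat) \<and> MCauchy (\<sigma> \<circ> r)))"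
    unfolding mtotally_bounded_sequentially using TV by blast
  also have "\<dots> \<longleftrightarrow> (\<forall>s. range s \<subseteq> ?B \<longrightarrow> (\<exists>r. strict_mono (r :: nat \<Rightarrow> nat) \<and> MCauchy (\<lambda>m. T (s (r m)))))"
  proof (intro iffI allI impI)
    fix s :: "nat \<Rightarrow> 'x \<Rightarrow> complex"
    assume 1: "\<forall>\<sigma>. range \<sigma> \<subseteq> T ` ?B \<longrightarrow> (\<exists>r. strict_mono (r :: nat \<Rightarrow> nat) \<and> MCauchy (\<sigma> \<circ> r))"
      and s: "range s \<subseteq> ?B"
    have "range (T \<circ> s) \<subseteq> T ` ?B" using s by auto
    from 1[rule_format, OF this] show "\<exists>r. strict_mono (r :: nat \<Rightarrow> nat) \<and> MCauchy (\<lambda>m. T (s (r m)))"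
      by (simp add: o_def)
  next
    fix \<sigma> :: "nat \<Rightarrow> 'x \<Rightarrow> complex"
    assume 1: "\<forall>s. range s \<subseteq> ?B \<longrightarrow> (\<exists>r. strict_mono (r :: nat \<Rightarrow> nat) \<and> MCauchy (\<lambda>m. T (s (r m))))"
      and \<sigma>: "range \<sigma> \<subseteq> T ` ?B"
    have "\<forall>m. \<exists>f. f \<in> ?B \<and> \<sigma> m = T f" using \<sigma> by blast
    then obtain s where s: "\<And>m. s m \<in> ?B" "\<And>m. \<sigma> m = T (s m)" by metis
    have "range s \<subseteq> ?B" using s(1) by blast
    from 1[rule_format, OF this] s(2)
    show "\<exists>r. strict_mono (r :: nat \<Rightarrow> nat) \<and> MCauchy (\<sigma> \<circ> r)"
      by (simp add: o_def)
  qed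
  also have "\<dots> \<longleftrightarrow> (\<forall>s. (\<forall>m. s m \<in> Q \<and> fnorm H (s m) \<le> 1) \<longrightarrow>
      (\<exists>r. strict_mono (r :: nat \<Rightarrow> nat) \<and>
        (\<forall>e>0. \<exists>N. \<forall>m\<ge>N. \<forall>l\<ge>N. fnorm H (T (s (r m)) - T (s (r l))) < e)))"
  proof (intro all_cong1 imp_cong ex_cong1 conj_cong refl)
    show "range s \<subseteq> ?B \<longleftrightarrow> (\<forall>m. s m \<in> Q \<and> fnorm H (s m) \<le> 1)" for s :: "nat \<Rightarrow> _"
      by auto
    fix s :: "nat \<Rightarrow> 'x \<Rightarrow> complex" and r :: "nat \<Rightarrow> nat"
    assume "\<forall>m. s m \<in> Q \<and> fnorm H (s m) \<le> 1"
    then have "\<And>m. T (s (r m)) \<in> fset H" using TV by blast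
    then show "MCauchy (\<lambda>m. T (s (r m))) \<longleftrightarrow>
        (\<forall>e>0. \<exists>N. \<forall>m\<ge>N. \<forall>l\<ge>N. fnorm H (T (s (r m)) - T (s (r l))) < e)"
      unfolding MCauchy_def by (simp add: Defs.fdist_def image_subset_iff)
  qed
  finally show ?thesis using True unfolding compact_operator_on_def by blast
qed (simp add: compact_operator_on_def)

lemma compact_operator_onD:
  assumes "Q \<subseteq> fset H" "compact_operator_on H Q T" "\<forall>m. s m \<in> Q \<and> fnorm H (s m) \<le> 1"
  shows "\<exists>r. strict_mono (r :: nat \<Rightarrow> nat) \<and>
    (\<forall>e>0. \<exists>N. \<forall>m\<ge>N. \<forall>l\<ge>N. fnorm H (T (s (r m)) - T (s (r l))) < e)"
  using compact_operator_on_iff[OF assms(1)] assms(2,3) by simp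

text \<open>The coordinates of the images in a finite orthonormal basis are bounded, so they
  converge along a common subsequence, and coordinatewise convergence is norm convergence.\<close>

lemma finite_dimensional_compact_operator:
  assumes Q: "cfun.subspace Q" "Q \<subseteq> fset H" and fin: "finite_dimensional Q" and T: "bounded_op Q T"
  shows "compact_operator_on H Q T"
  unfolding compact_operator_on_iff[OF Q(2)]
proof (intro conjI allI impI)
  show "T ` Q \<subseteq> Q" using bounded_opD(1)[OF T] by blast
  fix s :: "nat \<Rightarrow> 'x \<Rightarrow> complex"
  assume s: "\<forall>m. s m \<in> Q \<and> fnorm H (s m) \<le> 1"
  obtain E where E: "finite E" "orthonormal E" "E \<subseteq> Q" "Q = cfun.span E"
    using finite_dimensional_basis[OF Q fin] by blast
  have EV: "\<And>e. e \<in> E \<Longrightarrow> e \<in> fset H" using E(2) by (auto simp: orthonormal_def)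
  have En: "fnorm H e = 1" if "e \<in> E" for e
    using E(2) that by (auto simp: orthonormal_def fnorm_def)
  obtain C where C: "C \<ge> 0" "\<And>f. f \<in> Q \<Longrightarrow> fnorm H (T f) \<le> C * fnorm H f"
    using bounded_op_bound[OF T] by blast
  have TQ: "\<And>m. T (s m) \<in> Q" and TV: "\<And>m. T (s m) \<in> fset H"
    using bounded_opD(1)[OF T] s Q(2) by blast+
  have "norm (finner H (T (s m)) e) \<le> C" if e: "e \<in> E" for m e
  proof -
    have "norm (finner H (T (s m)) e) \<le> fnorm H (T (s m)) * fnorm H e"
      using TV EV[OF e] by (rule Cauchy_Schwarz)
    also have "\<dots> \<le> C * fnorm H (s m)" using C(2) s En[OF e] by simp
    also have "\<dots> \<le> C * 1" using s C(1) by (intro mult_left_mono) auto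
    finally show ?thesis by simp
  qed
  then obtain r :: "nat \<Rightarrow> nat" where r: "strict_mono r"
    "\<And>e. e \<in> E \<Longrightarrow> \<exists>l. (\<lambda>m. finner H (T (s (r m))) e) \<longlonglongrightarrow> l"
    using function_convergent_subsequence[of E "\<lambda>m e. finner H (T (s m)) e" C] countable_finite[OF E(1)]
    by blast
  then obtain a where a: "\<And>e. e \<in> E \<Longrightarrow> (\<lambda>m. finner H (T (s (r m))) e) \<longlonglongrightarrow> a e"
    by metis
  define g where "g = (\<Sum>e\<in>E. cscale (a e) e)"
  have gQ: "g \<in> cfun.span E"
    unfolding g_def by (intro cfun.span_sum cfun.span_scale cfun.span_base)
  then have gV: "g \<in> fset H" using E Q by blast
  have ge: "finner H g e = a e" if "e \<in> E" for e
    unfolding g_def by (rule orthonormal_coefficient[OF E(1,2) that])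
  have "fnorm H (T (s (r m)) - g) =
      sqrt (Re (\<Sum>e\<in>E. (finner H (T (s (r m))) e - a e) * cnj (finner H (T (s (r m))) e - a e)))" for m
  proof -
    have d: "T (s (r m)) - g \<in> cfun.span E" "T (s (r m)) - g \<in> fset H"
      using TQ[of "r m"] gQ E(4) TV gV by (auto simp: cfun.span_diff)
    have "finner H (T (s (r m)) - g) e = finner H (T (s (r m))) e - a e" if "e \<in> E" for e
      using that ge TV gV EV by (simp add: inner_diff_left)
    then show ?thesis
      unfolding fnorm_def using Parseval_finite[OF E(1,2) d] by simp
  qed
  moreover have "(\<lambda>m. sqrt (Re (\<Sum>e\<in>E. (finner H (T (s (r m))) e - a e) * cnj (finner H (T (s (r m))) e - a e))))
      \<longlonglongrightarrow> sqrt (Re (\<Sum>e\<in>E. (a e - a e) * cnj (a e - a e)))"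
    by (intro tendsto_intros a)
  ultimately have "flim (\<lambda>m. T (s (r m))) g"
    using TV gV by (simp add: flim_def)
  then show "\<exists>r. strict_mono (r :: nat \<Rightarrow> nat) \<and>
        (\<forall>e>0. \<exists>N. \<forall>m\<ge>N. \<forall>l\<ge>N. fnorm H (T (s (r m)) - T (s (r l))) < e)"
    using r(1) flim_Cauchy by blast
qed

end

section \<open>Reproducing kernel spaces\<close>

locale rk_space =
  fixes X :: "'x set" and K :: "'x \<Rightarrow> 'x \<Rightarrow> complex" and H :: "'x fun_hilbert"
  assumes rkhs: "rkhs X K H"
begin

sublocale hilbert_fun H
  using rkhs by unfold_locales (auto simp: rkhs_def hilbert_function_space_def)

abbreviation ker :: "'x \<Rightarrow> 'x \<Rightarrow> complex" where
  "ker \<equiv> kernel_section X K"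

lemma vanishes_outside: "f \<in> fset H \<Longrightarrow> x \<notin> X \<Longrightarrow> f x = 0"
  using rkhs by (auto simp: rkhs_def hilbert_function_space_def)

lemma kernel_mem [simp]: "w \<in> X \<Longrightarrow> ker w \<in> fset H"
  using rkhs by (auto simp: rkhs_def)

lemma inner_kernel: "f \<in> fset H \<Longrightarrow> w \<in> X \<Longrightarrow> finner H f (ker w) = f w"
  using rkhs by (auto simp: rkhs_def)

text \<open>Symmetry of the inner product read through the reproducing property. It later moves a
  common zero of \<open>1/k\<close> from one variable to the other.\<close>

lemma kernel_hermitian:
  assumes z: "z \<in> X" and w: "w \<in> X"
  shows "K w z = cnj (K z w)"
proof -
  have "finner H (ker z) (ker w) = cnj (finner H (ker w) (ker z))"
    using z w by (intro inner_commute) auto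
  then show ?thesis
    using z w inner_kernel[OF kernel_mem[OF w] z] inner_kernel[OF kernel_mem[OF z] w]
    by (simp only:) (simp add: kernel_section_def)
qed

lemma fset_ext: "f \<in> fset H \<Longrightarrow> g \<in> fset H \<Longrightarrow> (\<And>x. x \<in> X \<Longrightarrow> f x = g x) \<Longrightarrow> f = g"
  using vanishes_outside by (metis ext)

text \<open>Evaluation is an inner product, hence continuous. This identifies limits obtained from
  completeness with explicitly given functions.\<close>

lemma flim_pointwise:
  assumes "flim s f" shows "(\<lambda>m. s m x) \<longlonglongrightarrow> f x"
proof (cases "x \<in> X")
  case True
  have "f \<in> fset H" "\<And>m. s m \<in> fset H" using assms by (auto simp: flim_def)
  then show ?thesis
    using flim_inner[OF assms flim_const[OF kernel_mem[OF True]]] True by (simp add: inner_kernel)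
next
  case False
  have "f \<in> fset H" "\<And>m. s m \<in> fset H" using assms by (auto simp: flim_def)
  then show ?thesis using False by (simp add: vanishes_outside)
qed

text \<open>A function orthogonal to every kernel section vanishes at every point.\<close>

lemma kernels_generate:
  assumes Q: "closed_subspace H Q" and ker: "\<And>w. w \<in> X \<Longrightarrow> ker w \<in> Q"
  shows "Q = fset H"
proof (rule antisym)
  show "fset H \<subseteq> Q"
  proof
    fix f assume f: "f \<in> fset H"
    show "f \<in> Q"
    proof (rule in_closed_subspaceI[OF Q f])
      fix g assume g: "g \<in> orth_complement H Q"
      have "g = 0"
      proof (rule fset_ext)
        fix w assume "w \<in> X"
        then show "g w = 0 w" using g ker[of w] inner_kernel[of g w] by (auto simp: orth_complement_def)
      qed (use g in \<open>auto simp: orth_complement_def\<close>)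
      then show "finner H f g = 0" using f by simp
    qed
  qed
qed (use closed_subspaceD(2)[OF Q] in blast)

end

section \<open>Quotient modules over the disc\<close>

text \<open>Encoding of polynomials P(z,t) in two variables: the outer variable is t, later cnj w,
  and the coefficients are polynomials in z. So \<open>poly P [:t:]\<close> is P(.,t), and
  \<open>degree P\<close> is the degree in t.\<close>

lemma poly_poly_altdef:
  fixes P :: "complex poly poly"
  shows "poly (poly P [:t:]) z = (\<Sum>q\<le>degree P. poly (coeff P q) z * t ^ q)"
  by (simp add: poly_altdef[of P] poly_sum)

lemma infinite_disc: "infinite disc"
  by (rule uncountable_infinite[OF uncountable_ball]) simp

lemma poly_eq_on_infinite:
  fixes p q :: "complex poly"
  assumes "infinite S" "\<And>x. x \<in> S \<Longrightarrow> poly p x = poly q x"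
  shows "p = q"
proof (rule ccontr)
  assume "p \<noteq> q"
  then have "finite {x. poly (p - q) x = 0}" by (intro poly_roots_finite) simp
  moreover have "S \<subseteq> {x. poly (p - q) x = 0}" using assms by auto
  ultimately show False using assms finite_subset by blast
qed

lemma cnj_disc_iff [simp]: "cnj w \<in> disc \<longleftrightarrow> w \<in> disc"
  by (simp add: dist_norm)

text \<open>A common zero \<open>t\<close> of all \<open>P(z, \<cdot>)\<close> splits off the factor \<open>t' - t\<close>, and by Hermitian symmetry
  also \<open>z - cnj t\<close>; both are absorbed into \<open>u\<close>.\<close>

lemma reduced_inverse_polynomial:
  fixes k :: "complex \<Rightarrow> complex \<Rightarrow> complex"
  assumes k: "inverse_polynomial_kernel k"
    and herm: "\<And>z w. z \<in> disc \<Longrightarrow> w \<in> disc \<Longrightarrow> k w z = cnj (k z w)"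
  obtains P :: "complex poly poly" and u :: "complex \<Rightarrow> complex" where
    "\<And>z. z \<in> disc \<Longrightarrow> u z \<noteq> 0"
    "\<And>z w. z \<in> disc \<Longrightarrow> w \<in> disc \<Longrightarrow> poly (poly P [:cnj w:]) z * k z w = u z * cnj (u w)"
    "\<And>t. poly P [:t:] \<noteq> 0"
proof -
  \<comment> \<open>\<open>R\<close> relaxes P = 1/k, which is the case u = 1: a nowhere vanishing u
    may absorb factors of P. Among all such P one of least degree in t is chosen, so that no factor
    can be split off any more.\<close>
  define R where "R P u \<longleftrightarrow> (\<forall>z\<in>disc. u z \<noteq> 0) \<and>
    (\<forall>z\<in>disc. \<forall>w\<in>disc. poly (poly P [:cnj w:]) z * k z w = u z * cnj (u w))"
    for P :: "complex poly poly" and u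
  have k0: "\<And>z w. z \<in> disc \<Longrightarrow> w \<in> disc \<Longrightarrow> k z w \<noteq> 0"
    using k by (auto simp: inverse_polynomial_kernel_def)
  have "\<exists>P u. R P u"
  proof -
    obtain N :: nat and a where a: "\<forall>z\<in>disc. \<forall>w\<in>disc.
        1 / k z w = (\<Sum>p\<le>N. \<Sum>q\<le>N. a p q * z ^ p * cnj w ^ q)"
      using k[unfolded inverse_polynomial_kernel_def, THEN conjunct2] by (elim exE)
    define P where "P = (\<Sum>p\<le>N. \<Sum>q\<le>N. monom (monom (a p q) p) q)"
    have "poly (poly P [:cnj w:]) z = 1 / k z w" if "z \<in> disc" "w \<in> disc" for z w
      using a[rule_format, OF that] by (simp add: P_def poly_sum poly_monom)
    then have "R P (\<lambda>_. 1)" using k0 by (simp add: R_def)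
    then show ?thesis by blast
  qed
  then obtain P where P: "\<exists>u. R P u" and min: "\<And>P'. \<exists>u. R P' u \<Longrightarrow> degree P \<le> degree P'"
    using ex_has_least_nat[of "\<lambda>P. \<exists>u. R P u" _ degree] by blast
  obtain u where u: "R P u" using P by blast
  have u0: "\<And>z. z \<in> disc \<Longrightarrow> u z \<noteq> 0"
    and eq: "\<And>z w. z \<in> disc \<Longrightarrow> w \<in> disc \<Longrightarrow> poly (poly P [:cnj w:]) z * k z w = u z * cnj (u w)"
    using u by (auto simp: R_def)
  have P0: "poly (poly P [:cnj w:]) z \<noteq> 0" if "z \<in> disc" "w \<in> disc" for z w
    using eq[OF that] u0 that by auto
  have "poly P [:t:] \<noteq> 0" for t
  proof
    assume t: "poly P [:t:] = 0"
    define c where "c = cnj t"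
    \<comment> \<open>For c in the disc, P(0, cnj c) k(0,c) = u(0) cnj (u c) would be
      nonzero.\<close>
    have c: "c \<notin> disc" using P0[of 0 c] t by (auto simp: c_def)
    obtain P1 where P1: "P = [:- [:t:], 1:] * P1"
      using t by (auto simp: poly_eq_0_iff_dvd)
    have "P \<noteq> 0" using P0[of 0 0] by auto
    then have "P1 \<noteq> 0" using P1 by auto
    then have deg: "degree P = Suc (degree P1)"
      unfolding P1 by (subst degree_mult_eq) auto
    have Pc: "poly (poly P [:cnj w:]) c = 0" if w: "w \<in> disc" for w
    proof -
      \<comment> \<open>\<open>B\<close> is cnj P(w, cnj z) as a polynomial in z. On the disc it
        agrees with P(z, cnj w) by Hermitian symmetry; being polynomials, the two agree at c as
        well, where \<open>B\<close> takes the value cnj P(w,t) = 0.\<close>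
      define B where "B = (\<Sum>q\<le>degree P. monom (cnj (poly (coeff P q) w)) q)"
      have B: "poly B z = cnj (poly (poly P [:cnj z:]) w)" for z
        by (simp add: B_def poly_sum poly_monom poly_poly_altdef)
      have "poly P [:cnj w:] = B"
      proof (rule poly_eq_on_infinite[OF infinite_disc])
        fix z :: complex assume z: "z \<in> disc"
        have "poly (poly P [:cnj w:]) z * k z w = poly B z * k z w"
          using eq[OF z w] arg_cong[OF eq[OF w z], of cnj] herm[OF w z] by (simp add: B mult.commute)
        then show "poly (poly P [:cnj w:]) z = poly B z" using k0[OF z w] by simp
      qed
      then show ?thesis using B[of c] t by (simp add: c_def)
    qed
    \<comment> \<open>The factor s - t can be cancelled, because t lies outside the disc.\<close>
    have P1c: "poly (poly P1 [:s:]) c = 0" if s: "s \<in> disc" for s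
    proof -
      have "(s - t) * poly (poly P1 [:s:]) c = 0"
        using Pc[of "cnj s"] s by (auto simp: P1)
      moreover have "s \<noteq> t" using c s by (auto simp: c_def)
      ultimately show ?thesis by simp
    qed
    \<comment> \<open>Now P1(c,s), as a polynomial in s, vanishes on the disc, so every coefficient
      of \<open>P1\<close> has the root c.\<close>
    have "(\<Sum>q\<le>degree P1. monom (poly (coeff P1 q) c) q) = 0"
      by (rule poly_eq_on_infinite[OF infinite_disc])
        (use P1c in \<open>simp add: poly_poly_altdef poly_sum poly_monom\<close>)
    then have *: "coeff (\<Sum>q\<le>degree P1. monom (poly (coeff P1 q) c) q) q' = 0" for q'
      by simp
    have "poly (coeff P1 q) c = 0" for q
      using *[of q] coeff_eq_0[of P1 q] by (cases "q \<le> degree P1") (simp_all add: coeff_sum)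
    then have "[:- c, 1:] dvd coeff P1 q" for q by (simp add: poly_eq_0_iff_dvd)
    then have "[:[:- c, 1:]:] dvd P1" by (simp add: const_poly_dvd_iff)
    then obtain P2 where P2: "P1 = [:[:- c, 1:]:] * P2" by (auto simp: dvd_def)
    \<comment> \<open>Dividing P(z, cnj w) by (z - c) (cnj w - t) divides u(z) by z - c and cnj (u
      w) by cnj (w - c), since t = cnj c.\<close>
    have "R P2 (\<lambda>z. u z / (z - c))"
      unfolding R_def
    proof (intro conjI ballI)
      fix z :: complex assume z: "z \<in> disc"
      then show "u z / (z - c) \<noteq> 0" using u0 c by auto
      fix w :: complex assume w: "w \<in> disc"
      have "z - c \<noteq> 0" "cnj w - t \<noteq> 0" using z w c by (auto simp: c_def)
      moreover have "(cnj w - t) * ((z - c) * poly (poly P2 [:cnj w:]) z) * k z w = u z * cnj (u w)"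
        using eq[OF z w] by (simp add: P1 P2 algebra_simps)
      moreover have "cnj (w - c) = cnj w - t" by (simp add: c_def)
      ultimately show "poly (poly P2 [:cnj w:]) z * k z w = u z / (z - c) * cnj (u w / (w - c))"
        unfolding complex_cnj_divide times_divide_times_eq by (simp add: eq_divide_eq ac_simps)
    qed
    \<comment> \<open>Splitting off the linear factor in the outer variable lowered the degree by
      one; the factor z - c is a constant for that variable.\<close>
    then have "degree P \<le> degree P2" using min by blast
    moreover have "degree P2 \<le> degree P1" using P2 by simp
    ultimately show False using deg by simp
  qed
  then show thesis using that u0 eq by blast
qed

lemma complex_poly_has_root:
  fixes S :: "complex poly" assumes "degree S \<noteq> 0" shows "\<exists>c. poly S c = 0"
proof -
  have "\<not> constant (poly S)" using constant_degree[of S] assms by simp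
  then show ?thesis by (rule Fundamental_Theorem_Algebra.fundamental_theorem_of_algebra)
qed

section \<open>Adjoints on quotient modules; eigenvectors from polynomial relations\<close>

context hilbert_fun
begin

lemma bounded_op_mult:
  assumes b: "bounded_multiplier H \<phi>"
  shows "bounded_op (fset H) (mult_op \<phi>)"
proof -
  obtain C where m: "\<And>f. f \<in> fset H \<Longrightarrow> mult_op \<phi> f \<in> fset H"
    and C: "\<And>f. f \<in> fset H \<Longrightarrow> fnorm H (mult_op \<phi> f) \<le> C * fnorm H f"
    using b by (auto simp: bounded_multiplier_def)
  have "fnorm H (mult_op \<phi> f) \<le> \<bar>C\<bar> * fnorm H f" if "f \<in> fset H" for f
  proof -
    have "C * fnorm H f \<le> \<bar>C\<bar> * fnorm H f" using that by (intro mult_right_mono) auto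
    then show ?thesis using C[OF that] by simp
  qed
  moreover have "mult_op \<phi> (f + g) = mult_op \<phi> f + mult_op \<phi> g"
    "mult_op \<phi> (cscale c f) = cscale c (mult_op \<phi> f)" for f g c
    by (simp_all add: mult_op_def cscale_def fun_eq_iff algebra_simps)
  ultimately show ?thesis
    unfolding bounded_op_def using m by (meson abs_ge_zero)
qed

text \<open>The orthogonal complement of \<open>Q\<close> is invariant under the multiplier, so
  \<open>Q\<close> is invariant under its adjoint. Hence no projection enters the adjoint of the
  compression, whose powers are restrictions of powers of the full adjoint.\<close>

lemma quotient_module_adjoint:
  assumes Q: "quotient_module H \<Phi> Q" and \<phi>: "\<phi> \<in> \<Phi>" and b: "bounded_multiplier H \<phi>" and g: "g \<in> Q"
  shows quotient_module_adjoint_mem: "adjoint_on H (fset H) (mult_op \<phi>) g \<in> Q"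
    and adjoint_compression_eq:
      "adjoint_on H Q (compression H Q \<phi>) g = adjoint_on H (fset H) (mult_op \<phi>) g"
proof -
  have cl: "closed_subspace H Q"
    and inv: "\<And>f. f \<in> orth_complement H Q \<Longrightarrow> mult_op \<phi> f \<in> orth_complement H Q"
    using Q \<phi> by (auto simp: quotient_module_def)
  note QV = closed_subspaceD(2)[OF cl]
  note M = bounded_op_mult[OF b] and V = closed_subspace_fset
  let ?a = "adjoint_on H (fset H) (mult_op \<phi>) g"
  have gV: "g \<in> fset H" using g QV by blast
  have a: "?a \<in> fset H" using adjoint_on_mem[OF V M gV] .
  show mem: "?a \<in> Q"
  proof (rule in_closed_subspaceI[OF cl a])
    fix f assume f: "f \<in> orth_complement H Q"
    then have fV: "f \<in> fset H" by (auto simp: orth_complement_def)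
    have "finner H f ?a = finner H (mult_op \<phi> f) g" by (rule inner_adjoint_on[OF V M gV fV])
    also have "\<dots> = 0" using inv[OF f] g by (auto simp: orth_complement_def)
    finally show "finner H ?a f = 0" using inner_commute[OF fV a] by simp
  qed
  show "adjoint_on H Q (compression H Q \<phi>) g = ?a"
  proof (rule adjoint_on_unique[OF cl mem])
    fix f assume f: "f \<in> Q"
    have "mult_op \<phi> f \<in> fset H" using bounded_opD(1)[OF M] f QV by blast
    then show "finner H (compression H Q \<phi> f) g = finner H f ?a"
      using inner_orth_proj(1)[OF cl _ g] inner_adjoint_on[OF V M gV] f QV
      by (auto simp: compression_def)
  qed
qed

lemma bounded_op_sum:
  assumes "bounded_op Q T" "cfun.subspace Q" "\<And>i. i \<in> A \<Longrightarrow> f i \<in> Q"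
  shows "T (sum f A) = (\<Sum>i\<in>A. T (f i))"
proof -
  have T0: "T 0 = 0" using bounded_opD(3)[OF assms(1), of 0 0] cfun.subspace_0[OF assms(2)] by simp
  show ?thesis
  proof (cases "finite A")
    case True
    then show ?thesis using assms(3)
      by (induction A rule: finite_induct)
        (simp_all add: T0 bounded_opD(2)[OF assms(1)] cfun.subspace_sum[OF assms(2)])
  qed (simp add: T0)
qed

lemma bounded_op_funpow_mem: "bounded_op Q T \<Longrightarrow> f \<in> Q \<Longrightarrow> (T ^^ m) f \<in> Q"
  by (induction m) (auto simp: bounded_opD(1))

text \<open>The linear factors of \<open>S\<close> are peeled off one at a time. If \<open>S\<close>
  = (X - c) \<open>S1\<close>, then \<open>S1\<close>(T) g either is an eigenvector for c or
  vanishes, and in the latter case \<open>S1\<close> replaces \<open>S\<close>. A relation for one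
  single vector suffices, whatever the dimension of \<open>Q\<close>.\<close>

lemma eigenvector_of_annihilating_polynomial:
  assumes T: "bounded_op Q T" and Q: "cfun.subspace Q"
    and g: "g \<in> Q" "g \<noteq> 0"
    and S: "S \<noteq> 0" "(\<Sum>i\<le>degree S. cscale (coeff S i) ((T ^^ i) g)) = 0"
  obtains h c where "h \<in> Q" "h \<noteq> 0" "T h = cscale c h"
proof -
  have "\<exists>h c. h \<in> Q \<and> h \<noteq> 0 \<and> T h = cscale c h"
    using S
  proof (induction "degree S" arbitrary: S rule: less_induct)
    case less
    note Tm = bounded_op_funpow_mem[OF T g(1)]
    show ?case
    proof (cases "degree S = 0")
      case True
      then obtain s where s: "S = [:s:]" by (rule degree_eq_zeroE)
      with less.prems have "s \<noteq> 0" "cscale s g = 0" by auto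
      then show ?thesis using g by simp
    next
      case False
      then obtain c where "poly S c = 0"
        using complex_poly_has_root[of S] by blast
      then obtain S1 where S1: "S = [:- c, 1:] * S1" by (auto simp: poly_eq_0_iff_dvd)
      have "S1 \<noteq> 0" using less.prems S1 by auto
      then have deg: "degree S = Suc (degree S1)"
        unfolding S1 by (subst degree_mult_eq) auto
      define d where "d = degree S1"
      define h where "h = (\<Sum>i\<le>d. cscale (coeff S1 i) ((T ^^ i) g))"
      have hQ: "h \<in> Q"
        unfolding h_def using Tm Q by (intro cfun.subspace_sum cfun.subspace_scale) auto
      show ?thesis
      proof (cases "h = 0")
        case True
        show ?thesis
          by (rule less.hyps[of S1]) (use True \<open>S1 \<noteq> 0\<close> deg in \<open>auto simp: h_def d_def\<close>)
      next
        case False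
        have Th: "T h = (\<Sum>i\<le>d. cscale (coeff S1 i) ((T ^^ Suc i) g))"
          unfolding h_def using Tm Q
          by (subst bounded_op_sum[OF T Q]) (auto simp: cfun.subspace_scale bounded_opD(3)[OF T])
        \<comment> \<open>Thus \<open>cscale c h\<close> may be summed over the same range as
          \<open>S\<close>, one index beyond the degree of \<open>S1\<close>.\<close>
        have "coeff S1 (Suc d) = 0" by (simp add: d_def coeff_eq_0)
        then have ch: "cscale c h = (\<Sum>i\<le>Suc d. cscale (c * coeff S1 i) ((T ^^ i) g))"
          unfolding h_def by (simp add: cfun.scale_sum_right)
        have "(\<Sum>i\<le>Suc d. cscale (coeff S i) ((T ^^ i) g))
            = (\<Sum>i\<le>Suc d. cscale (case i of 0 \<Rightarrow> 0 | Suc j \<Rightarrow> coeff S1 j) ((T ^^ i) g)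
                - cscale (c * coeff S1 i) ((T ^^ i) g))"
          by (intro sum.cong refl)
            (simp add: S1 coeff_pCons cfun.scale_left_diff_distrib split: nat.split)
        also have "\<dots> = T h - cscale c h"
          unfolding sum_subtractf ch Th by (subst sum.atMost_Suc_shift) simp
        finally have "T h = cscale c h"
          using less.prems deg by (simp add: d_def)
        then show ?thesis using hQ False by blast
      qed
    qed
  qed
  then show thesis using that by blast
qed

end

section \<open>Continuity of the functions in a module over the disc\<close>

locale disc_module =
  fixes k :: "complex \<Rightarrow> complex \<Rightarrow> complex" and H :: "complex fun_hilbert"
  assumes module: "analytic_hilbert_module k H"
begin

sublocale rk_space disc k H
  using module by unfold_locales (simp add: analytic_hilbert_module_def)

lemma bounded_coordinate: "bounded_multiplier H (\<lambda>z. z)"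
  and inverse_polynomial: "inverse_polynomial_kernel k"
  using module by (auto simp: analytic_hilbert_module_def)

lemma kernel_nonzero: "z \<in> disc \<Longrightarrow> w \<in> disc \<Longrightarrow> k z w \<noteq> 0"
  using inverse_polynomial by (auto simp: inverse_polynomial_kernel_def)

text \<open>By Cauchy-Schwarz, f w - f z is at most the norm of f times the distance of the two
  kernel sections, and that distance is governed by \<open>k\<close>, the inverse of a polynomial
  without zeros on the disc.\<close>

lemma continuous_element:
  assumes f: "f \<in> fset H" and z: "z \<in> disc"
  shows "(f \<longlongrightarrow> f z) (at z)"
proof -
  obtain N :: nat and a where a: "\<forall>z\<in>disc. \<forall>w\<in>disc.
      1 / k z w = (\<Sum>p\<le>N. \<Sum>q\<le>N. a p q * z ^ p * cnj w ^ q)"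
    using inverse_polynomial[unfolded inverse_polynomial_kernel_def, THEN conjunct2] by (elim exE)
  define b where "b z w = (\<Sum>p\<le>N. \<Sum>q\<le>N. a p q * z ^ p * cnj w ^ q)" for z w
  have kb: "k z w = 1 / b z w" if "z \<in> disc" "w \<in> disc" for z w
    unfolding b_def a[rule_format, OF that, symmetric] by simp
  have b0: "b z w \<noteq> 0" if "z \<in> disc" "w \<in> disc" for z w
    using kb[OF that] kernel_nonzero[OF that] by auto
  have near: "\<forall>\<^sub>F w in at z. w \<in> disc"
    using z by (intro eventually_at_in_open') auto
  \<comment> \<open>The squared norm of \<open>ker w - ker z\<close>, written with the polynomial
    \<open>b\<close> so that its limit can be read off.\<close>
  define D where "D = (\<lambda>w. Re (1 / b w w - 1 / b w z - 1 / b z w + 1 / b z z))"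
  have "(D \<longlongrightarrow> Re (1 / b z z - 1 / b z z - 1 / b z z + 1 / b z z)) (at z)"
    unfolding D_def using b0[OF z z] unfolding b_def by (intro tendsto_intros) auto
  then have "((\<lambda>w. fnorm H f * sqrt (D w)) \<longlongrightarrow> fnorm H f * sqrt 0) (at z)"
    by (intro tendsto_intros) simp
  then have lim: "((\<lambda>w. fnorm H f * sqrt (D w)) \<longlongrightarrow> 0) (at z)" by simp
  have "norm (f w - f z) \<le> fnorm H f * sqrt (D w)" if w: "w \<in> disc" for w
  proof -
    have m: "ker w \<in> fset H" "ker z \<in> fset H" using w z by auto
    have "finner H (ker x) (ker y) = k y x" if "x \<in> disc" "y \<in> disc" for x y
      using inner_kernel[OF kernel_mem[OF that(1)] that(2)] that by (simp add: kernel_section_def)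
    then have "finner H (ker w - ker z) (ker w - ker z) = k w w - k w z - (k z w - k z z)"
      using m w z by (simp only: inner_diff_left inner_diff_right diff_mem)
    then have "fnorm H (ker w - ker z) = sqrt (D w)"
      unfolding fnorm_def D_def using kb[OF w w] kb[OF w z] kb[OF z w] kb[OF z z] by simp
    moreover have "f w - f z = finner H f (ker w - ker z)"
      using m f w z inner_kernel[OF f] by (simp only: inner_diff_right)
    ultimately show ?thesis using Cauchy_Schwarz[OF f, of "ker w - ker z"] m by simp
  qed
  then have "((\<lambda>w. f w - f z) \<longlongrightarrow> 0) (at z)"
    using near by (intro Lim_null_comparison[OF _ lim]) (auto elim: eventually_mono)
  then show ?thesis by (rule LIM_zero_cancel)
qed

text \<open>By continuity the value at a point of F is a limit of zeros. This takes care of the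
  roots of P(.,t) when an eigenvector is shown to vanish.\<close>

lemma zero_off_finite:
  assumes f: "f \<in> fset H" and F: "finite F" and zero: "\<And>z. z \<in> disc \<Longrightarrow> z \<notin> F \<Longrightarrow> f z = 0"
  shows "f = 0"
proof (rule fset_ext)
  fix z :: complex assume z: "z \<in> disc"
  \<comment> \<open>The point z itself is kept in the open set, whether or not it belongs to
    F.\<close>
  have "open (disc - (F - {z}))" using F by (intro open_Diff finite_imp_closed) auto
  then have "\<forall>\<^sub>F w in at z. w \<in> disc - (F - {z}) - {z}"
    using z by (intro eventually_at_in_open) auto
  then have "\<forall>\<^sub>F w in at z. f w = 0"
    by (rule eventually_mono) (use zero in auto)
  then have "((\<lambda>_. 0) \<longlongrightarrow> f z) (at z)"
    by (rule Lim_transform_eventually[OF continuous_element[OF f z]])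
  then show "f z = 0 z" by (simp add: tendsto_const_iff)
qed (use f in auto)

end

context hilbert_fun
begin

lemma inner_adjoint_funpow:
  assumes Q: "closed_subspace H Q" and T: "bounded_op Q T" and f: "f \<in> Q" and g: "g \<in> Q"
  shows "finner H ((adjoint_on H Q T ^^ m) f) g = finner H f ((T ^^ m) g)"
  using g
proof (induction m arbitrary: g)
  case (Suc m)
  note A = bounded_op_funpow_mem[OF bounded_op_adjoint_on[OF Q T] f]
  have "finner H ((adjoint_on H Q T ^^ Suc m) f) g = finner H ((adjoint_on H Q T ^^ m) f) (T g)"
    using inner_adjoint_on_left[OF Q T A Suc.prems] by simp
  also have "\<dots> = finner H f ((T ^^ Suc m) g)"
    using Suc.IH[OF bounded_opD(1)[OF T Suc.prems]] by (simp add: funpow_swap1)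
  finally show ?case .
qed simp

lemma funpow_commute_op:
  assumes "\<And>f. f \<in> Q \<Longrightarrow> S (T f) = T (S f)" "bounded_op Q T" "f \<in> Q"
  shows "S ((T ^^ m) f) = (T ^^ m) (S f)"
  using assms(3)
proof (induction m)
  case (Suc m)
  then show ?case using assms(1) bounded_op_funpow_mem[OF assms(2), of f m] by simp
qed simp

end

lemma mult_op_funpow: "(mult_op (\<lambda>z. z) ^^ m) f = (\<lambda>z. z ^ m * f z)"
  by (induction m) (auto simp: mult_op_def fun_eq_iff)

lemma sum_fun_apply: "(\<Sum>i\<in>A. f i) x = (\<Sum>i\<in>A. f i x)"
  for f :: "'i \<Rightarrow> 'x \<Rightarrow> complex"
  by (induction A rule: infinite_finite_induct) auto

section \<open>The rank one calculus and normal compressions\<close>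

context disc_module
begin

abbreviation "M \<equiv> mult_op (\<lambda>z::complex. z)"
abbreviation "Ms \<equiv> adjoint_on H (fset H) M"

lemma bounded_op_M: "bounded_op (fset H) M"
  by (rule bounded_op_mult[OF bounded_coordinate])

text \<open>The hereditary calculus \<open>P(M, M\<^sup>*)\<close> of the reduced polynomial is the rank one operator
  \<open>U \<otimes> U\<close>, because it maps \<open>k\<^sub>w\<close> to \<open>cnj (U w) U\<close>.\<close>

lemma rank_one_calculus:
  obtains P :: "complex poly poly" and U where "U \<in> fset H"
    "\<And>t. poly P [:t:] \<noteq> 0" "\<And>z w. z \<in> disc \<Longrightarrow> w \<in> disc \<Longrightarrow> poly (poly P [:cnj w:]) z \<noteq> 0"
    "\<And>f z. f \<in> fset H \<Longrightarrow> z \<in> disc \<Longrightarrow>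
      (\<Sum>q\<le>degree P. poly (coeff P q) z * (Ms ^^ q) f z) = U z * finner H f U"
proof -
  obtain P :: "complex poly poly" and u where u: "\<And>z. z \<in> disc \<Longrightarrow> u z \<noteq> 0"
    and eq: "\<And>z w. z \<in> disc \<Longrightarrow> w \<in> disc \<Longrightarrow> poly (poly P [:cnj w:]) z * k z w = u z * cnj (u w)"
    and P: "\<And>t. poly P [:t:] \<noteq> 0"
    using reduced_inverse_polynomial[OF inverse_polynomial kernel_hermitian] by metis
  define U where "U = (\<lambda>z. if z \<in> disc then u z else 0)"
  note mem = bounded_op_funpow_mem[OF bounded_op_M]
  \<comment> \<open>\<open>G z\<close> represents the functional that applies P(z,
    \<open>Ms\<close>) to f and evaluates at z. The coefficients are conjugated because
    \<open>G z\<close> stands in the second argument.\<close>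
  define G where "G z = (\<Sum>q\<le>degree P. cscale (cnj (poly (coeff P q) z)) ((M ^^ q) (ker z)))" for z
  have GV: "G z \<in> fset H" if "z \<in> disc" for z
    unfolding G_def using mem that by (intro sum_mem scale_mem) auto
  have G: "G z = cscale (cnj (u z)) U" if z: "z \<in> disc" for z
  proof
    fix w
    have "G z w = (\<Sum>q\<le>degree P. cnj (poly (coeff P q) z) * (w ^ q * ker z w))"
      by (simp add: G_def sum_fun_apply cscale_def mult_op_funpow)
    also have "\<dots> = cnj (poly (poly P [:cnj w:]) z) * ker z w"
      by (simp add: poly_poly_altdef sum_distrib_right mult.assoc)
    also have "\<dots> = cscale (cnj (u z)) U w"
      using arg_cong[OF eq[OF z, of w], of cnj] kernel_hermitian[OF z, of w]
      by (auto simp: U_def cscale_def kernel_section_def)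
    finally show "G z w = cscale (cnj (u z)) U w" .
  qed
  have z0: "(0 :: complex) \<in> disc" by simp
  \<comment> \<open>A priori \<open>U\<close> is just a function; it belongs to the space as a
    multiple of \<open>G 0\<close>, because u has no zero at 0.\<close>
  have "U = cscale (1 / cnj (u 0)) (G 0)"
    using G[OF z0] u[OF z0] by simp
  then have UV: "U \<in> fset H" using GV[OF z0] by simp
  show thesis
  proof (rule that[OF UV P])
    show "poly (poly P [:cnj w:]) z \<noteq> 0" if "z \<in> disc" "w \<in> disc" for z w
      using eq[OF that] u that by auto
    fix f and z :: complex assume f: "f \<in> fset H" and z: "z \<in> disc"
    have "finner H f (G z) = (\<Sum>q\<le>degree P. poly (coeff P q) z * finner H f ((M ^^ q) (ker z)))"
      unfolding G_def using mem f z
      by (subst inner_sum_right) (auto simp: inner_scale_right)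
    also have "\<dots> = (\<Sum>q\<le>degree P. poly (coeff P q) z * (Ms ^^ q) f z)"
    proof (intro sum.cong refl arg_cong2[of _ _ _ _ "(*)"])
      fix q
      have "finner H f ((M ^^ q) (ker z)) = finner H ((Ms ^^ q) f) (ker z)"
        by (rule inner_adjoint_funpow[OF closed_subspace_fset bounded_op_M f kernel_mem[OF z], symmetric])
      also have "\<dots> = (Ms ^^ q) f z"
        by (rule inner_kernel[OF bounded_op_funpow_mem[OF bounded_op_adjoint_on[OF closed_subspace_fset bounded_op_M] f] z])
      finally show "finner H f ((M ^^ q) (ker z)) = (Ms ^^ q) f z" .
    qed
    finally show "(\<Sum>q\<le>degree P. poly (coeff P q) z * (Ms ^^ q) f z) = U z * finner H f U"
      using G[OF z] f UV z by (simp add: inner_scale_right U_def)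
  qed
qed

text \<open>Write \<open>U\<close> for the vector of the rank one calculus. By normality the vectors of
  \<open>Q\<close> orthogonal to \<open>U\<close> form a reducing subspace \<open>R\<close> of the compression, on which \<open>P(z, M\<^sup>*)\<close>
  followed by evaluation at \<open>z\<close> vanishes. Since \<open>M\<^sup>*\<close> has no eigenvector in \<open>R\<close>, evaluation at
  \<open>z\<close> itself vanishes on \<open>R\<close>.\<close>

lemma normal_quotient_one_dimensional:
  assumes qm: "quotient_module H {\<lambda>z. z} Q"
    and normal: "\<And>f. f \<in> Q \<Longrightarrow> cross_commutator H Q (\<lambda>z. z) (\<lambda>z. z) f = 0"
  obtains f0 where "f0 \<in> Q" "Q = cfun.span {f0}"
proof -
  have Q: "closed_subspace H Q" using qm by (simp add: quotient_module_def)
  note Q' = closed_subspaceD[OF Q]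
  have QV: "\<And>f. f \<in> Q \<Longrightarrow> f \<in> fset H" using Q'(2) by blast
  define C where "C = compression H Q (\<lambda>z. z)"
  have C: "bounded_op Q C" unfolding C_def by (rule bounded_op_compression[OF Q bounded_coordinate])
  have adj: "adjoint_on H Q C f = Ms f" if "f \<in> Q" for f
    unfolding C_def using adjoint_compression_eq[OF qm _ bounded_coordinate that] by simp
  have T_mem: "Ms f \<in> Q" if "f \<in> Q" for f
    using quotient_module_adjoint_mem[OF qm _ bounded_coordinate that] by simp
  have T: "bounded_op Q Ms"
    using bounded_op_adjoint_on[OF Q C] unfolding bounded_op_def
    by (simp add: adj Q'(1) cfun.subspace_add cfun.subspace_scale)
  have CT: "finner H (Ms f) g = finner H f (C g)" if "f \<in> Q" "g \<in> Q" for f g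
    using inner_adjoint_on_left[OF Q C that] adj[OF that(1)] by simp
  have TC: "finner H (C f) g = finner H f (Ms g)" if "f \<in> Q" "g \<in> Q" for f g
    using inner_adjoint_on[OF Q C that(2,1)] adj[OF that(2)] by simp
  have comm: "C (Ms f) = Ms (C f)" if f: "f \<in> Q" for f
    using normal[OF f] adj[OF f] adj[OF bounded_opD(1)[OF C f]]
    by (simp add: cross_commutator_def commutator_def C_def[symmetric])
  note Tm = bounded_op_funpow_mem[OF T]
  obtain P :: "complex poly poly" and U where U: "U \<in> fset H"
    and P: "\<And>t. poly P [:t:] \<noteq> 0" "\<And>z w. z \<in> disc \<Longrightarrow> w \<in> disc \<Longrightarrow> poly (poly P [:cnj w:]) z \<noteq> 0"
    and calc: "\<And>f z. f \<in> fset H \<Longrightarrow> z \<in> disc \<Longrightarrow>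
      (\<Sum>q\<le>degree P. poly (coeff P q) z * (Ms ^^ q) f z) = U z * finner H f U"
    by (rule rank_one_calculus) (rule that; assumption)
  \<comment> \<open>The form of the rank one operator, with all powers of \<open>M\<close> moved to
    g as powers of \<open>Ms\<close>. Only vectors of \<open>Q\<close> then occur, and on
    \<open>Q\<close> the operator \<open>C\<close> is adjoint to \<open>Ms\<close>.\<close>
  define B where "B f g = (\<Sum>q\<le>degree P. \<Sum>p\<le>degree (coeff P q).
      coeff (coeff P q) p * finner H ((Ms ^^ q) f) ((Ms ^^ p) g))" for f g
  have B: "B f g = finner H f U * finner H U g" if f: "f \<in> Q" and g: "g \<in> Q" for f g
  proof -
    have M_mem: "(M ^^ p) ((Ms ^^ q) f) \<in> fset H" for p q
      using bounded_op_funpow_mem[OF bounded_op_M] Tm[OF f] QV by blast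
    have "cscale (finner H f U) U = (\<Sum>q\<le>degree P. \<Sum>p\<le>degree (coeff P q).
        cscale (coeff (coeff P q) p) ((M ^^ p) ((Ms ^^ q) f)))" (is "?l = ?r")
    proof (rule fset_ext)
      show "?l \<in> fset H" using U by simp
      show "?r \<in> fset H" using M_mem by (intro sum_mem scale_mem)
      fix z :: complex assume z: "z \<in> disc"
      show "?l z = ?r z"
        using calc[OF QV[OF f] z]
        by (simp add: sum_fun_apply cscale_def mult_op_funpow poly_altdef sum_distrib_right mult.assoc
            mult.commute[of "U z"])
    qed
    then have "finner H f U * finner H U g = finner H ?r g"
      using U QV[OF g] by (metis inner_scale_left)
    also have "\<dots> = (\<Sum>q\<le>degree P. \<Sum>p\<le>degree (coeff P q).
        coeff (coeff P q) p * finner H ((M ^^ p) ((Ms ^^ q) f)) g)"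
      using M_mem QV[OF g] by (simp add: inner_sum_left inner_scale_left sum_mem)
    also have "\<dots> = B f g"
      unfolding B_def
    proof (intro sum.cong refl arg_cong2[of _ _ _ _ "(*)"])
      fix p q
      let ?f = "(Ms ^^ q) f"
      have fV: "?f \<in> fset H" using Tm[OF f] QV by blast
      have "finner H ((Ms ^^ p) g) ?f = finner H g ((M ^^ p) ?f)"
        by (rule inner_adjoint_funpow[OF closed_subspace_fset bounded_op_M QV[OF g] fV])
      then show "finner H ((M ^^ p) ?f) g = finner H ?f ((Ms ^^ p) g)"
        using inner_commute[OF QV[OF g] M_mem] inner_commute[OF _ fV] QV[OF Tm[OF g]] by simp
    qed
    finally show ?thesis by simp
  qed
  \<comment> \<open>By normality \<open>C\<close> commutes with the powers of \<open>Ms\<close>, so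
    it can be pulled to the front and moved to the other argument.\<close>
  have BC: "B (C f) g = B f (Ms g)" if f: "f \<in> Q" and g: "g \<in> Q" for f g
    unfolding B_def
  proof (intro sum.cong refl arg_cong2[of _ _ _ _ "(*)"])
    fix p q
    have "finner H ((Ms ^^ q) (C f)) ((Ms ^^ p) g) = finner H (C ((Ms ^^ q) f)) ((Ms ^^ p) g)"
      using funpow_commute_op[of Q C Ms f, OF comm T f] by simp
    also have "\<dots> = finner H ((Ms ^^ q) f) ((Ms ^^ p) (Ms g))"
      using TC Tm f g by (simp add: funpow_swap1)
    finally show "finner H ((Ms ^^ q) (C f)) ((Ms ^^ p) g) = finner H ((Ms ^^ q) f) ((Ms ^^ p) (Ms g))" .
  qed
  have BT: "B (Ms f) g = B f (C g)" if f: "f \<in> Q" and g: "g \<in> Q" for f g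
    unfolding B_def
  proof (intro sum.cong refl arg_cong2[of _ _ _ _ "(*)"])
    fix p q
    have "finner H ((Ms ^^ q) (Ms f)) ((Ms ^^ p) g) = finner H ((Ms ^^ q) f) (C ((Ms ^^ p) g))"
      using CT[OF Tm[OF f] Tm[OF g]] by (simp add: funpow_swap1)
    also have "\<dots> = finner H ((Ms ^^ q) f) ((Ms ^^ p) (C g))"
      using funpow_commute_op[of Q C Ms g, OF comm T g] by simp
    finally show "finner H ((Ms ^^ q) (Ms f)) ((Ms ^^ p) g) = finner H ((Ms ^^ q) f) ((Ms ^^ p) (C g))" .
  qed
  define R where "R = {f \<in> Q. finner H f U = 0}"
  have R: "closed_subspace H R"
    using closed_subspace_orthogonal_in[OF Q, of "{U}"] U by (simp add: R_def)
  note R' = closed_subspaceD[OF R]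
  have R_inv: "C f \<in> R \<and> Ms f \<in> R" if f: "f \<in> R" for f
  proof -
    have fQ: "f \<in> Q" "finner H f U = 0" using f by (auto simp: R_def)
    have mem: "C f \<in> Q" "Ms f \<in> Q" using fQ bounded_opD(1)[OF C] T_mem by auto
    \<comment> \<open>If \<open>U\<close> is orthogonal to \<open>Q\<close>, both products vanish at
      once. Otherwise take g in \<open>Q\<close> not orthogonal to \<open>U\<close>: by
      \<open>B\<close> and \<open>BC\<close> the product of (C f, U) and (U, g) equals that of (f,
      U) and (U, Ms g), where (f, U) = 0; similarly for \<open>Ms f\<close>.\<close>
    have "finner H (C f) U = 0 \<and> finner H (Ms f) U = 0"
    proof (cases "\<forall>g\<in>Q. finner H U g = 0")
      case True
      then show ?thesis
        using inner_commute[OF U QV[OF mem(1)]] inner_commute[OF U QV[OF mem(2)]] mem by simp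
    next
      case False
      then obtain g where g: "g \<in> Q" "finner H U g \<noteq> 0" by blast
      have "finner H (C f) U * finner H U g = 0"
        using B[OF mem(1) g(1)] BC[OF fQ(1) g(1)] B[OF fQ(1) T_mem[OF g(1)]] fQ(2) by simp
      moreover have "finner H (Ms f) U * finner H U g = 0"
        using B[OF mem(2) g(1)] BT[OF fQ(1) g(1)] B[OF fQ(1) bounded_opD(1)[OF C g(1)]] fQ(2) by simp
      ultimately show ?thesis using g(2) by simp
    qed
    then show ?thesis using mem by (simp add: R_def)
  qed
  have RQ: "\<And>f. f \<in> R \<Longrightarrow> f \<in> Q" by (simp add: R_def)
  have CR: "bounded_op R C"
    using C R_inv RQ unfolding bounded_op_def by blast
  have TR: "bounded_op R Ms"
    using T R_inv RQ unfolding bounded_op_def by blast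
  \<comment> \<open>By normality the norm of \<open>Ms h - cscale (cnj c) h\<close> is that of
    \<open>C h - cscale c h\<close>, namely zero. The rank one formula then reads P(z, cnj c) h(z) =
    0, and P(., cnj c) has only finitely many roots.\<close>
  have no_eigenvector: "h = 0" if h: "h \<in> R" and Ch: "C h = cscale c h" for h c
  proof -
    have hQ: "h \<in> Q" and hV: "h \<in> fset H" using h RQ QV by auto
    have ThV: "Ms h \<in> fset H" and ThQ: "Ms h \<in> Q" using T_mem[OF hQ] QV by auto
    have "finner H (Ms h) (Ms h) = finner H h (C (Ms h))" by (rule CT[OF hQ ThQ])
    also have "\<dots> = finner H h (Ms (C h))" using comm[OF hQ] by simp
    also have "\<dots> = finner H (C h) (C h)" using TC[OF hQ bounded_opD(1)[OF C hQ]] by simp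
    finally have "finner H (Ms h) (Ms h) = finner H (C h) (C h)" .
    moreover have "finner H (Ms h) h = finner H h (C h)" "finner H h (Ms h) = finner H (C h) h"
      using CT[OF hQ hQ] TC[OF hQ hQ] by auto
    ultimately have "finner H (Ms h - cscale (cnj c) h) (Ms h - cscale (cnj c) h) = 0"
      using hV ThV by (simp add: inner_diff_left inner_diff_right inner_scale_left inner_scale_right Ch)
    then have Th: "Ms h = cscale (cnj c) h"
      using inner_self_eq_0_iff[of "Ms h - cscale (cnj c) h"] hV ThV by simp
    have Thm: "(Ms ^^ q) h = cscale (cnj c ^ q) h" for q
      by (induction q) (use bounded_opD(3)[OF T hQ] Th in \<open>simp_all add: mult.commute\<close>)
    have "poly (poly P [:cnj c:]) z * h z = 0" if z: "z \<in> disc" for z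
      using calc[OF hV z] h
      by (simp add: poly_poly_altdef Thm cscale_def R_def sum_distrib_right mult.assoc)
    moreover have "finite {z. poly (poly P [:cnj c:]) z = 0}"
      by (rule poly_roots_finite[OF P(1)])
    ultimately show "h = 0" by (intro zero_off_finite[OF hV]) auto
  qed
  have "f z = 0" if f: "f \<in> R" and z: "z \<in> disc" for f z
  proof -
    \<comment> \<open>\<open>g\<close> represents evaluation at z on \<open>R\<close>; the aim is to
      show that it is zero.\<close>
    define g where "g = orth_proj H R (ker z)"
    have g: "g \<in> R" using orth_proj_mem[OF R] z by (simp add: g_def)
    \<comment> \<open>P(z,.) with conjugated coefficients, because acting on \<open>g\<close> the
      operator \<open>C\<close> takes the place of its adjoint \<open>Ms\<close>.\<close>
    define S where "S = (\<Sum>q\<le>degree P. monom (cnj (poly (coeff P q) z)) q)"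
    have coeff_S: "coeff S q = (if q \<le> degree P then cnj (poly (coeff P q) z) else 0)" for q
      by (simp add: S_def coeff_sum)
    have deg_S: "degree S \<le> degree P" by (rule degree_le) (simp add: coeff_S)
    have "S \<noteq> 0"
    proof
      assume "S = 0"
      then have "poly (coeff P q) z = 0" if "q \<le> degree P" for q
        using coeff_S[of q] that by simp
      \<comment> \<open>The value at t = 0 already shows that P(z,.) is nonzero, as 0 is the
        conjugate of a point of the disc.\<close>
      then have "poly (poly P [:cnj 0:]) z = 0" unfolding poly_poly_altdef by simp
      then show False using P(2)[OF z, of 0] by simp
    qed
    define G where "G = (\<Sum>q\<le>degree P. cscale (cnj (poly (coeff P q) z)) ((C ^^ q) g))"
    have Cg: "(C ^^ q) g \<in> R" for q by (rule bounded_op_funpow_mem[OF CR g])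
    have GR: "G \<in> R" unfolding G_def using Cg R'(1) by (intro cfun.subspace_sum cfun.subspace_scale)
    \<comment> \<open>\<open>G\<close> is \<open>S\<close>(C) g. Its inner product with f' is P(z,
      \<open>Ms\<close>) f' evaluated at z, which is zero for f' orthogonal to \<open>U\<close>. As
      \<open>G\<close> itself lies in \<open>R\<close>, it vanishes, and this is the polynomial
      relation for \<open>g\<close>.\<close>
    have "finner H f' G = 0" if f': "f' \<in> R" for f'
    proof -
      have f'Q: "f' \<in> Q" and f'V: "f' \<in> fset H" using f' RQ QV by auto
      have "finner H f' G = (\<Sum>q\<le>degree P. poly (coeff P q) z * finner H f' ((C ^^ q) g))"
        unfolding G_def using Cg R'(2) f'V
        by (subst inner_sum_right) (auto simp: inner_scale_right subset_iff)
      also have "\<dots> = (\<Sum>q\<le>degree P. poly (coeff P q) z * (Ms ^^ q) f' z)"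
      proof (intro sum.cong refl arg_cong2[of _ _ _ _ "(*)"])
        fix q
        have Tq: "(Ms ^^ q) f' \<in> R" by (rule bounded_op_funpow_mem[OF TR f'])
        have "(adjoint_on H Q C ^^ q) f' = (Ms ^^ q) f'"
          by (induction q) (use Tm[OF f'Q] adj in auto)
        then have "finner H f' ((C ^^ q) g) = finner H ((Ms ^^ q) f') g"
          using inner_adjoint_funpow[OF Q C f'Q RQ[OF g], of q] by simp
        also have "\<dots> = finner H ((Ms ^^ q) f') (ker z)"
          unfolding g_def using inner_orth_proj(2)[OF R _ Tq] z by simp
        also have "\<dots> = (Ms ^^ q) f' z"
          using inner_kernel z Tq R'(2) by blast
        finally show "finner H f' ((C ^^ q) g) = (Ms ^^ q) f' z" .
      qed
      also have "\<dots> = 0" using calc[OF f'V z] f' by (simp add: R_def)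
      finally show ?thesis .
    qed
    then have "G = 0" using GR R'(2) inner_self_eq_0_iff[of G] by blast
    moreover have "poly (coeff P q) z = 0" if "q \<le> degree P" "\<not> q \<le> degree S" for q
      using coeff_eq_0[of S q] coeff_S[of q] that by simp
    then have "G = (\<Sum>q\<le>degree S. cscale (coeff S q) ((C ^^ q) g))"
      unfolding G_def by (intro sum.mono_neutral_cong_right) (use deg_S coeff_S in auto)
    ultimately have "g = 0"
      using eigenvector_of_annihilating_polynomial[OF CR R'(1) g _ \<open>S \<noteq> 0\<close>] no_eigenvector by metis
    then show "f z = 0"
      using inner_orth_proj(2)[OF R _ f, of "ker z"] inner_kernel[of f z] f R'(2) z
      by (auto simp: g_def)
  qed
  then have R0: "f = 0" if "f \<in> R" for f
    using that RQ QV by (intro fset_ext) auto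
  show thesis
  \<comment> \<open>With \<open>R\<close> trivial, the functional given by \<open>U\<close> is
    injective on \<open>Q\<close>, so \<open>Q\<close> has dimension at most one.\<close>
  proof (cases "\<forall>f\<in>Q. finner H f U = 0")
    case True
    then have "Q = {0}" using R0 Q'(1) by (auto simp: R_def cfun.subspace_0)
    then show thesis using that[of 0] by simp
  next
    case False
    then obtain f0 where f0: "f0 \<in> Q" "finner H f0 U \<noteq> 0" by blast
    have "f \<in> cfun.span {f0}" if f: "f \<in> Q" for f
    proof -
      let ?c = "finner H f U / finner H f0 U"
      have "f - cscale ?c f0 \<in> Q"
        using f f0 Q'(1) by (simp add: cfun.subspace_diff cfun.subspace_scale)
      moreover have "finner H (f - cscale ?c f0) U = 0"
        using f f0 QV U by (simp add: inner_diff_left inner_scale_left)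
      ultimately have "f - cscale ?c f0 = 0" by (intro R0) (simp add: R_def)
      then show ?thesis by (metis cfun.span_base cfun.span_scale eq_iff_diff_eq_0 singletonI)
    qed
    moreover have "cfun.span {f0} \<subseteq> Q" using f0 Q'(1) by (intro cfun.span_minimal) auto
    ultimately show thesis using that[OF f0(1)] by blast
  qed
qed

end

section \<open>Tensor products\<close>

context hilbert_fun
begin

lemma flim_add:
  assumes "flim s f" "flim t g" shows "flim (\<lambda>m. s m + t m) (f + g)"
proof -
  have mem: "\<And>m. s m \<in> fset H" "\<And>m. t m \<in> fset H" "f \<in> fset H" "g \<in> fset H"
    and lim: "(\<lambda>m. fnorm H (s m - f)) \<longlonglongrightarrow> 0" "(\<lambda>m. fnorm H (t m - g)) \<longlonglongrightarrow> 0"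
    using assms by (auto simp: flim_def)
  have lim': "(\<lambda>m. fnorm H (s m - f) + fnorm H (t m - g)) \<longlonglongrightarrow> 0"
    using tendsto_add[OF lim] by simp
  have bound: "norm (fnorm H (s m + t m - (f + g))) \<le> fnorm H (s m - f) + fnorm H (t m - g)" for m
    using fnorm_triangle[of "s m - f" "t m - g"] mem by (simp add: add_diff_add)
  have "(\<lambda>m. fnorm H (s m + t m - (f + g))) \<longlonglongrightarrow> 0"
    by (rule Lim_null_comparison[OF always_eventually[OF allI[OF bound]] lim'])
  then show ?thesis using mem by (simp add: flim_def)
qed

lemma flim_scale:
  assumes "flim s f" shows "flim (\<lambda>m. cscale c (s m)) (cscale c f)"
proof -
  have mem: "\<And>m. s m \<in> fset H" "f \<in> fset H" and lim: "(\<lambda>m. fnorm H (s m - f)) \<longlonglongrightarrow> 0"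
    using assms by (auto simp: flim_def)
  have "fnorm H (cscale c (s m) - cscale c f) = cmod c * fnorm H (s m - f)" for m
    using mem by (simp flip: cfun.scale_right_diff_distrib add: fnorm_scale)
  then show ?thesis
    using mem tendsto_mult_right_zero[OF lim, of "cmod c"] by (simp add: flim_def)
qed

lemma flim_fnorm:
  assumes "flim s f" shows "(\<lambda>m. fnorm H (s m)) \<longlonglongrightarrow> fnorm H f"
  unfolding fnorm_def by (intro tendsto_intros flim_inner assms)

lemma closed_subspace_closure:
  assumes W: "cfun.subspace W" "W \<subseteq> fset H"
  shows "closed_subspace H (ftopology H closure_of W)"
proof -
  note cl = closure_of_iff_flim[OF W(2)]
  have "cfun.subspace (ftopology H closure_of W)"
    unfolding cfun.subspace_def
  proof (intro conjI ballI allI)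
    show "0 \<in> ftopology H closure_of W"
      unfolding cl using W flim_const[of 0] by (intro exI[of _ "\<lambda>_. 0"]) (simp add: cfun.subspace_0)
  next
    fix f g assume "f \<in> ftopology H closure_of W" "g \<in> ftopology H closure_of W"
    then obtain s t where "\<forall>m. s m \<in> W" "flim s f" "\<forall>m. t m \<in> W" "flim t g" unfolding cl by blast
    then show "f + g \<in> ftopology H closure_of W"
      unfolding cl using flim_add[of s f t g] W(1) by (intro exI[of _ "\<lambda>m. s m + t m"]) (simp add: cfun.subspace_add)
  next
    fix c f assume "f \<in> ftopology H closure_of W"
    then obtain s where "\<forall>m. s m \<in> W" "flim s f" unfolding cl by blast
    then show "cscale c f \<in> ftopology H closure_of W"
      unfolding cl using flim_scale[of s f c] W(1)
      by (intro exI[of _ "\<lambda>m. cscale c (s m)"]) (simp add: cfun.subspace_scale)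
  qed
  then show ?thesis by (simp add: closed_subspace_def)
qed

end

context rk_space
begin

lemma span_kernels_dense:
  assumes f: "f \<in> fset H" and W: "cfun.subspace W" "W \<subseteq> fset H" "\<And>w. w \<in> X \<Longrightarrow> ker w \<in> W"
  obtains s where "\<And>m. s m \<in> W" "flim s f"
proof -
  have "W \<subseteq> ftopology H closure_of W"
    using W(2) by (simp add: closure_of_subset ftopology_eq)
  then have "ftopology H closure_of W = fset H"
    using W by (intro kernels_generate closed_subspace_closure) auto
  then show thesis using that f closure_of_iff_flim[OF W(2), of f] by blast
qed

end

section \<open>Elementary tensors, linear in one slot at a time\<close>

lemma elementary_tensor_upd:
  assumes "j \<in> {1..n}" "z \<in> polydisc n"
  shows "elementary_tensor n (f(j := h)) z = h (z j) * (\<Prod>i\<in>{1..n} - {j}. f i (z i))"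
  using assms prod.remove[of "{1..n}" j "\<lambda>i. (f(j := h)) i (z i)"]
  by (auto simp: elementary_tensor_def intro!: prod.cong)

lemma elementary_tensor_outside: "z \<notin> polydisc n \<Longrightarrow> elementary_tensor n f z = 0"
  by (simp add: elementary_tensor_def)

lemma elementary_tensor_cong:
  "(\<And>i. i \<in> {1..n} \<Longrightarrow> f i = g i) \<Longrightarrow> elementary_tensor n f = elementary_tensor n g"
  by (auto simp: elementary_tensor_def intro!: prod.cong)

lemma elementary_tensor_add:
  assumes "j \<in> {1..n}"
  shows "elementary_tensor n (f(j := h + h')) = elementary_tensor n (f(j := h)) + elementary_tensor n (f(j := h'))"
proof
  fix z show "elementary_tensor n (f(j := h + h')) z = (elementary_tensor n (f(j := h)) + elementary_tensor n (f(j := h'))) z"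
    by (cases "z \<in> polydisc n")
      (simp_all add: elementary_tensor_upd[OF assms] elementary_tensor_outside distrib_right)
qed

lemma elementary_tensor_scale:
  assumes "j \<in> {1..n}"
  shows "elementary_tensor n (f(j := cscale c h)) = cscale c (elementary_tensor n (f(j := h)))"
proof
  fix z show "elementary_tensor n (f(j := cscale c h)) z = cscale c (elementary_tensor n (f(j := h))) z"
    by (cases "z \<in> polydisc n")
      (simp_all add: elementary_tensor_upd[OF assms] elementary_tensor_outside cscale_def)
qed

lemma elementary_tensor_diff:
  assumes "j \<in> {1..n}"
  shows "elementary_tensor n (f(j := h - h')) = elementary_tensor n (f(j := h)) - elementary_tensor n (f(j := h'))"
  using elementary_tensor_add[OF assms, of f "h - h'" h'] by simp

lemma elementary_tensor_zero:
  assumes "j \<in> {1..n}" "f j = 0" shows "elementary_tensor n f = 0"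
  using elementary_tensor_scale[OF assms(1), of f 0 0] assms by (simp add: fun_upd_idem)

lemma elementary_tensor_coord:
  assumes "j \<in> {1..n}"
  shows "mult_op (coord j) (elementary_tensor n f) = elementary_tensor n (f(j := mult_op (\<lambda>z. z) (f j)))"
proof
  fix z
  have "elementary_tensor n f = elementary_tensor n (f(j := f j))" by simp
  then show "mult_op (coord j) (elementary_tensor n f) z = elementary_tensor n (f(j := mult_op (\<lambda>z. z) (f j))) z"
    by (cases "z \<in> polydisc n") (simp_all add: elementary_tensor_upd[OF assms]
        elementary_tensor_outside mult_op_def coord_def del: fun_upd_triv)
qed

section \<open>Inner products of elementary tensors\<close>

locale polydisc_module =
  fixes n :: nat and k :: "nat \<Rightarrow> complex \<Rightarrow> complex \<Rightarrow> complex"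
    and H :: "nat \<Rightarrow> complex fun_hilbert" and HK :: "(nat \<Rightarrow> complex) fun_hilbert"
  assumes polydisc_module: "analytic_hilbert_module_polydisc n k H HK"
begin

sublocale HK: rk_space "polydisc n" "product_kernel n k" HK
  using polydisc_module by unfold_locales (simp add: analytic_hilbert_module_polydisc_def)

abbreviation "I \<equiv> {1..n}"
abbreviation "et \<equiv> elementary_tensor n"

lemma factor: "i \<in> I \<Longrightarrow> disc_module (k i) (H i)"
  using polydisc_module by unfold_locales (simp add: analytic_hilbert_module_polydisc_def)

lemma factor_hilbert: "i \<in> I \<Longrightarrow> hilbert_fun (H i)"
proof -
  assume "i \<in> I"
  then interpret disc_module "k i" "H i" by (rule factor)
  show ?thesis by unfold_locales
qed

text \<open>The i-th factors range over arbitrary sets \<open>A i\<close>, not only subspaces, so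
  that one slot after another can be enlarged: from kernel sections to their span, and from the span
  to \<open>fset (H i)\<close>.\<close>

definition tensor_isometric :: "(nat \<Rightarrow> (complex \<Rightarrow> complex) set) \<Rightarrow> bool" where
  "tensor_isometric A \<longleftrightarrow> (\<forall>i\<in>I. A i \<subseteq> fset (H i)) \<and>
     (\<forall>f. (\<forall>i\<in>I. f i \<in> A i) \<longrightarrow> et f \<in> fset HK) \<and>
     (\<forall>f g. (\<forall>i\<in>I. f i \<in> A i) \<and> (\<forall>i\<in>I. g i \<in> A i) \<longrightarrow>
        finner HK (et f) (et g) = (\<Prod>i\<in>I. finner (H i) (f i) (g i)))"

lemma prod_upd:
  fixes F :: "nat \<Rightarrow> (complex \<Rightarrow> complex) \<Rightarrow> complex"
  assumes "j \<in> I"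
  shows "(\<Prod>i\<in>I. F i ((f(j := h)) i)) = F j h * (\<Prod>i\<in>I - {j}. F i (f i))"
  using assms prod.remove[of I j "\<lambda>i. F i ((f(j := h)) i)"] by (auto intro!: prod.cong)

text \<open>For kernel sections the product formula is the definition of
  \<open>product_kernel\<close>, seen through the reproducing properties of \<open>HK\<close> and of
  the factors.\<close>

lemma tensor_isometric_kernels:
  "tensor_isometric (\<lambda>i. kernel_section disc (k i) ` disc)"
proof -
  let ?k = "\<lambda>i. kernel_section disc (k i)"
  have ex: "\<exists>w\<in>polydisc n. (\<forall>i\<in>I. f i = ?k i (w i)) \<and> et f = kernel_section (polydisc n) (product_kernel n k) w"
    if "\<forall>i\<in>I. f i \<in> ?k i ` disc" for f
  proof -
    have "\<forall>i\<in>I. \<exists>w. w \<in> disc \<and> f i = ?k i w" using that by blast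
    then obtain w where w: "\<And>i. i \<in> I \<Longrightarrow> w i \<in> disc \<and> f i = ?k i (w i)" by metis
    \<comment> \<open>Points of the polydisc are extensional functions, hence the
      restriction.\<close>
    let ?w = "restrict w I"
    have wp: "?w \<in> polydisc n" using w by (auto simp: polydisc_def)
    have "et f z = kernel_section (polydisc n) (product_kernel n k) ?w z" for z
    proof (cases "z \<in> polydisc n")
      case True
      then have "z i \<in> disc" if "i \<in> I" for i using that by (auto simp: polydisc_def PiE_def Pi_def)
      then have "f i (z i) = k i (z i) (?w i)" if "i \<in> I" for i
        using w[OF that] that by (simp add: kernel_section_def)
      then show ?thesis using True
        by (auto simp: elementary_tensor_def kernel_section_def product_kernel_def intro!: prod.cong)
    qed (simp add: elementary_tensor_def kernel_section_def)
    then show ?thesis using wp w by (intro bexI[of _ ?w]) auto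
  qed
  show ?thesis
    unfolding tensor_isometric_def
  proof (intro conjI ballI allI impI)
    fix i assume "i \<in> I"
    then interpret disc_module "k i" "H i" by (rule factor)
    show "?k i ` disc \<subseteq> fset (H i)" by auto
  next
    fix f assume "\<forall>i\<in>I. f i \<in> ?k i ` disc"
    then show "et f \<in> fset HK" using ex[of f] HK.kernel_mem by metis
  next
    fix f g assume fg: "(\<forall>i\<in>I. f i \<in> ?k i ` disc) \<and> (\<forall>i\<in>I. g i \<in> ?k i ` disc)"
    obtain w v where w: "w \<in> polydisc n" "\<forall>i\<in>I. f i = ?k i (w i)" "et f = HK.ker w"
      and v: "v \<in> polydisc n" "\<forall>i\<in>I. g i = ?k i (v i)" "et g = HK.ker v"
      using ex fg by metis
    have "finner HK (et f) (et g) = product_kernel n k v w"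
      using w v HK.inner_kernel[OF HK.kernel_mem[OF w(1)] v(1)] by (simp add: kernel_section_def)
    also have "\<dots> = (\<Prod>i\<in>I. finner (H i) (f i) (g i))"
      unfolding product_kernel_def
    proof (rule prod.cong[OF refl])
      fix i assume i: "i \<in> I"
      then interpret disc_module "k i" "H i" by (rule factor)
      have "w i \<in> disc" "v i \<in> disc" using w(1) v(1) i by (auto simp: polydisc_def PiE_def Pi_def)
      then show "k i (v i) (w i) = finner (H i) (f i) (g i)"
        using w(2) v(2) i inner_kernel[OF kernel_mem[of "w i"], of "v i"] by (simp add: kernel_section_def)
    qed
    finally show "finner HK (et f) (et g) = (\<Prod>i\<in>I. finner (H i) (f i) (g i))" .
  qed
qed

text \<open>Both sides of the product formula are linear in the vector h of slot \<open>j\<close>.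
  The scalar \<open>c g\<close> stands for the product over the other slots.\<close>

lemma slot_subspace:
  assumes j: "j \<in> I" and \<G>: "\<And>g. g \<in> \<G> \<Longrightarrow> et g \<in> fset HK" "\<And>g. g \<in> \<G> \<Longrightarrow> g j \<in> fset (H j)"
  shows "cfun.subspace {h \<in> fset (H j). et (f(j := h)) \<in> fset HK \<and>
    (\<forall>g\<in>\<G>. finner HK (et (f(j := h))) (et g) = finner (H j) h (g j) * c g)}"
proof -
  interpret Hj: hilbert_fun "H j" using j by (rule factor_hilbert)
  have "et (f(j := 0)) = 0" using elementary_tensor_zero[OF j, of "f(j := 0)"] by simp
  then show ?thesis
    using \<G> unfolding cfun.subspace_def
    by (auto simp: elementary_tensor_add[OF j] elementary_tensor_scale[OF j] HK.inner_add_left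
        Hj.inner_add_left HK.inner_scale_left Hj.inner_scale_left distrib_right)
qed

lemma tensor_isometric_span:
  assumes A: "tensor_isometric A" and j: "j \<in> I"
  shows "tensor_isometric (A(j := cfun.span (A j)))"
proof -
  interpret Hj: hilbert_fun "H j" using j by (rule factor_hilbert)
  let ?A = "A(j := cfun.span (A j))"
  have AH: "\<And>i. i \<in> I \<Longrightarrow> A i \<subseteq> fset (H i)"
    and mem: "\<And>f. (\<And>i. i \<in> I \<Longrightarrow> f i \<in> A i) \<Longrightarrow> et f \<in> fset HK"
    and ip: "\<And>f g. (\<And>i. i \<in> I \<Longrightarrow> f i \<in> A i) \<Longrightarrow> (\<And>i. i \<in> I \<Longrightarrow> g i \<in> A i) \<Longrightarrow>
        finner HK (et f) (et g) = (\<Prod>i\<in>I. finner (H i) (f i) (g i))"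
    using A unfolding tensor_isometric_def by blast+
  have A'H: "?A i \<subseteq> fset (H i)" if "i \<in> I" for i
    using AH[OF that] AH[OF j] Hj.span_subset_fset[of "A j"] by simp
  \<comment> \<open>Only the first argument leaves \<open>A\<close> here; the second one still
    ranges over \<open>A\<close>.\<close>
  have 1: "et f \<in> fset HK \<and> (\<forall>g. (\<forall>i\<in>I. g i \<in> A i) \<longrightarrow>
      finner HK (et f) (et g) = (\<Prod>i\<in>I. finner (H i) (f i) (g i)))" if f: "\<And>i. i \<in> I \<Longrightarrow> f i \<in> ?A i" for f
  proof -
    let ?S = "{h \<in> fset (H j). et (f(j := h)) \<in> fset HK \<and> (\<forall>g\<in>{g. \<forall>i\<in>I. g i \<in> A i}.
        finner HK (et (f(j := h))) (et g) = finner (H j) h (g j) * (\<Prod>i\<in>I - {j}. finner (H i) (f i) (g i)))}"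
    have "A j \<subseteq> ?S"
    proof
      fix h assume h: "h \<in> A j"
      have fh: "(f(j := h)) i \<in> A i" if "i \<in> I" for i
        using f[OF that] h by (cases "i = j") auto
      have "finner HK (et (f(j := h))) (et g) = finner (H j) h (g j) * (\<Prod>i\<in>I - {j}. finner (H i) (f i) (g i))"
        if g: "\<forall>i\<in>I. g i \<in> A i" for g
      proof -
        have "finner HK (et (f(j := h))) (et g) = (\<Prod>i\<in>I. finner (H i) ((f(j := h)) i) (g i))"
          by (rule ip[OF fh]) (use g in auto)
        also have "\<dots> = finner (H j) h (g j) * (\<Prod>i\<in>I - {j}. finner (H i) (f i) (g i))"
          by (rule prod_upd[OF j])
        finally show ?thesis .
      qed
      then show "h \<in> ?S" using mem[of "f(j := h)", OF fh] h AH[OF j] by auto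
    qed
    moreover have "cfun.subspace ?S"
    proof (rule slot_subspace[OF j])
      fix g assume "g \<in> {g. \<forall>i\<in>I. g i \<in> A i}"
      then show "et g \<in> fset HK" "g j \<in> fset (H j)" using mem[of g] AH[OF j] j by blast+
    qed
    ultimately have "cfun.span (A j) \<subseteq> ?S" by (rule cfun.span_minimal)
    then have "f j \<in> ?S" using f[OF j] by auto
    then show ?thesis using prod.remove[of I j "\<lambda>i. finner (H i) (f i) (_ i)"] j by auto
  qed
  \<comment> \<open>Conjugate symmetry turns the previous fact around, and the remaining argument is
    enlarged by the same linearity.\<close>
  have 2: "finner HK (et g) (et f) = (\<Prod>i\<in>I. finner (H i) (g i) (f i))"
    if f: "\<And>i. i \<in> I \<Longrightarrow> f i \<in> ?A i" and g: "\<And>i. i \<in> I \<Longrightarrow> g i \<in> ?A i" for f g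
  proof -
    let ?S = "{h \<in> fset (H j). et (g(j := h)) \<in> fset HK \<and> (\<forall>f\<in>{f. \<forall>i\<in>I. f i \<in> ?A i}.
        finner HK (et (g(j := h))) (et f) = finner (H j) h (f j) * (\<Prod>i\<in>I - {j}. finner (H i) (g i) (f i)))}"
    have "A j \<subseteq> ?S"
    proof
      fix h assume h: "h \<in> A j"
      have gh: "(g(j := h)) i \<in> A i" if "i \<in> I" for i
        using g[OF that] h by (cases "i = j") auto
      have "finner HK (et (g(j := h))) (et f) = finner (H j) h (f j) * (\<Prod>i\<in>I - {j}. finner (H i) (g i) (f i))"
        if f: "\<forall>i\<in>I. f i \<in> ?A i" for f
      proof -
        have fm: "et f \<in> fset HK" and "finner HK (et f) (et (g(j := h))) = (\<Prod>i\<in>I. finner (H i) (f i) ((g(j := h)) i))"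
          using 1[of f] f gh by blast+
        then have "finner HK (et (g(j := h))) (et f) = cnj (\<Prod>i\<in>I. finner (H i) (f i) ((g(j := h)) i))"
          using HK.inner_commute[OF fm mem[of "g(j := h)", OF gh]] by simp
        also have "\<dots> = (\<Prod>i\<in>I. finner (H i) ((g(j := h)) i) (f i))"
          unfolding cnj_prod
        proof (rule prod.cong[OF refl])
          fix i assume i: "i \<in> I"
          have "f i \<in> fset (H i)" "(g(j := h)) i \<in> fset (H i)"
            using f A'H[OF i] gh[OF i] AH[OF i] i by blast+
          then show "cnj (finner (H i) (f i) ((g(j := h)) i)) = finner (H i) ((g(j := h)) i) (f i)"
            using hilbert_fun.inner_commute[OF factor_hilbert[OF i]] by metis
        qed
        also have "\<dots> = finner (H j) h (f j) * (\<Prod>i\<in>I - {j}. finner (H i) (g i) (f i))"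
          by (rule prod_upd[OF j])
        finally show ?thesis .
      qed
      then show "h \<in> ?S" using mem[of "g(j := h)", OF gh] h AH[OF j] by auto
    qed
    moreover have "cfun.subspace ?S"
    proof (rule slot_subspace[OF j])
      fix f assume "f \<in> {f. \<forall>i\<in>I. f i \<in> ?A i}"
      then show "et f \<in> fset HK" "f j \<in> fset (H j)" using 1[of f] A'H[OF j] j by blast+
    qed
    ultimately have "cfun.span (A j) \<subseteq> ?S" by (rule cfun.span_minimal)
    then have "g j \<in> ?S" using g[OF j] by auto
    then show ?thesis using prod.remove[of I j "\<lambda>i. finner (H i) (g i) (f i)"] j f by auto
  qed
  show ?thesis
    unfolding tensor_isometric_def using A'H 1 2 by blast
qed

text \<open>Norm approximation in slot \<open>j\<close> gives a Cauchy sequence of tensors in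
  \<open>HK\<close>, whose limit is recognised by its values at points. Inner products then pass to
  the limit.\<close>

lemma tensor_isometric_dense:
  assumes A: "tensor_isometric A" and j: "j \<in> I" and sub: "cfun.subspace (A j)"
    and ker: "kernel_section disc (k j) ` disc \<subseteq> A j"
  shows "tensor_isometric (A(j := fset (H j)))"
proof -
  interpret Hj: disc_module "k j" "H j" using j by (rule factor)
  let ?A = "A(j := fset (H j))"
  have AH: "\<And>i. i \<in> I \<Longrightarrow> A i \<subseteq> fset (H i)"
    and mem: "\<And>f. (\<And>i. i \<in> I \<Longrightarrow> f i \<in> A i) \<Longrightarrow> et f \<in> fset HK"
    and ip: "\<And>f g. (\<And>i. i \<in> I \<Longrightarrow> f i \<in> A i) \<Longrightarrow> (\<And>i. i \<in> I \<Longrightarrow> g i \<in> A i) \<Longrightarrow>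
        finner HK (et f) (et g) = (\<Prod>i\<in>I. finner (H i) (f i) (g i))"
    using A unfolding tensor_isometric_def by blast+
  have appr: "\<exists>s. (\<forall>m. s m \<in> A j) \<and> Hj.flim s (f j) \<and> HK.flim (\<lambda>m. et (f(j := s m))) (et f)"
    if f: "\<And>i. i \<in> I \<Longrightarrow> f i \<in> ?A i" for f
  proof -
    have fj: "f j \<in> fset (H j)" using f[OF j] by simp
    obtain s where s: "\<And>m. s m \<in> A j" "Hj.flim s (f j)"
      using Hj.span_kernels_dense[OF fj sub AH[OF j]] ker by blast
    have fA: "(f(j := h)) i \<in> A i" if "h \<in> A j" "i \<in> I" for h i
      using f[OF that(2)] that(1) by (cases "i = j") auto
    \<comment> \<open>The product of the squared norms of the other factors.\<close>
    define c where "c = Re (\<Prod>i\<in>I - {j}. finner (H i) (f i) (f i))"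
    have nrm: "fnorm HK (et (f(j := h))) = sqrt c * fnorm (H j) h" if h: "h \<in> A j" for h
    proof -
      have hV: "h \<in> fset (H j)" using h AH[OF j] by blast
      have "finner HK (et (f(j := h))) (et (f(j := h))) = (\<Prod>i\<in>I. finner (H i) ((f(j := h)) i) ((f(j := h)) i))"
        by (rule ip) (use fA h in auto)
      also have "\<dots> = finner (H j) h h * (\<Prod>i\<in>I - {j}. finner (H i) (f i) (f i))"
        by (rule prod_upd[OF j, of "\<lambda>i h. finner (H i) h h"])
      finally have "Re (finner HK (et (f(j := h))) (et (f(j := h)))) = Re (finner (H j) h h) * c"
        using hV by (simp add: c_def Hj.inner_self)
      then show ?thesis by (simp add: fnorm_def real_sqrt_mult)
    qed
    define t where "t m = et (f(j := s m))" for m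
    have tV: "t m \<in> fset HK" for m unfolding t_def by (rule mem) (use fA s in auto)
    have dist: "fnorm HK (t m - t l) = sqrt c * fnorm (H j) (s m - s l)" for m l
      using nrm[of "s m - s l"] s(1) sub by (simp add: t_def elementary_tensor_diff[OF j] cfun.subspace_diff)
    obtain F where F: "HK.flim t F"
    proof (rule HK.complete[of t])
      fix e :: real assume e: "e > 0"
      \<comment> \<open>The summand 1 keeps the denominator positive even if another factor is
        zero.\<close>
      define d where "d = e / (\<bar>sqrt c\<bar> + 1)"
      have "d > 0" using e by (simp add: d_def add_nonneg_pos)
      then obtain N where N: "\<forall>m\<ge>N. \<forall>l\<ge>N. fnorm (H j) (s m - s l) < d"
        using Hj.flim_Cauchy[OF s(2)] by blast
      have "fnorm HK (t m - t l) < e" if "m \<ge> N" "l \<ge> N" for m l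
      proof -
        have pos: "0 \<le> fnorm (H j) (s m - s l)"
          using s(1) AH[OF j] by (intro Hj.fnorm_nonneg Hj.diff_mem) auto
        have "sqrt c * fnorm (H j) (s m - s l) \<le> (\<bar>sqrt c\<bar> + 1) * fnorm (H j) (s m - s l)"
          using pos by (intro mult_right_mono) auto
        also have "\<dots> < (\<bar>sqrt c\<bar> + 1) * d"
          using N that by (intro mult_strict_left_mono) (auto intro: add_nonneg_pos)
        also have "\<dots> = e" unfolding d_def using abs_ge_zero[of "sqrt c"] by (simp add: field_simps)
        finally show ?thesis using dist by simp
      qed
      then show "\<exists>N. \<forall>m\<ge>N. \<forall>l\<ge>N. fnorm HK (t m - t l) < e" by blast
    qed (use tV in auto)
    have "F = et f"
    proof
      fix z
      show "F z = et f z"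
      proof (cases "z \<in> polydisc n")
        case True
        have "(\<lambda>m. t m z) \<longlonglongrightarrow> f j (z j) * (\<Prod>i\<in>I - {j}. f i (z i))"
          unfolding t_def elementary_tensor_upd[OF j True]
          by (intro tendsto_intros Hj.flim_pointwise s)
        then have "(\<lambda>m. t m z) \<longlonglongrightarrow> et f z"
          using elementary_tensor_upd[OF j True, of f "f j"] by simp
        then show ?thesis using HK.flim_pointwise[OF F, of z] LIMSEQ_unique by blast
      next
        case False
        then show ?thesis using F HK.vanishes_outside elementary_tensor_outside by (auto simp: HK.flim_def)
      qed
    qed
    then show ?thesis using s F unfolding t_def by blast
  qed
  show ?thesis
    unfolding tensor_isometric_def
  proof (intro conjI ballI allI impI)
    show "?A i \<subseteq> fset (H i)" if "i \<in> I" for i using AH[OF that] by simp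
    show "et f \<in> fset HK" if "\<forall>i\<in>I. f i \<in> ?A i" for f
      using appr[of f] that by (auto simp: HK.flim_def)
    fix f g assume fg: "(\<forall>i\<in>I. f i \<in> ?A i) \<and> (\<forall>i\<in>I. g i \<in> ?A i)"
    obtain s where s: "\<And>m. s m \<in> A j" "Hj.flim s (f j)" "HK.flim (\<lambda>m. et (f(j := s m))) (et f)"
      using appr[of f] fg by blast
    obtain t where t: "\<And>m. t m \<in> A j" "Hj.flim t (g j)" "HK.flim (\<lambda>m. et (g(j := t m))) (et g)"
      using appr[of g] fg by blast
    have "finner HK (et (f(j := s m))) (et (g(j := t m))) =
        finner (H j) (s m) (t m) * (\<Prod>i\<in>I - {j}. finner (H i) (f i) (g i))" for m
    proof -
      have "(f(j := s m)) i \<in> A i" "(g(j := t m)) i \<in> A i" if "i \<in> I" for i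
        using fg s(1) t(1) that by (cases "i = j"; force)+
      then have "finner HK (et (f(j := s m))) (et (g(j := t m))) =
          (\<Prod>i\<in>I. finner (H i) ((f(j := s m)) i) ((g(j := t m)) i))" by (rule ip)
      also have "\<dots> = finner (H j) (s m) (t m) * (\<Prod>i\<in>I - {j}. finner (H i) (f i) (g i))"
        using prod.remove[of I j "\<lambda>i. finner (H i) ((f(j := s m)) i) ((g(j := t m)) i)"] j
        by (auto intro!: prod.cong)
      finally show ?thesis .
    qed
    then have "(\<lambda>m. finner (H j) (s m) (t m) * (\<Prod>i\<in>I - {j}. finner (H i) (f i) (g i))) \<longlonglongrightarrow> finner HK (et f) (et g)"
      using HK.flim_inner[OF s(3) t(3)] by simp
    moreover have "(\<lambda>m. finner (H j) (s m) (t m) * (\<Prod>i\<in>I - {j}. finner (H i) (f i) (g i)))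
        \<longlonglongrightarrow> finner (H j) (f j) (g j) * (\<Prod>i\<in>I - {j}. finner (H i) (f i) (g i))"
      by (intro tendsto_intros Hj.flim_inner s t)
    ultimately have "finner HK (et f) (et g) = finner (H j) (f j) (g j) * (\<Prod>i\<in>I - {j}. finner (H i) (f i) (g i))"
      using LIMSEQ_unique by blast
    then show "finner HK (et f) (et g) = (\<Prod>i\<in>I. finner (H i) (f i) (g i))"
      using prod.remove[of I j "\<lambda>i. finner (H i) (f i) (g i)"] j by simp
  qed
qed

text \<open>Induction on the set \<open>J\<close> of slots already enlarged; outside
  \<open>J\<close> the factors are still kernel sections.\<close>

lemma tensor_isometric_fset: "tensor_isometric (\<lambda>i. fset (H i))"
proof -
  have "tensor_isometric (\<lambda>i. if i \<in> J then fset (H i) else kernel_section disc (k i) ` disc)"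
    if "finite J" "J \<subseteq> I" for J
    using that
  proof (induction J rule: finite_induct)
    case empty
    then show ?case using tensor_isometric_kernels by simp
  next
    case (insert j J)
    let ?A = "\<lambda>i. if i \<in> J then fset (H i) else kernel_section disc (k i) ` disc"
    have j: "j \<in> I" and A: "tensor_isometric ?A" using insert by auto
    have "tensor_isometric ((?A(j := cfun.span (?A j)))(j := fset (H j)))"
      using insert.hyps(2)
      by (intro tensor_isometric_dense[OF tensor_isometric_span[OF A j] j])
        (auto simp: cfun.span_base)
    moreover have "(?A(j := cfun.span (?A j)))(j := fset (H j))
        = (\<lambda>i. if i \<in> insert j J then fset (H i) else kernel_section disc (k i) ` disc)"
      by (auto simp: fun_eq_iff)
    ultimately show ?case by simp
  qed
  from this[of I] have *: "tensor_isometric (\<lambda>i. if i \<in> I then fset (H i) else kernel_section disc (k i) ` disc)"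
    by simp
  then show ?thesis unfolding tensor_isometric_def by simp
qed

lemma et_mem: "(\<And>i. i \<in> I \<Longrightarrow> f i \<in> fset (H i)) \<Longrightarrow> et f \<in> fset HK"
  and et_inner: "(\<And>i. i \<in> I \<Longrightarrow> f i \<in> fset (H i)) \<Longrightarrow> (\<And>i. i \<in> I \<Longrightarrow> g i \<in> fset (H i)) \<Longrightarrow>
    finner HK (et f) (et g) = (\<Prod>i\<in>I. finner (H i) (f i) (g i))"
  using tensor_isometric_fset by (simp_all add: tensor_isometric_def)

end

context hilbert_fun
begin

lemma inner_sum_sum:
  assumes "\<And>a. a \<in> A \<Longrightarrow> f a \<in> fset H"
  shows "finner H (\<Sum>a\<in>A. cscale (c a) (f a)) (\<Sum>a\<in>A. cscale (c a) (f a)) =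
    (\<Sum>a\<in>A. \<Sum>b\<in>A. c a * cnj (c b) * finner H (f a) (f b))"
proof -
  have m: "(\<Sum>a\<in>A. cscale (c a) (f a)) \<in> fset H" using assms by (intro sum_mem) auto
  have "finner H (\<Sum>a\<in>A. cscale (c a) (f a)) (\<Sum>a\<in>A. cscale (c a) (f a)) =
      (\<Sum>a\<in>A. c a * finner H (f a) (\<Sum>a\<in>A. cscale (c a) (f a)))"
    using assms m by (subst inner_sum_left) (auto simp: inner_scale_left)
  also have "\<dots> = (\<Sum>a\<in>A. \<Sum>b\<in>A. c a * cnj (c b) * finner H (f a) (f b))"
  proof (rule sum.cong[OF refl])
    fix a assume a: "a \<in> A"
    have "finner H (f a) (\<Sum>a\<in>A. cscale (c a) (f a)) = (\<Sum>b\<in>A. cnj (c b) * finner H (f a) (f b))"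
      using assms a by (subst inner_sum_right) (auto simp: inner_scale_right)
    then show "c a * finner H (f a) (\<Sum>a\<in>A. cscale (c a) (f a)) = (\<Sum>b\<in>A. c a * cnj (c b) * finner H (f a) (f b))"
      by (simp add: sum_distrib_left mult.assoc)
  qed
  finally show ?thesis .
qed

end

section \<open>Coordinates are bounded multipliers of the tensor product\<close>

context polydisc_module
begin

lemma kernel_eq_et:
  assumes w: "w \<in> polydisc n"
  shows "HK.ker w = et (\<lambda>i. kernel_section disc (k i) (w i))"
proof
  fix z
  show "HK.ker w z = et (\<lambda>i. kernel_section disc (k i) (w i)) z"
  proof (cases "z \<in> polydisc n")
    case True
    then have "z i \<in> disc" if "i \<in> I" for i using that by (auto simp: polydisc_def PiE_def Pi_def)
    then show ?thesis using True
      by (auto simp: elementary_tensor_def kernel_section_def product_kernel_def intro!: prod.cong)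
  qed (simp add: elementary_tensor_def kernel_section_def)
qed

definition tensors :: "((nat \<Rightarrow> complex) \<Rightarrow> complex) set" where
  "tensors = {et f | f. \<forall>i\<in>I. f i \<in> fset (H i)}"

lemma tensors_subset: "tensors \<subseteq> fset HK"
  unfolding tensors_def using et_mem by blast

lemma tensors_dense:
  assumes "F \<in> fset HK"
  obtains s where "\<And>m. s m \<in> cfun.span tensors" "HK.flim s F"
proof (rule HK.span_kernels_dense[OF assms])
  show "cfun.span tensors \<subseteq> fset HK" by (rule HK.span_subset_fset[OF tensors_subset])
  fix w assume w: "w \<in> polydisc n"
  have "kernel_section disc (k i) (w i) \<in> fset (H i)" if i: "i \<in> I" for i
  proof -
    interpret disc_module "k i" "H i" using i by (rule factor)
    show ?thesis using w i by (intro kernel_mem) (auto simp: polydisc_def PiE_def Pi_def)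
  qed
  then have "HK.ker w \<in> tensors" unfolding kernel_eq_et[OF w] tensors_def by blast
  then show "HK.ker w \<in> cfun.span tensors" by (rule cfun.span_base)
qed (use that in auto)

lemma et_inner_upd:
  assumes j: "j \<in> I" and f: "\<And>i. i \<in> I \<Longrightarrow> f i \<in> fset (H i)" and g: "\<And>i. i \<in> I \<Longrightarrow> g i \<in> fset (H i)"
    and h: "h \<in> fset (H j)" "h' \<in> fset (H j)"
  shows "finner HK (et (f(j := h))) (et (g(j := h'))) =
    finner (H j) h h' * (\<Prod>i\<in>I - {j}. finner (H i) (f i) (g i))"
proof -
  have "(f(j := h)) i \<in> fset (H i)" "(g(j := h')) i \<in> fset (H i)" if "i \<in> I" for i
    using f g h that by auto
  then have "finner HK (et (f(j := h))) (et (g(j := h'))) =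
      (\<Prod>i\<in>I. finner (H i) ((f(j := h)) i) ((g(j := h')) i))" by (rule et_inner)
  also have "\<dots> = finner (H j) h h' * (\<Prod>i\<in>I - {j}. finner (H i) (f i) (g i))"
    using prod.remove[of I j "\<lambda>i. finner (H i) ((f(j := h)) i) ((g(j := h')) i)"] j
    by (auto intro!: prod.cong)
  finally show ?thesis .
qed

lemma et_upd_mem:
  assumes "\<And>i. i \<in> I \<Longrightarrow> f i \<in> fset (H i)" "h \<in> fset (H j)"
  shows "et (f(j := h)) \<in> fset HK"
  by (rule et_mem) (use assms in auto)

text \<open>Supplies a neutral vector to fill a slot. The kernel section at 0 is nonzero because
  \<open>k j\<close> has no zeros.\<close>

lemma factor_unit_vector:
  assumes "j \<in> I"
  obtains e where "e \<in> fset (H j)" "finner (H j) e e = 1"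
proof -
  interpret disc_module "k j" "H j" using assms by (rule factor)
  have z: "(0 :: complex) \<in> disc" by simp
  have "ker 0 0 \<noteq> 0" using kernel_nonzero[OF z z] by (simp add: kernel_section_def)
  then have "ker 0 \<notin> cfun.span {}" by auto
  then obtain e where e: "finner (H j) e e = 1" "e \<in> cfun.span {ker 0}"
    using orthonormal_extend[of "{}" "ker 0"] kernel_mem[OF z] by (auto simp: orthonormal_def)
  then have "e \<in> fset (H j)" using span_subset_fset[of "{ker 0}"] kernel_mem[OF z] by blast
  then show thesis using that e by blast
qed

text \<open>Expanding the Gram matrix of the remaining tensor factors in an orthonormal basis turns the
  norm of a sum of tensors into a sum of squares of norms in the \<open>j\<close>-th factor, for all operators on
  that factor simultaneously.\<close>

lemma slot_decomposition:
  assumes j: "j \<in> I" and fin: "finite A" and \<phi>: "\<forall>a\<in>A. \<forall>i\<in>I. \<phi> a i \<in> fset (H i)"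
  shows "\<exists>(E :: ((nat \<Rightarrow> complex) \<Rightarrow> complex) set) h. (\<forall>e\<in>E. h e \<in> fset (H j)) \<and>
    (\<forall>T. hilbert_fun.bounded_op (H j) (fset (H j)) T \<longrightarrow>
      (fnorm HK (\<Sum>a\<in>A. cscale (c a) (et ((\<phi> a)(j := T (\<phi> a j))))))\<^sup>2 = (\<Sum>e\<in>E. (fnorm (H j) (T (h e)))\<^sup>2))"
proof -
  interpret Hj: hilbert_fun "H j" using j by (rule factor_hilbert)
  obtain u where u: "u \<in> fset (H j)" "finner (H j) u u = 1" using factor_unit_vector[OF j] by blast
  \<comment> \<open>With the unit vector u in slot \<open>j\<close>, the Gram matrix of these
    tensors is the product over the other slots alone.\<close>
  define g where "g a = et ((\<phi> a)(j := u))" for a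
  have gV: "g a \<in> fset HK" if "a \<in> A" for a
    unfolding g_def by (rule et_upd_mem) (use \<phi> that u in auto)
  obtain E where E: "finite E" "HK.orthonormal E" "cfun.span E = cfun.span (g ` A)"
    using HK.finite_orthonormal_basis[of "g ` A"] fin gV by blast
  \<comment> \<open>Neither \<open>E\<close> nor \<open>h\<close> depends on \<open>T\<close>, so
    that norms for different operators can be compared term by term.\<close>
  define h where "h e = (\<Sum>a\<in>A. cscale (c a * finner HK (g a) e) (\<phi> a j))" for e
  have \<phi>j: "\<phi> a j \<in> fset (H j)" if "a \<in> A" for a using \<phi> that j by blast
  show ?thesis
  proof (intro exI conjI ballI allI impI)
    show "h e \<in> fset (H j)" for e unfolding h_def using \<phi>j by (intro Hj.sum_mem) auto
    fix T assume T: "Hj.bounded_op (fset (H j)) T"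
    have T\<phi>: "T (\<phi> a j) \<in> fset (H j)" if "a \<in> A" for a using Hj.bounded_opD(1)[OF T] \<phi>j that by blast
    let ?F = "\<Sum>a\<in>A. cscale (c a) (et ((\<phi> a)(j := T (\<phi> a j))))"
    have FV: "et ((\<phi> a)(j := T (\<phi> a j))) \<in> fset HK" if "a \<in> A" for a
      by (rule et_upd_mem) (use \<phi> that T\<phi> in auto)
    have Th: "T (h e) = (\<Sum>a\<in>A. cscale (c a * finner HK (g a) e) (T (\<phi> a j)))" for e
      unfolding h_def using \<phi>j Hj.bounded_opD(3)[OF T]
      by (subst Hj.bounded_op_sum[OF T Hj.subspace_fset]) auto
    have ThV: "T (h e) \<in> fset (H j)" for e unfolding Th using T\<phi> by (intro Hj.sum_mem) auto
    have "finner HK ?F ?F = (\<Sum>a\<in>A. \<Sum>b\<in>A. c a * cnj (c b) *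
        finner HK (et ((\<phi> a)(j := T (\<phi> a j)))) (et ((\<phi> b)(j := T (\<phi> b j)))))"
      using FV by (rule HK.inner_sum_sum)
    also have "\<dots> = (\<Sum>a\<in>A. \<Sum>b\<in>A. \<Sum>e\<in>E. (c a * finner HK (g a) e) * cnj (c b * finner HK (g b) e) *
        finner (H j) (T (\<phi> a j)) (T (\<phi> b j)))"
    proof (intro sum.cong refl)
      fix a b assume a: "a \<in> A" and b: "b \<in> A"
      have "finner HK (et ((\<phi> a)(j := T (\<phi> a j)))) (et ((\<phi> b)(j := T (\<phi> b j))))
          = finner (H j) (T (\<phi> a j)) (T (\<phi> b j)) * (\<Prod>i\<in>I - {j}. finner (H i) (\<phi> a i) (\<phi> b i))"
        using \<phi> a b T\<phi> by (intro et_inner_upd[OF j]) auto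
      also have "(\<Prod>i\<in>I - {j}. finner (H i) (\<phi> a i) (\<phi> b i)) = finner HK (g a) (g b)"
        unfolding g_def using et_inner_upd[OF j, of "\<phi> a" "\<phi> b" u u] \<phi> a b u by simp
      also have "\<dots> = (\<Sum>e\<in>E. finner HK (g a) e * cnj (finner HK (g b) e))"
        using E a b gV by (intro HK.Parseval_finite) (auto simp: cfun.span_base)
      finally have eq: "finner HK (et ((\<phi> a)(j := T (\<phi> a j)))) (et ((\<phi> b)(j := T (\<phi> b j))))
          = finner (H j) (T (\<phi> a j)) (T (\<phi> b j)) * (\<Sum>e\<in>E. finner HK (g a) e * cnj (finner HK (g b) e))" .
      show "c a * cnj (c b) * finner HK (et ((\<phi> a)(j := T (\<phi> a j)))) (et ((\<phi> b)(j := T (\<phi> b j))))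
          = (\<Sum>e\<in>E. (c a * finner HK (g a) e) * cnj (c b * finner HK (g b) e) *
              finner (H j) (T (\<phi> a j)) (T (\<phi> b j)))"
        unfolding eq by (simp add: sum_distrib_left ac_simps)
    qed
    also have "\<dots> = (\<Sum>e\<in>E. \<Sum>a\<in>A. \<Sum>b\<in>A. (c a * finner HK (g a) e) * cnj (c b * finner HK (g b) e) *
        finner (H j) (T (\<phi> a j)) (T (\<phi> b j)))"
      by (simp add: sum.swap[of _ E])
    also have "\<dots> = (\<Sum>e\<in>E. finner (H j) (T (h e)) (T (h e)))"
      unfolding Th using T\<phi> by (intro sum.cong refl Hj.inner_sum_sum[symmetric])
    finally have "Re (finner HK ?F ?F) = (\<Sum>e\<in>E. (fnorm (H j) (T (h e)))\<^sup>2)"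
      using ThV by (simp add: Hj.fnorm_sq)
    moreover have "?F \<in> fset HK" using FV by (intro HK.sum_mem) auto
    ultimately show "(fnorm HK ?F)\<^sup>2 = (\<Sum>e\<in>E. (fnorm (H j) (T (h e)))\<^sup>2)"
      by (simp add: HK.fnorm_sq)
  qed
qed

lemma mult_op_sum_scale:
  "mult_op \<psi> (\<Sum>a\<in>A. cscale (c a) (f a)) = (\<Sum>a\<in>A. cscale (c a) (mult_op \<psi> (f a)))"
  by (simp add: mult_op_def cscale_def fun_eq_iff sum_fun_apply sum_distrib_left mult.left_commute)

text \<open>On sums of tensors, the slot decomposition for the identity and for multiplication on
  \<open>H j\<close> have the same index set and vectors, so the bound on \<open>H j\<close> carries
  over with the same constant. Density extends it to \<open>HK\<close>.\<close>

lemma bounded_coord: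
  assumes j: "j \<in> I"
  shows "bounded_multiplier HK (coord j)"
proof -
  interpret Hj: disc_module "k j" "H j" using j by (rule factor)
  obtain C where C: "C \<ge> 0" "\<And>f. f \<in> fset (H j) \<Longrightarrow> fnorm (H j) (Hj.M f) \<le> C * fnorm (H j) f"
    using Hj.bounded_op_bound[OF Hj.bounded_op_M] by blast
  have base: "mult_op (coord j) F \<in> fset HK \<and> fnorm HK (mult_op (coord j) F) \<le> C * fnorm HK F"
    if F_span: "F \<in> cfun.span tensors" for F
  proof -
    obtain A c where A: "finite A" "A \<subseteq> tensors" "F = (\<Sum>a\<in>A. cscale (c a) a)"
      using F_span by (auto simp: cfun.span_explicit)
    have "\<forall>a\<in>A. \<exists>f. (\<forall>i\<in>I. f i \<in> fset (H i)) \<and> a = et f"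
      using A(2) unfolding tensors_def by blast
    then obtain \<phi> where \<phi>: "\<forall>a\<in>A. \<forall>i\<in>I. \<phi> a i \<in> fset (H i)" "\<And>a. a \<in> A \<Longrightarrow> a = et (\<phi> a)"
      by metis
    obtain E :: "((nat \<Rightarrow> complex) \<Rightarrow> complex) set" and h where h: "\<forall>e\<in>E. h e \<in> fset (H j)"
      and norm: "\<forall>T. Hj.bounded_op (fset (H j)) T \<longrightarrow>
        (fnorm HK (\<Sum>a\<in>A. cscale (c a) (et ((\<phi> a)(j := T (\<phi> a j))))))\<^sup>2 = (\<Sum>e\<in>E. (fnorm (H j) (T (h e)))\<^sup>2)"
      using slot_decomposition[OF j A(1), OF \<phi>(1), of c] by (elim exE conjE)
    have "Hj.bounded_op (fset (H j)) (\<lambda>f. f)"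
      by (auto simp: Hj.bounded_op_def intro!: exI[of _ 1])
    from norm[rule_format, OF this] have F: "(fnorm HK F)\<^sup>2 = (\<Sum>e\<in>E. (fnorm (H j) (h e))\<^sup>2)"
      using A(3) \<phi>(2) by (simp cong: sum.cong)
    have MF: "mult_op (coord j) F = (\<Sum>a\<in>A. cscale (c a) (et ((\<phi> a)(j := Hj.M (\<phi> a j)))))"
      unfolding A(3) mult_op_sum_scale
      using \<phi>(2) by (intro sum.cong refl) (metis elementary_tensor_coord[OF j])
    have "et ((\<phi> a)(j := Hj.M (\<phi> a j))) \<in> fset HK" if "a \<in> A" for a
      by (rule et_upd_mem) (use \<phi> that Hj.bounded_opD(1)[OF Hj.bounded_op_M] j in auto)
    then have mem: "mult_op (coord j) F \<in> fset HK"
      unfolding MF by (intro HK.sum_mem HK.scale_mem)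
    have FV: "F \<in> fset HK" using F_span HK.span_subset_fset[OF tensors_subset] by blast
    have "(fnorm HK (mult_op (coord j) F))\<^sup>2 = (\<Sum>e\<in>E. (fnorm (H j) (Hj.M (h e)))\<^sup>2)"
      unfolding MF by (rule norm[rule_format, OF Hj.bounded_op_M])
    also have "\<dots> \<le> (\<Sum>e\<in>E. (C * fnorm (H j) (h e))\<^sup>2)"
      using h C(2) Hj.bounded_opD(1)[OF Hj.bounded_op_M] by (intro sum_mono power_mono) auto
    also have "\<dots> = (C * fnorm HK F)\<^sup>2"
      by (simp add: power_mult_distrib F sum_distrib_left)
    finally have "fnorm HK (mult_op (coord j) F) \<le> C * fnorm HK F"
      using C(1) FV by (meson HK.fnorm_nonneg mult_nonneg_nonneg power2_le_imp_le)
    then show ?thesis using mem by blast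
  qed
  have "mult_op (coord j) F \<in> fset HK \<and> fnorm HK (mult_op (coord j) F) \<le> C * fnorm HK F"
    if F: "F \<in> fset HK" for F
  proof -
    obtain s where s: "\<And>m. s m \<in> cfun.span tensors" "HK.flim s F"
      using tensors_dense[OF F] by blast
    define t where "t m = mult_op (coord j) (s m)" for m
    have tV: "t m \<in> fset HK" for m using base[OF s(1)] by (simp add: t_def)
    have diff: "fnorm HK (t m - t l) \<le> C * fnorm HK (s m - s l)" for m l
    proof -
      have "t m - t l = mult_op (coord j) (s m - s l)"
        by (simp add: t_def mult_op_def fun_eq_iff algebra_simps)
      then show ?thesis using base[of "s m - s l"] s(1) by (simp add: cfun.span_diff)
    qed
    obtain G where G: "HK.flim t G"
    proof (rule HK.complete[of t])
      fix e :: real assume e: "e > 0"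
      \<comment> \<open>C may be zero, hence the denominator C + 1.\<close>
      then obtain N where N: "\<forall>m\<ge>N. \<forall>l\<ge>N. fnorm HK (s m - s l) < e / (C + 1)"
        using HK.flim_Cauchy[OF s(2), of "e / (C + 1)"] C(1) by auto
      have "fnorm HK (t m - t l) < e" if "m \<ge> N" "l \<ge> N" for m l
      proof -
        have pos: "0 \<le> fnorm HK (s m - s l)"
          using s(2) by (intro HK.fnorm_nonneg HK.diff_mem) (auto simp: HK.flim_def)
        have "fnorm HK (t m - t l) \<le> C * fnorm HK (s m - s l)" by (rule diff)
        also have "\<dots> \<le> (C + 1) * fnorm HK (s m - s l)" using pos by (intro mult_right_mono) auto
        also have "\<dots> < (C + 1) * (e / (C + 1))"
          using N that C(1) by (intro mult_strict_left_mono) auto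
        also have "\<dots> = e" using C(1) by simp
        finally show ?thesis .
      qed
      then show "\<exists>N. \<forall>m\<ge>N. \<forall>l\<ge>N. fnorm HK (t m - t l) < e" by blast
    qed (use tV in auto)
    have "G z = mult_op (coord j) F z" for z
    proof -
      have "(\<lambda>m. coord j z * s m z) \<longlonglongrightarrow> coord j z * F z"
        by (intro tendsto_intros HK.flim_pointwise s)
      then show ?thesis using HK.flim_pointwise[OF G, of z] LIMSEQ_unique
        by (auto simp: t_def mult_op_def)
    qed
    then have GF: "G = mult_op (coord j) F" by blast
    have "fnorm HK G \<le> C * fnorm HK F"
    proof (rule LIMSEQ_le[OF HK.flim_fnorm[OF G]])
      show "(\<lambda>m. C * fnorm HK (s m)) \<longlonglongrightarrow> C * fnorm HK F"
        by (intro tendsto_intros HK.flim_fnorm s)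
      show "\<exists>N. \<forall>m\<ge>N. fnorm HK (t m) \<le> C * fnorm HK (s m)"
        using base[OF s(1)] by (auto simp: t_def)
    qed
    then show ?thesis using G GF by (auto simp: HK.flim_def)
  qed
  then show ?thesis unfolding bounded_multiplier_def by blast
qed

end

section \<open>Quotient modules of the tensor product\<close>

context hilbert_fun
begin

lemma unit_vector:
  assumes Q: "cfun.subspace Q" "Q \<subseteq> fset H" and f: "f \<in> Q" "f \<noteq> 0"
  obtains e where "e \<in> Q" "finner H e e = 1" "f \<in> cfun.span {e}"
proof -
  have fV: "f \<in> fset H" using f Q by blast
  have "f \<notin> cfun.span {}" using f by simp
  then obtain e where e: "finner H e e = 1" "e \<in> cfun.span {f}" "f \<in> cfun.span {e}"
    using orthonormal_extend[of "{}" f] fV by (auto simp: orthonormal_def)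
  have "cfun.span {f} \<subseteq> Q" using f Q by (intro cfun.span_minimal) auto
  then show thesis using that e by blast
qed

end

text \<open>\<open>cfun.dim\<close> is the cardinality of a basis, and infinite sets have
  cardinality 0; so the value 1 does yield a singleton basis.\<close>

lemma one_dimensional_span:
  assumes "cfun.subspace S" "cfun.dim S = 1"
  obtains b where "b \<in> S" "b \<noteq> 0" "S = cfun.span {b}"
proof -
  obtain B where B: "B \<subseteq> S" "cfun.independent B" "S \<subseteq> cfun.span B" "card B = cfun.dim S"
    using cfun.basis_exists by blast
  then obtain b where b: "B = {b}" using assms(2) by (metis card_1_singletonE)
  have "b \<noteq> 0" using B(2) b cfun.dependent_zero by auto
  moreover have "cfun.span {b} \<subseteq> S" using B(1) b assms(1) by (intro cfun.span_minimal) auto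
  ultimately show thesis using that[of b] B b by auto
qed

lemma dim_span_singleton:
  assumes "b \<noteq> 0" shows "cfun.dim (cfun.span {b}) = 1"
proof -
  have "cfun.independent {b}" using assms by simp
  then show ?thesis by (simp add: cfun.dim_eq_card_independent)
qed

locale tensor_quotient = polydisc_module +
  fixes Qi :: "nat \<Rightarrow> (complex \<Rightarrow> complex) set" and Q :: "((nat \<Rightarrow> complex) \<Rightarrow> complex) set"
  assumes factor_quotient: "\<And>i. i \<in> {1..n} \<Longrightarrow> quotient_module (H i) {\<lambda>z. z} (Qi i)"
    and Q_eq: "Q = tensor_subspace HK n Qi"
    and Q_closed: "closed_subspace HK Q"
begin

lemma Qi_closed: "i \<in> I \<Longrightarrow> closed_subspace (H i) (Qi i)"
  using factor_quotient by (simp add: quotient_module_def)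

lemma Qi_subspace: "i \<in> I \<Longrightarrow> cfun.subspace (Qi i)"
  using Qi_closed by (simp add: closed_subspace_def)

lemma Qi_subset: "i \<in> I \<Longrightarrow> Qi i \<subseteq> fset (H i)"
  using hilbert_fun.closed_subspaceD(2)[OF factor_hilbert Qi_closed] .

lemma Qi_mem: "i \<in> I \<Longrightarrow> f \<in> Qi i \<Longrightarrow> f \<in> fset (H i)"
  using Qi_subset by blast

lemmas Q_subspace = HK.closed_subspaceD(1)[OF Q_closed]
lemmas Q_subset = HK.closed_subspaceD(2)[OF Q_closed]

lemma et_fset: "(\<And>i. i \<in> I \<Longrightarrow> f i \<in> Qi i) \<Longrightarrow> et f \<in> fset HK"
  by (rule et_mem) (use Qi_mem in blast)

lemma span_tensors_subset:
  "cfun.span {et f | f. \<forall>i\<in>I. f i \<in> Qi i} \<subseteq> fset HK"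
  using et_fset by (intro HK.span_subset_fset) blast

lemma et_Q: assumes "\<And>i. i \<in> I \<Longrightarrow> f i \<in> Qi i" shows "et f \<in> Q"
proof -
  have "et f \<in> cfun.span {et f | f. \<forall>i\<in>I. f i \<in> Qi i}" using assms by (intro cfun.span_base) blast
  then show ?thesis
    using closure_of_subset[of _ "ftopology HK"] span_tensors_subset
    unfolding Q_eq tensor_subspace_def HK.ftopology_eq HK.topspace_mtopology by blast
qed

text \<open>Reduces linear, continuous statements about \<open>Q\<close> to elementary
  tensors.\<close>

lemma Q_minimal:
  assumes W: "closed_subspace HK W" and et: "\<And>f. (\<And>i. i \<in> I \<Longrightarrow> f i \<in> Qi i) \<Longrightarrow> et f \<in> W"
  shows "Q \<subseteq> W"
proof -
  have "cfun.span {et f | f. \<forall>i\<in>I. f i \<in> Qi i} \<subseteq> W"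
    using et HK.closed_subspaceD(1)[OF W] by (intro cfun.span_minimal) auto
  then show ?thesis
    unfolding Q_eq tensor_subspace_def using W by (intro closure_of_minimal) (auto simp: closed_subspace_def)
qed

lemma orthogonal_to_tensors:
  assumes F: "F \<in> fset HK" and orth: "\<And>f. (\<And>i. i \<in> I \<Longrightarrow> f i \<in> Qi i) \<Longrightarrow> finner HK (et f) F = 0"
    and G: "G \<in> Q"
  shows "finner HK G F = 0"
proof -
  have "closed_subspace HK {G \<in> fset HK. \<forall>F\<in>{F}. finner HK G F = 0}"
    by (rule HK.closed_subspace_orthogonal_in) (use F in auto)
  then have "Q \<subseteq> {G \<in> fset HK. \<forall>F\<in>{F}. finner HK G F = 0}"
    by (rule Q_minimal) (use orth et_fset in auto)
  then show ?thesis using G by auto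
qed

text \<open>The uniqueness test for all that follows: members of \<open>Q\<close> are equal if they
  have the same inner products with elementary tensors.\<close>

lemma orthogonal_to_tensors_zero:
  assumes F: "F \<in> Q" and orth: "\<And>f. (\<And>i. i \<in> I \<Longrightarrow> f i \<in> Qi i) \<Longrightarrow> finner HK (et f) F = 0"
  shows "F = 0"
  using orthogonal_to_tensors[OF _ orth F] F Q_subset HK.inner_self_eq_0_iff[of F] by blast

section \<open>Operators of the quotient module on elementary tensors\<close>

abbreviation "Cj j \<equiv> compression (H j) (Qi j) (\<lambda>z. z)"
abbreviation "Aj j \<equiv> adjoint_on (H j) (Qi j) (Cj j)"
abbreviation "Dj j \<equiv> cross_commutator (H j) (Qi j) (\<lambda>z. z) (\<lambda>z. z)"

lemma factor_ops:
  assumes j: "j \<in> I"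
  shows bounded_Cj: "hilbert_fun.bounded_op (H j) (Qi j) (Cj j)"
    and bounded_Aj: "hilbert_fun.bounded_op (H j) (Qi j) (Aj j)"
    and bounded_Dj: "hilbert_fun.bounded_op (H j) (Qi j) (Dj j)"
proof -
  interpret Hj: disc_module "k j" "H j" using j by (rule factor)
  note b = Hj.bounded_coordinate and Q = Qi_closed[OF j]
  show "Hj.bounded_op (Qi j) (Cj j)" by (rule Hj.bounded_op_compression[OF Q b])
  then show "Hj.bounded_op (Qi j) (Aj j)" by (rule Hj.bounded_op_adjoint_on[OF Q])
  show "Hj.bounded_op (Qi j) (Dj j)" by (rule Hj.bounded_op_cross_commutator[OF Q b b])
qed

lemma factor_op_mem:
  assumes "j \<in> I" "f \<in> Qi j"
  shows "Cj j f \<in> Qi j" "Aj j f \<in> Qi j" "Dj j f \<in> Qi j"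
  using hilbert_fun.bounded_opD(1)[OF factor_hilbert[OF assms(1)]] factor_ops[OF assms(1)] assms(2)
  by blast+

text \<open>The residual carries in slot \<open>j\<close> a vector orthogonal to
  \<open>Qi j\<close>, so it is orthogonal to every tensor from the factors and thus to
  \<open>Q\<close>.\<close>

lemma compression_et:
  assumes j: "j \<in> I" and f: "\<And>i. i \<in> I \<Longrightarrow> f i \<in> Qi i"
  shows "compression HK Q (coord j) (et f) = et (f(j := Cj j (f j)))"
  unfolding compression_def elementary_tensor_coord[OF j]
proof (rule HK.orth_proj_unique[OF Q_closed])
  interpret Hj: disc_module "k j" "H j" using j by (rule factor)
  have MV: "Hj.M (f j) \<in> fset (H j)"
    using Hj.bounded_opD(1)[OF Hj.bounded_op_M] Qi_mem[OF j f[OF j]] by blast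
  have C: "Cj j (f j) \<in> Qi j" using factor_op_mem[OF j f[OF j]] by blast
  show "et (f(j := orth_proj (H j) (Qi j) (Hj.M (f j)))) \<in> Q"
    by (rule et_Q) (use f C in \<open>auto simp: compression_def\<close>)
  let ?d = "Hj.M (f j) - orth_proj (H j) (Qi j) (Hj.M (f j))"
  have d: "?d \<in> fset (H j)" "\<And>g. g \<in> Qi j \<Longrightarrow> finner (H j) ?d g = 0"
    using Hj.orth_proj_compl[OF Qi_closed[OF j] MV] by (auto simp: orth_complement_def)
  have dV: "et (f(j := ?d)) \<in> fset HK"
    by (rule et_upd_mem) (use f Qi_mem d in auto)
  have "finner HK (et (f(j := ?d))) G = 0" if "G \<in> Q" for G
  proof -
    have "finner HK G (et (f(j := ?d))) = 0"
    proof (rule orthogonal_to_tensors[OF dV _ that])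
      fix g assume g: "\<And>i. i \<in> I \<Longrightarrow> g i \<in> Qi i"
      have "finner HK (et (f(j := ?d))) (et (g(j := g j))) = 0"
        using f g Qi_mem d j by (subst et_inner_upd[OF j]) auto
      then show "finner HK (et g) (et (f(j := ?d))) = 0"
        using HK.inner_commute[OF dV et_fset[OF g]] by simp
    qed
    then show ?thesis using HK.inner_commute[OF _ dV, of G] that Q_subset by auto
  qed
  then show "et (f(j := Hj.M (f j))) - et (f(j := orth_proj (H j) (Qi j) (Hj.M (f j)))) \<in> orth_complement HK Q"
    using dV by (simp add: orth_complement_def elementary_tensor_diff[OF j])
qed

lemma bounded_compression: "j \<in> I \<Longrightarrow> HK.bounded_op Q (compression HK Q (coord j))"
  by (rule HK.bounded_op_compression[OF Q_closed bounded_coord])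

text \<open>Both sides are tested against tensors, where the compression is known to act in slot
  \<open>j\<close> only.\<close>

lemma adjoint_et:
  assumes j: "j \<in> I" and f: "\<And>i. i \<in> I \<Longrightarrow> f i \<in> Qi i"
  shows "adjoint_on HK Q (compression HK Q (coord j)) (et f) = et (f(j := Aj j (f j)))"
proof -
  interpret Hj: disc_module "k j" "H j" using j by (rule factor)
  let ?A = "adjoint_on HK Q (compression HK Q (coord j)) (et f)"
  let ?e = "et (f(j := Aj j (f j)))"
  note C = bounded_compression[OF j]
  have A: "Aj j (f j) \<in> Qi j" using factor_op_mem[OF j f[OF j]] by blast
  have AQ: "?A \<in> Q" by (rule HK.adjoint_on_mem[OF Q_closed C et_Q[OF f]])
  have eQ: "?e \<in> Q" by (rule et_Q) (use f A in auto)
  have "?A - ?e = 0"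
  proof (rule orthogonal_to_tensors_zero)
    show "?A - ?e \<in> Q" using AQ eQ Q_subspace by (rule cfun.subspace_diff[rotated])
    fix g assume g: "\<And>i. i \<in> I \<Longrightarrow> g i \<in> Qi i"
    have gC: "Cj j (g j) \<in> Qi j" using factor_op_mem[OF j g[OF j]] by blast
    have "finner HK (et g) ?A = finner HK (et (g(j := Cj j (g j)))) (et f)"
      using HK.inner_adjoint_on[OF Q_closed C et_Q[OF f] et_Q[OF g]] compression_et[OF j g] by simp
    also have "\<dots> = finner HK (et (g(j := Cj j (g j)))) (et (f(j := f j)))" by simp
    also have "\<dots> = finner (H j) (Cj j (g j)) (f j) * (\<Prod>i\<in>I - {j}. finner (H i) (g i) (f i))"
      using f g gC Qi_mem j by (intro et_inner_upd[OF j]) blast+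
    also have "finner (H j) (Cj j (g j)) (f j) = finner (H j) (g j) (Aj j (f j))"
      using Hj.inner_adjoint_on[OF Qi_closed[OF j] bounded_Cj[OF j] f[OF j] g[OF j]] by simp
    also have "\<dots> * (\<Prod>i\<in>I - {j}. finner (H i) (g i) (f i)) = finner HK (et (g(j := g j))) ?e"
      using f g A Qi_mem j by (intro et_inner_upd[OF j, symmetric]) blast+
    finally have "finner HK (et g) ?A = finner HK (et g) ?e" by simp
    then show "finner HK (et g) (?A - ?e) = 0"
      using HK.inner_diff_right[OF et_fset[OF g], of ?A ?e] AQ eQ Q_subset by auto
  qed
  then show ?thesis by simp
qed

lemma cross_commutator_et:
  assumes j: "j \<in> I" and f: "\<And>i. i \<in> I \<Longrightarrow> f i \<in> Qi i"
  shows "cross_commutator HK Q (coord j) (coord j) (et f) = et (f(j := Dj j (f j)))"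
proof -
  have C: "Cj j (f j) \<in> Qi j" and A: "Aj j (f j) \<in> Qi j" using factor_op_mem[OF j f[OF j]] by blast+
  have "(f(j := Cj j (f j))) i \<in> Qi i" "(f(j := Aj j (f j))) i \<in> Qi i" if "i \<in> I" for i
    using f C A that by auto
  then show ?thesis
    using compression_et[OF j, of f] compression_et[OF j, of "f(j := Aj j (f j))"]
      adjoint_et[OF j, of f] adjoint_et[OF j, of "f(j := Cj j (f j))"] f
    unfolding cross_commutator_def commutator_def by (simp add: elementary_tensor_diff[OF j])
qed

text \<open>Operators acting in different slots commute.\<close>

lemma cross_commutator_et_distinct:
  assumes a: "a \<in> I" and b: "b \<in> I" and ab: "a \<noteq> b" and f: "\<And>i. i \<in> I \<Longrightarrow> f i \<in> Qi i"
  shows "cross_commutator HK Q (coord a) (coord b) (et f) = 0"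
proof -
  have C: "Cj a (f a) \<in> Qi a" and A: "Aj b (f b) \<in> Qi b"
    using factor_op_mem[OF a f[OF a]] factor_op_mem[OF b f[OF b]] by blast+
  have "(f(a := Cj a (f a))) i \<in> Qi i" "(f(b := Aj b (f b))) i \<in> Qi i" if "i \<in> I" for i
    using f C A that by auto
  then show ?thesis
    using compression_et[OF a, of f] compression_et[OF a, of "f(b := Aj b (f b))"]
      adjoint_et[OF b, of f] adjoint_et[OF b, of "f(a := Cj a (f a))"] f ab
    unfolding cross_commutator_def commutator_def by (simp add: fun_upd_twist)
qed

lemma bounded_cross_commutator:
  "a \<in> I \<Longrightarrow> b \<in> I \<Longrightarrow> HK.bounded_op Q (cross_commutator HK Q (coord a) (coord b))"
  by (intro HK.bounded_op_cross_commutator Q_closed bounded_coord)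

lemma fnorm_et_upd:
  assumes j: "j \<in> I" and f: "\<And>i. i \<in> I - {j} \<Longrightarrow> f i \<in> Qi i" and h: "h \<in> Qi j"
  shows "fnorm HK (et (f(j := h))) = fnorm (H j) h * (\<Prod>i\<in>I - {j}. fnorm (H i) (f i))"
proof -
  let ?f = "f(j := h)"
  have f': "?f i \<in> fset (H i)" if "i \<in> I" for i using f h Qi_mem that by (cases "i = j") auto
  have "finner HK (et ?f) (et ?f) = (\<Prod>i\<in>I. finner (H i) (?f i) (?f i))"
    by (rule et_inner) (use f' in auto)
  also have "\<dots> = (\<Prod>i\<in>I. of_real ((fnorm (H i) (?f i))\<^sup>2))"
    by (intro prod.cong refl hilbert_fun.inner_self[OF factor_hilbert] f')
  also have "\<dots> = of_real ((\<Prod>i\<in>I. fnorm (H i) (?f i))\<^sup>2)" by (simp add: prod_power_distrib)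
  finally have "Re (finner HK (et ?f) (et ?f)) = (\<Prod>i\<in>I. fnorm (H i) (?f i))\<^sup>2"
    by (simp only: Re_complex_of_real)
  then have "fnorm HK (et ?f) = \<bar>\<Prod>i\<in>I. fnorm (H i) (?f i)\<bar>"
    unfolding fnorm_def[of HK] by (simp only: real_sqrt_abs)
  also have "\<dots> = (\<Prod>i\<in>I. fnorm (H i) (?f i))"
    by (intro abs_of_nonneg prod_nonneg hilbert_fun.fnorm_nonneg[OF factor_hilbert] f' ballI)
  also have "\<dots> = fnorm (H j) h * (\<Prod>i\<in>I - {j}. fnorm (H i) (f i))"
    using prod.remove[of I j "\<lambda>i. fnorm (H i) (?f i)"] j by (auto intro!: prod.cong)
  finally show ?thesis .
qed

text \<open>Disposes of the degenerate case: once \<open>Q\<close> is infinite dimensional, every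
  factor contains a unit vector.\<close>

lemma zero_factor:
  assumes j: "j \<in> I" and z: "Qi j = {0}"
  shows "finite_dimensional Q"
proof -
  have "F = 0" if "F \<in> Q" for F
  proof (rule orthogonal_to_tensors_zero[OF that])
    fix f assume "\<And>i. i \<in> I \<Longrightarrow> f i \<in> Qi i"
    then have "et f = 0" using elementary_tensor_zero[OF j, of f] z j by blast
    then show "finner HK (et f) F = 0" using that Q_subset by auto
  qed
  then show ?thesis unfolding finite_dimensional_def by (intro exI[of _ "{}"]) auto
qed

text \<open>Used contrapositively, to find an infinite dimensional factor. Tensors of generators
  span all tensors by multilinearity, and the closure adds nothing, because the residual of an
  orthonormal expansion is orthogonal to all tensors.\<close>

lemma finite_dimensional_factors:
  assumes fin: "\<And>i. i \<in> I \<Longrightarrow> finite_dimensional (Qi i)"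
  shows "finite_dimensional Q"
proof -
  have "\<forall>i\<in>I. \<exists>B. finite B \<and> B \<subseteq> Qi i \<and> Qi i \<subseteq> cfun.span B"
    using fin by (simp add: finite_dimensional_def)
  then obtain B where B: "\<And>i. i \<in> I \<Longrightarrow> finite (B i) \<and> B i \<subseteq> Qi i \<and> Qi i \<subseteq> cfun.span (B i)" by metis
  define S where "S = et ` (PiE I B)"
  have finS: "finite S" unfolding S_def using B by (intro finite_imageI finite_PiE) auto
  have SQ: "S \<subseteq> Q" unfolding S_def using B by (auto intro!: et_Q simp: PiE_def Pi_def) blast
  \<comment> \<open>\<open>J\<close> collects the slots that already range over all of
    \<open>Qi i\<close> instead of the generators \<open>B i\<close>.\<close>
  have et_span: "\<forall>f. (\<forall>i\<in>J. f i \<in> Qi i) \<and> (\<forall>i\<in>I - J. f i \<in> B i) \<longrightarrow> et f \<in> cfun.span S"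
    if "finite J" "J \<subseteq> I" for J
    using that
  proof (induction J rule: finite_induct)
    case empty
    have "et f \<in> cfun.span S" if "\<forall>i\<in>I. f i \<in> B i" for f
    proof -
      have "restrict f I \<in> PiE I B" using that by auto
      moreover have "et f = et (restrict f I)" by (rule elementary_tensor_cong) simp
      ultimately show ?thesis by (auto simp: S_def intro: cfun.span_base)
    qed
    then show ?case by simp
  next
    case (insert j J)
    have j: "j \<in> I" and IH: "\<And>f. (\<forall>i\<in>J. f i \<in> Qi i) \<Longrightarrow> (\<forall>i\<in>I - J. f i \<in> B i) \<Longrightarrow> et f \<in> cfun.span S"
      using insert by auto
    show ?case
    proof (intro allI impI)
      fix f assume f: "(\<forall>i\<in>insert j J. f i \<in> Qi i) \<and> (\<forall>i\<in>I - insert j J. f i \<in> B i)"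
      let ?T = "{h. et (f(j := h)) \<in> cfun.span S}"
      have "et (f(j := 0)) = 0" using elementary_tensor_zero[OF j, of "f(j := 0)"] by simp
      then have "cfun.subspace ?T"
        by (auto simp: cfun.subspace_def elementary_tensor_add[OF j] elementary_tensor_scale[OF j]
            cfun.span_add cfun.span_scale cfun.span_zero)
      moreover have "B j \<subseteq> ?T"
      proof
        fix b assume b: "b \<in> B j"
        have "et (f(j := b)) \<in> cfun.span S"
          by (rule IH) (use f b insert.hyps in auto)
        then show "b \<in> ?T" by simp
      qed
      ultimately have "cfun.span (B j) \<subseteq> ?T" by (rule cfun.span_minimal[rotated])
      then have "f j \<in> ?T" using f B[OF j] by blast
      then show "et f \<in> cfun.span S" by simp
    qed
  qed
  obtain E where E: "finite E" "HK.orthonormal E" "cfun.span E = cfun.span S"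
    using HK.finite_orthonormal_basis[OF finS] SQ Q_subset by blast
  have EV: "\<And>e. e \<in> E \<Longrightarrow> e \<in> fset HK" using E(2) by (auto simp: HK.orthonormal_def)
  have spanQ: "cfun.span E \<subseteq> Q" unfolding E(3) using SQ Q_subspace by (rule cfun.span_minimal)
  have "F \<in> cfun.span S" if F: "F \<in> Q" for F
  proof -
    define p where "p = (\<Sum>e\<in>E. cscale (finner HK F e) e)"
    have p: "p \<in> cfun.span E"
      unfolding p_def by (intro cfun.span_sum cfun.span_scale cfun.span_base)
    then have FpQ: "F - p \<in> Q" using F spanQ Q_subspace by (intro cfun.subspace_diff) auto
    have FpV: "F - p \<in> fset HK" using FpQ Q_subset by blast
    have res: "finner HK (F - p) e = 0" if "e \<in> E" for e
      unfolding p_def using HK.orthonormal_residual[OF E(1,2) _ that] F Q_subset by blast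
    have "F - p = 0"
    proof (rule orthogonal_to_tensors_zero[OF FpQ])
      fix f assume "\<And>i. i \<in> I \<Longrightarrow> f i \<in> Qi i"
      then have "et f \<in> cfun.span E" using et_span[of I] E(3) by simp
      then have "finner HK (et f) (F - p) = (\<Sum>e\<in>E. finner HK (et f) e * cnj (finner HK (F - p) e))"
        by (rule HK.Parseval_finite[OF E(1,2) _ FpV])
      then show "finner HK (et f) (F - p) = 0" using res by simp
    qed
    then show ?thesis using p E(3) by simp
  qed
  then show ?thesis using finS SQ unfolding finite_dimensional_def by blast
qed

text \<open>If \<open>Dj j\<close> did not kill a unit vector v, then v in slot \<open>j\<close> and
  an orthonormal sequence in slot \<open>i\<close> would give unit tensors whose images are
  equidistant, so without a Cauchy subsequence.\<close>

lemma compact_imp_normal_factor: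
  assumes i: "i \<in> I" and j: "j \<in> I" and ij: "i \<noteq> j"
    and inf: "\<not> finite_dimensional (Qi i)"
    and unit: "\<And>i. i \<in> I \<Longrightarrow> u i \<in> Qi i \<and> finner (H i) (u i) (u i) = 1"
    and comp: "compact_operator_on HK Q (cross_commutator HK Q (coord j) (coord j))"
    and f: "f \<in> Qi j"
  shows "Dj j f = 0"
proof (rule ccontr)
  assume D0: "Dj j f \<noteq> 0"
  interpret Hi: hilbert_fun "H i" using i by (rule factor_hilbert)
  interpret Hj: hilbert_fun "H j" using j by (rule factor_hilbert)
  let ?T = "cross_commutator HK Q (coord j) (coord j)"
  have f0: "f \<noteq> 0"
    using D0 Hj.bounded_opD(3)[OF bounded_Dj[OF j], of f 0] f by auto
  obtain v where v: "v \<in> Qi j" "finner (H j) v v = 1" "f \<in> cfun.span {v}"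
    using Hj.unit_vector[OF Qi_subspace[OF j] Qi_subset[OF j] f f0] by blast
  obtain c where "f = cscale c v" using v(3) by (auto simp: cfun.span_singleton)
  then have Dv: "Dj j v \<noteq> 0" using D0 Hj.bounded_opD(3)[OF bounded_Dj[OF j] v(1), of c] by auto
  obtain e :: "nat \<Rightarrow> complex \<Rightarrow> complex" where e: "\<And>m. e m \<in> Qi i"
    "\<And>m l. finner (H i) (e m) (e l) = (if m = l then 1 else 0)"
    using Hi.infinite_orthonormal_sequence[OF Qi_subspace[OF i] Qi_subset[OF i] inf] by blast
  define g where "g = u(j := v)"
  define g' where "g' = u(j := Dj j v)"
  have g: "g l \<in> Qi l \<and> fnorm (H l) (g l) = 1" if "l \<in> I" for l
    using unit[OF that] v by (auto simp: g_def fnorm_def)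
  have g': "g' l \<in> Qi l" "fnorm (H l) (g' l) \<noteq> 0" if l: "l \<in> I" for l
  proof -
    interpret Hl: hilbert_fun "H l" using l by (rule factor_hilbert)
    show mem: "g' l \<in> Qi l" using unit[OF l] factor_op_mem(3)[OF j v(1)] by (auto simp: g'_def)
    have "g' l \<noteq> 0"
      using Dv unit[OF l] Hl.inner_zero_left[of 0] by (auto simp: g'_def)
    then show "fnorm (H l) (g' l) \<noteq> 0" using Hl.fnorm_eq_0_iff Qi_mem[OF l mem] by blast
  qed
  \<comment> \<open>The contribution of all slots but \<open>i\<close> to the norm of an image,
    including that of \<open>Dj j v\<close> in slot \<open>j\<close>.\<close>
  define c where "c = (\<Prod>l\<in>I - {i}. fnorm (H l) (g' l))"
  have "c \<noteq> 0" using g' by (simp add: c_def)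
  define s where "s m = et (g(i := e m))" for m
  have gm: "(g(i := e m)) l \<in> Qi l" if "l \<in> I" for l m using g[OF that] e(1) by auto
  have s: "s m \<in> Q \<and> fnorm HK (s m) \<le> 1" for m
  proof
    show "s m \<in> Q" unfolding s_def by (rule et_Q) (rule gm)
    have "fnorm HK (s m) = fnorm (H i) (e m) * (\<Prod>l\<in>I - {i}. fnorm (H l) (g l))"
      unfolding s_def using g e(1) by (intro fnorm_et_upd[OF i]) auto
    also have "\<dots> = 1" using g e(2)[of m m] by (simp add: fnorm_def)
    finally show "fnorm HK (s m) \<le> 1" by simp
  qed
  have Ts: "?T (s m) = et (g'(i := e m))" for m
  proof -
    have "?T (s m) = et ((g(i := e m))(j := Dj j ((g(i := e m)) j)))"
      unfolding s_def by (rule cross_commutator_et[OF j]) (rule gm)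
    also have "(g(i := e m))(j := Dj j ((g(i := e m)) j)) = g'(i := e m)"
      using ij by (auto simp: g_def g'_def fun_eq_iff)
    finally show ?thesis .
  qed
  have dist: "fnorm HK (?T (s m) - ?T (s l)) = sqrt 2 * c" if "m \<noteq> l" for m l
  proof -
    have d: "e m - e l \<in> Qi i" using e(1) Qi_subspace[OF i] by (simp add: cfun.subspace_diff)
    have eV: "\<And>m. e m \<in> fset (H i)" using e(1) Qi_mem[OF i] by blast
    have "finner (H i) (e m - e l) (e m - e l) = 2"
      using that eV e(2) by (simp add: Hi.inner_diff_left Hi.inner_diff_right)
    then have "fnorm (H i) (e m - e l) = sqrt 2" by (simp add: fnorm_def)
    then show ?thesis
      unfolding Ts elementary_tensor_diff[OF i, symmetric]
      using g' d by (subst fnorm_et_upd[OF i]) (auto simp: c_def)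
  qed
  \<comment> \<open>The sign is read off from the distance: sqrt 2 * c is the norm of a difference,
    hence nonnegative, and c is nonzero.\<close>
  have "c > 0"
  proof -
    have "0 \<le> fnorm HK (?T (s 0) - ?T (s 1))"
      using HK.bounded_opD(1)[OF bounded_cross_commutator[OF j j]] s Q_subset
      by (intro HK.fnorm_nonneg HK.diff_mem) blast+
    then show ?thesis using dist[of 0 1] \<open>c \<noteq> 0\<close> by (simp add: zero_le_mult_iff)
  qed
  obtain r :: "nat \<Rightarrow> nat" where r: "strict_mono r"
    "\<forall>e>0. \<exists>N. \<forall>m\<ge>N. \<forall>l\<ge>N. fnorm HK (?T (s (r m)) - ?T (s (r l))) < e"
    using comp s unfolding HK.compact_operator_on_iff[OF Q_subset] by blast
  then obtain N where N: "\<forall>m\<ge>N. \<forall>l\<ge>N. fnorm HK (?T (s (r m)) - ?T (s (r l))) < sqrt 2 * c"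
    using \<open>c > 0\<close> by (metis mult_pos_pos real_sqrt_gt_zero zero_less_numeral)
  have "r N \<noteq> r (Suc N)" using r(1) by (metis lessI less_irrefl strict_mono_def)
  then show False using N dist[of "r N" "r (Suc N)"] by (metis le_SucI less_irrefl order_refl)
qed

section \<open>Passing between the tensor product and a single factor\<close>

lemma unit_factors:
  assumes "\<And>i. i \<in> I \<Longrightarrow> Qi i \<noteq> {0}"
  obtains u where "\<And>i. i \<in> I \<Longrightarrow> u i \<in> Qi i \<and> finner (H i) (u i) (u i) = 1"
proof -
  have "\<exists>u. u \<in> Qi i \<and> finner (H i) u u = 1" if i: "i \<in> I" for i
  proof -
    obtain f where "f \<in> Qi i" "f \<noteq> 0"
      using assms[OF i] cfun.subspace_0[OF Qi_subspace[OF i]] by blast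
    then show ?thesis
      using hilbert_fun.unit_vector[OF factor_hilbert[OF i] Qi_subspace[OF i] Qi_subset[OF i]] by metis
  qed
  then show thesis using that by metis
qed

text \<open>Unit vectors in the other slots turn slot \<open>i\<close> into an isometric copy of
  \<open>Qi i\<close> inside \<open>Q\<close> that respects the self-commutators; Cauchy
  subsequences can be carried along it in both directions.\<close>

lemma slot_isometry:
  assumes i: "i \<in> I" and u: "\<And>l. l \<in> I \<Longrightarrow> l \<noteq> i \<Longrightarrow> u l \<in> Qi l \<and> finner (H l) (u l) (u l) = 1"
    and f: "f \<in> Qi i"
  shows slot_mem: "et (u(i := f)) \<in> Q"
    and slot_norm: "fnorm HK (et (u(i := f))) = fnorm (H i) f"
    and slot_commutator: "cross_commutator HK Q (coord i) (coord i) (et (u(i := f))) = et (u(i := Dj i f))"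
proof -
  have uf: "(u(i := f)) l \<in> Qi l" if "l \<in> I" for l using u f that by auto
  show "et (u(i := f)) \<in> Q" by (rule et_Q) (rule uf)
  have "fnorm HK (et (u(i := f))) = fnorm (H i) f * (\<Prod>l\<in>I - {i}. fnorm (H l) (u l))"
    by (rule fnorm_et_upd[OF i _ f]) (use u in auto)
  also have "(\<Prod>l\<in>I - {i}. fnorm (H l) (u l)) = 1"
    using u by (intro prod.neutral) (auto simp: fnorm_def)
  finally show "fnorm HK (et (u(i := f))) = fnorm (H i) f" by (simp only: mult_1_right)
  show "cross_commutator HK Q (coord i) (coord i) (et (u(i := f))) = et (u(i := Dj i f))"
    using cross_commutator_et[OF i, of "u(i := f)"] uf by simp
qed

lemma slot_norm_diff:
  assumes i: "i \<in> I" and u: "\<And>l. l \<in> I \<Longrightarrow> l \<noteq> i \<Longrightarrow> u l \<in> Qi l \<and> finner (H l) (u l) (u l) = 1"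
    and "f \<in> Qi i" "g \<in> Qi i"
  shows "fnorm HK (et (u(i := f)) - et (u(i := g))) = fnorm (H i) (f - g)"
  unfolding elementary_tensor_diff[OF i, symmetric]
  using assms Qi_subspace[OF i] by (intro slot_norm) (auto simp: cfun.subspace_diff)

lemma compact_factor:
  assumes i: "i \<in> I" and u: "\<And>l. l \<in> I \<Longrightarrow> l \<noteq> i \<Longrightarrow> u l \<in> Qi l \<and> finner (H l) (u l) (u l) = 1"
    and comp: "compact_operator_on HK Q (cross_commutator HK Q (coord i) (coord i))"
  shows "compact_operator_on (H i) (Qi i) (Dj i)"
proof -
  interpret Hi: hilbert_fun "H i" using i by (rule factor_hilbert)
  show ?thesis
    unfolding Hi.compact_operator_on_iff[OF Qi_subset[OF i]]
  proof (intro conjI allI impI)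
    show "Dj i ` Qi i \<subseteq> Qi i" using factor_op_mem(3)[OF i] by blast
    fix s :: "nat \<Rightarrow> complex \<Rightarrow> complex"
    assume s: "\<forall>m. s m \<in> Qi i \<and> fnorm (H i) (s m) \<le> 1"
    let ?T = "cross_commutator HK Q (coord i) (coord i)" and ?J = "\<lambda>f. et (u(i := f))"
    have Js: "\<forall>m. ?J (s m) \<in> Q \<and> fnorm HK (?J (s m)) \<le> 1"
      using s slot_mem[OF i u] slot_norm[OF i u] by simp
    obtain r :: "nat \<Rightarrow> nat" where r: "strict_mono r"
      "\<forall>e>0. \<exists>N. \<forall>m\<ge>N. \<forall>l\<ge>N. fnorm HK (?T (?J (s (r m))) - ?T (?J (s (r l)))) < e"
      using HK.compact_operator_onD[OF Q_subset comp Js] by (elim exE conjE)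
    have "fnorm HK (?T (?J (s a)) - ?T (?J (s b))) = fnorm (H i) (Dj i (s a) - Dj i (s b))" for a b
      using s slot_commutator[OF i u] slot_norm_diff[OF i u] factor_op_mem(3)[OF i] by simp
    then show "\<exists>r. strict_mono (r :: nat \<Rightarrow> nat) \<and>
        (\<forall>e>0. \<exists>N. \<forall>m\<ge>N. \<forall>l\<ge>N. fnorm (H i) (Dj i (s (r m)) - Dj i (s (r l))) < e)"
      using r by auto
  qed
qed

text \<open>The candidate h is the Riesz representative of the functional that pairs the copy of f
  with F. The difference of F and the copy of h is orthogonal to all tensors, since each tensor is a
  multiple of some copy.\<close>

lemma slot_surjective:
  assumes i: "i \<in> I" and u: "\<And>l. l \<in> I \<Longrightarrow> l \<noteq> i \<Longrightarrow> u l \<in> Qi l \<and> finner (H l) (u l) (u l) = 1"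
    and one: "\<And>l. l \<in> I \<Longrightarrow> l \<noteq> i \<Longrightarrow> Qi l = cfun.span {u l}"
    and F: "F \<in> Q"
  obtains h where "h \<in> Qi i" "F = et (u(i := h))"
proof -
  interpret Hi: hilbert_fun "H i" using i by (rule factor_hilbert)
  let ?J = "\<lambda>f. et (u(i := f))"
  have FV: "F \<in> fset HK" using F Q_subset by blast
  have JV: "?J f \<in> fset HK" if "f \<in> Qi i" for f using slot_mem[OF i u that] Q_subset by blast
  have JJ: "finner HK (?J f) (?J g) = finner (H i) f g" if "f \<in> Qi i" "g \<in> Qi i" for f g
  proof -
    have "(u(i := f)) l \<in> fset (H l)" "(u(i := g)) l \<in> fset (H l)" if "l \<in> I" for l
      using u \<open>f \<in> Qi i\<close> \<open>g \<in> Qi i\<close> Qi_mem that by (auto split: if_splits)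
    then have "finner HK (?J f) (?J g) = (\<Prod>l\<in>I. finner (H l) ((u(i := f)) l) ((u(i := g)) l))"
      by (rule et_inner)
    also have "\<dots> = finner (H i) f g * (\<Prod>l\<in>I - {i}. finner (H l) (u l) (u l))"
      using prod.remove[of I i "\<lambda>l. finner (H l) ((u(i := f)) l) ((u(i := g)) l)"] i
      by (auto intro!: prod.cong)
    also have "(\<Prod>l\<in>I - {i}. finner (H l) (u l) (u l)) = 1" using u by (intro prod.neutral) auto
    finally show ?thesis by (simp only: mult_1_right)
  qed
  have bound: "cmod (finner HK (?J f) F) \<le> fnorm HK F * fnorm (H i) f" if "f \<in> Qi i" for f
    using HK.Cauchy_Schwarz[OF JV[OF that] FV] slot_norm[OF i u that] by (simp add: mult.commute)
  obtain h where h: "h \<in> Qi i" "\<And>f. f \<in> Qi i \<Longrightarrow> finner HK (?J f) F = finner (H i) f h"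
  proof (rule Hi.Riesz_representation[OF Qi_closed[OF i], where \<phi> = "\<lambda>f. finner HK (?J f) F" and C = "fnorm HK F"])
    show "finner HK (?J (f + g)) F = finner HK (?J f) F + finner HK (?J g) F"
      if "f \<in> Qi i" "g \<in> Qi i" for f g
      unfolding elementary_tensor_add[OF i] using JV that FV by (intro HK.inner_add_left)
    show "finner HK (?J (cscale c f)) F = c * finner HK (?J f) F" if "f \<in> Qi i" for c f
      unfolding elementary_tensor_scale[OF i] using JV that FV by (intro HK.inner_scale_left)
  qed (use bound in blast)+
  have FJ: "F - ?J h \<in> Q" using F slot_mem[OF i u h(1)] Q_subspace by (intro cfun.subspace_diff)
  have "F - ?J h = 0"
  proof (rule orthogonal_to_tensors_zero[OF FJ])
    fix f assume f: "\<And>l. l \<in> I \<Longrightarrow> f l \<in> Qi l"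
    have "\<forall>l\<in>I - {i}. \<exists>c. f l = cscale c (u l)"
    proof
      fix l assume l: "l \<in> I - {i}"
      then have "f l \<in> cfun.span {u l}" using f[of l] one[of l] by simp
      then show "\<exists>c. f l = cscale c (u l)" by (auto simp: cfun.span_singleton)
    qed
    then obtain c where c: "\<And>l. l \<in> I - {i} \<Longrightarrow> f l = cscale (c l) (u l)" by metis
    \<comment> \<open>Every slot other than \<open>i\<close> contributes a scalar, and the scalars
      collect in front.\<close>
    have "et f = cscale (\<Prod>l\<in>I - {i}. c l) (?J (f i))"
    proof
      fix z
      show "et f z = cscale (\<Prod>l\<in>I - {i}. c l) (?J (f i)) z"
      proof (cases "z \<in> polydisc n")
        case True
        have "et (f(i := f i)) z = f i (z i) * (\<Prod>l\<in>I - {i}. c l * u l (z l))"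
          unfolding elementary_tensor_upd[OF i True] using c by (simp add: cscale_def)
        then show ?thesis
          by (simp add: elementary_tensor_upd[OF i True] cscale_def prod.distrib)
      qed (simp add: elementary_tensor_outside cscale_def)
    qed
    moreover have "finner HK (?J (f i)) (F - ?J h) = 0"
      using HK.inner_diff_right[OF JV[OF f[OF i]] FV JV[OF h(1)]] h f[OF i] JJ by simp
    ultimately show "finner HK (et f) (F - ?J h) = 0"
      using HK.inner_scale_left[OF JV[OF f[OF i]]] FJ Q_subset by auto
  qed
  then show thesis using that h(1) by simp
qed

section \<open>The two implications\<close>

lemma one_dimensional_normal:
  assumes l: "l \<in> I" and u: "Qi l = cfun.span {u}"
  shows "Dj l u = 0"
proof -
  interpret Hl: hilbert_fun "H l" using l by (rule factor_hilbert)
  have uQ: "u \<in> Qi l" using u by (simp add: cfun.span_base)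
  obtain c where c: "Cj l u = cscale c u"
    using factor_op_mem(1)[OF l uQ] u by (auto simp: cfun.span_singleton)
  obtain d where d: "Aj l u = cscale d u"
    using factor_op_mem(2)[OF l uQ] u by (auto simp: cfun.span_singleton)
  show ?thesis
    unfolding cross_commutator_def commutator_def c d
    using Hl.bounded_opD(3)[OF bounded_Cj[OF l] uQ] Hl.bounded_opD(3)[OF bounded_Aj[OF l] uQ] c d
    by (simp add: mult.commute)
qed

text \<open>\<open>Q\<close> is an isometric copy of \<open>Qi i\<close>. The only cross commutator
  that can be nonzero is that of slot \<open>i\<close> with itself, and its compactness is
  transported along the copy.\<close>

lemma essentially_normal_one_infinite_factor:
  assumes i: "i \<in> I" and en: "essentially_normal (H i) {\<lambda>z. z} (Qi i)"
    and one: "\<And>l. l \<in> I \<Longrightarrow> l \<noteq> i \<Longrightarrow> cfun.dim (Qi l) = 1"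
  shows "essentially_normal HK (coords n) Q"
proof -
  interpret Hi: hilbert_fun "H i" using i by (rule factor_hilbert)
  have "\<exists>u. u \<in> Qi l \<and> finner (H l) u u = 1 \<and> Qi l = cfun.span {u}" if l: "l \<in> I" "l \<noteq> i" for l
  proof -
    interpret Hl: hilbert_fun "H l" using l(1) by (rule factor_hilbert)
    obtain b where b: "b \<in> Qi l" "b \<noteq> 0" "Qi l = cfun.span {b}"
      using one_dimensional_span[OF Qi_subspace[OF l(1)] one[OF l]] by blast
    obtain u where u: "u \<in> Qi l" "finner (H l) u u = 1" "b \<in> cfun.span {u}"
      using Hl.unit_vector[OF Qi_subspace[OF l(1)] Qi_subset[OF l(1)] b(1,2)] by blast
    have "cfun.span {b} \<subseteq> cfun.span {u}" using u(3) by (intro cfun.span_minimal) auto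
    moreover have "cfun.span {u} \<subseteq> Qi l"
      using u(1) Qi_subspace[OF l(1)] by (intro cfun.span_minimal) auto
    ultimately show ?thesis using u b(3) by blast
  qed
  then obtain u where u: "\<And>l. l \<in> I \<Longrightarrow> l \<noteq> i \<Longrightarrow> u l \<in> Qi l \<and> finner (H l) (u l) (u l) = 1"
    and u1: "\<And>l. l \<in> I \<Longrightarrow> l \<noteq> i \<Longrightarrow> Qi l = cfun.span {u l}"
    by metis
  let ?J = "\<lambda>f. et (u(i := f))"
  have surj: "\<exists>f. f \<in> Qi i \<and> F = ?J f" if "F \<in> Q" for F
    using slot_surjective[OF i u u1 that] by blast
  have Jf: "(u(i := f)) l \<in> Qi l" if "f \<in> Qi i" "l \<in> I" for f l using u that by auto
  show ?thesis
    unfolding essentially_normal_def coords_def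
  proof clarify
    fix a b assume a: "a \<in> I" and b: "b \<in> I"
    let ?T = "cross_commutator HK Q (coord a) (coord b)"
    note TQ = HK.bounded_opD(1)[OF bounded_cross_commutator[OF a b]]
    show "compact_operator_on HK Q ?T"
    proof (cases "a = i \<and> b = i")
      case True
      have comp: "compact_operator_on (H i) (Qi i) (Dj i)"
        using en by (simp add: essentially_normal_def)
      show ?thesis
        unfolding HK.compact_operator_on_iff[OF Q_subset]
      proof (intro conjI allI impI)
        show "?T ` Q \<subseteq> Q" using TQ by blast
        fix s :: "nat \<Rightarrow> (nat \<Rightarrow> complex) \<Rightarrow> complex"
        assume s: "\<forall>m. s m \<in> Q \<and> fnorm HK (s m) \<le> 1"
        have "\<exists>f. f \<in> Qi i \<and> s m = ?J f" for m by (rule surj) (use s in blast)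
        then have "\<forall>m. \<exists>f. f \<in> Qi i \<and> s m = ?J f" ..
        from choice[OF this] obtain t where t': "\<forall>m. t m \<in> Qi i \<and> s m = ?J (t m)" by (elim exE)
        then have t: "\<And>m. t m \<in> Qi i" "\<And>m. s m = ?J (t m)" by auto
        have tQ: "\<forall>m. t m \<in> Qi i \<and> fnorm (H i) (t m) \<le> 1"
          using s t slot_norm[OF i u t(1)] by simp
        obtain r :: "nat \<Rightarrow> nat" where r: "strict_mono r"
          "\<forall>e>0. \<exists>N. \<forall>m\<ge>N. \<forall>l\<ge>N. fnorm (H i) (Dj i (t (r m)) - Dj i (t (r l))) < e"
          using Hi.compact_operator_onD[OF Qi_subset[OF i] comp tQ] by (elim exE conjE)
        have "fnorm HK (?T (s m) - ?T (s l)) = fnorm (H i) (Dj i (t m) - Dj i (t l))" for m l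
          using True t slot_commutator[OF i u] slot_norm_diff[OF i u] factor_op_mem(3)[OF i] by simp
        then show "\<exists>r. strict_mono (r :: nat \<Rightarrow> nat) \<and>
            (\<forall>e>0. \<exists>N. \<forall>m\<ge>N. \<forall>l\<ge>N. fnorm HK (?T (s (r m)) - ?T (s (r l))) < e)"
          using r by auto
      qed
    next
      case False
      \<comment> \<open>For a = b the slot is one dimensional, where the compression and its adjoint
        act as scalars; distinct slots commute.\<close>
      have T0: "?T F = 0" if F: "F \<in> Q" for F
      proof -
        obtain f where f: "f \<in> Qi i" "F = ?J f" using surj[OF F] by blast
        show ?thesis
        proof (cases "a = b")
          case True
          then have ai: "a \<noteq> i" using False by blast
          have "?T F = et ((u(i := f))(a := Dj a ((u(i := f)) a)))"
            unfolding f(2) True[symmetric] by (rule cross_commutator_et[OF a]) (rule Jf[OF f(1)])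
          also have "\<dots> = 0"
            using one_dimensional_normal[OF a u1[OF a ai]] ai
            by (intro elementary_tensor_zero[OF a]) simp
          finally show ?thesis .
        next
          case False
          then show ?thesis
            unfolding f(2) by (rule cross_commutator_et_distinct[OF a b]) (rule Jf[OF f(1)])
        qed
      qed
      show ?thesis
        unfolding HK.compact_operator_on_iff[OF Q_subset]
        using T0 TQ by (auto intro!: exI[of _ id] simp: strict_mono_def)
    qed
  qed
qed

lemma essentially_normal_finite_dimensional:
  assumes "finite_dimensional Q"
  shows "essentially_normal HK (coords n) Q"
  unfolding essentially_normal_def coords_def
  using HK.finite_dimensional_compact_operator[OF Q_subspace Q_subset assms bounded_cross_commutator]
  by blast

lemma essentially_normal_imp:
  assumes en: "essentially_normal HK (coords n) Q" and inf: "\<not> finite_dimensional Q"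
  shows "\<exists>i\<in>I. \<not> finite_dimensional (Qi i) \<and> essentially_normal (H i) {\<lambda>z. z} (Qi i) \<and>
    (\<forall>j\<in>I - {i}. cfun.dim (Qi j) = 1)"
proof -
  have comp: "compact_operator_on HK Q (cross_commutator HK Q (coord j) (coord j))" if "j \<in> I" for j
    using en that by (auto simp: essentially_normal_def coords_def)
  have nonzero: "Qi i \<noteq> {0}" if "i \<in> I" for i using zero_factor[OF that] inf by blast
  obtain u where u: "\<And>i. i \<in> I \<Longrightarrow> u i \<in> Qi i \<and> finner (H i) (u i) (u i) = 1"
    using unit_factors nonzero by metis
  obtain i where i: "i \<in> I" "\<not> finite_dimensional (Qi i)" using finite_dimensional_factors inf by blast
  have "cfun.dim (Qi j) = 1" if j: "j \<in> I" "j \<noteq> i" for j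
  proof -
    interpret Hj: disc_module "k j" "H j" using j(1) by (rule factor)
    have "Dj j f = 0" if "f \<in> Qi j" for f
      using compact_imp_normal_factor[OF i(1) j(1) j(2)[symmetric] i(2) u comp[OF j(1)] that] .
    then obtain f0 where f0: "f0 \<in> Qi j" "Qi j = cfun.span {f0}"
      using Hj.normal_quotient_one_dimensional[OF factor_quotient[OF j(1)]] by blast
    \<comment> \<open>Normality leaves dimension 0 or 1; a zero factor would make \<open>Q\<close>
      finite dimensional.\<close>
    have "cfun.span {0} = ({0} :: (complex \<Rightarrow> complex) set)" by simp
    then have "f0 \<noteq> 0" using f0(2) nonzero[OF j(1)] by metis
    then show ?thesis unfolding f0(2) by (rule dim_span_singleton)
  qed
  moreover have "essentially_normal (H i) {\<lambda>z. z} (Qi i)"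
    using compact_factor[OF i(1) u comp[OF i(1)]] by (simp add: essentially_normal_def)
  ultimately show ?thesis using i by blast
qed

end

theorem theorem3p2:
  fixes n :: nat
    and k :: "nat \<Rightarrow> complex \<Rightarrow> complex \<Rightarrow> complex"
    and H :: "nat \<Rightarrow> complex fun_hilbert"
    and HK :: "(nat \<Rightarrow> complex) fun_hilbert"
    and Qi :: "nat \<Rightarrow> (complex \<Rightarrow> complex) set"
    and Q :: "((nat \<Rightarrow> complex) \<Rightarrow> complex) set"
  assumes "n \<ge> 2"
    and "analytic_hilbert_module_polydisc n k H HK"
    and "\<And>i. i \<in> {1..n} \<Longrightarrow> quotient_module (H i) {\<lambda>z. z} (Qi i)"
    and "Q = tensor_subspace HK n Qi"
    and "quotient_module HK (coords n) Q"
    and "doubly_commuting HK n Q"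
  shows "essentially_normal HK (coords n) Q \<longleftrightarrow>
      finite_dimensional Q \<or>
      (\<exists>i\<in>{1..n}.
         \<not> finite_dimensional (Qi i) \<and> essentially_normal (H i) {\<lambda>z. z} (Qi i) \<and>
         (\<forall>j\<in>{1..n} - {i}. cfun.dim (Qi j) = 1))"
proof -
  interpret tensor_quotient n k H HK Qi Q
    using assms by unfold_locales (auto simp: quotient_module_def)
  show ?thesis
    using essentially_normal_finite_dimensional essentially_normal_one_infinite_factor
      essentially_normal_imp by blast
qed

end
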